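(* Let $\Sigma$ be a free boundary minimal Möbius band in the unit ball $B^n$ such that the coordinate functions restricted to $\Sigma$ are first Steklov eigenfunctions of $\Sigma$ with its induced metric. Then $n=4$ and $\Sigma$ is the critical Möbius band (up to congruence).
   Context: A free boundary minimal surface in $B^n$ is a minimal surface properly immersed in $B^n$ whose outward unit conormal along its boundary equals the outward unit normal of $\partial B^n$. First Steklov eigenfunctions are eigenfunctions of the Dirichlet-to-Neumann map for its first nonzero eigenvalue. The critical Möbius band is the image of $\varphi(t,\theta)=(2\sinh t\cos\theta,2\sinh t\sin\theta,\cosh2t\cos2\theta,\cosh2t\sin2\theta)$ restricted to $[-T_0,T_0]\times S^1$ modulo $(t,\theta)\sim(-t,\theta+\pi)$, where $T_0$ is the unique positive solution of $\coth t=2\tanh2t$, rescaled to lie as a free boundary surface in the unit ball $B^4$.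
   Formalization: Σ is assumed not to lie in a hyperplane through the origin (otherwise n = 4 fails: the critical band in B^4 inside B^5, rotated), and Σ is given by a conformal parametrization by [-T,T]×S^1 modulo (t,θ)~(-t,θ+π), as uniformization provides. *)

theory Defs
  imports "HOL-Analysis.Analysis"
begin

text \<open>A Moebius band is parametrized conformally (every Moebius band is conformally
  equivalent to such a model) by the strip [-T,T] x R, where maps are 2pi-periodic in
  the second variable and invariant under the involution (t,theta) -> (-t, theta+pi).\<close>

definition strip :: "real \<Rightarrow> (real \<times> real) set" where
  "strip T = {-T..T} \<times> UNIV"

definition mobius_sym :: "real \<Rightarrow> (real \<times> real \<Rightarrow> 'a) \<Rightarrow> bool" where
  "mobius_sym T f \<longleftrightarrow> (\<forall>t \<theta>. t \<in> {-T..T} \<longrightarrow>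
      f (t, \<theta> + 2*pi) = f (t, \<theta>) \<and> f (-t, \<theta> + pi) = f (t, \<theta>))"

definition dt :: "real \<Rightarrow> (real \<times> real \<Rightarrow> 'a::real_normed_vector) \<Rightarrow> real \<times> real \<Rightarrow> 'a" where
  "dt T f = (\<lambda>(t,\<theta>). vector_derivative (\<lambda>s. f (s, \<theta>)) (at t within {-T..T}))"

definition dth :: "(real \<times> real \<Rightarrow> 'a::real_normed_vector) \<Rightarrow> real \<times> real \<Rightarrow> 'a" where
  "dth f = (\<lambda>(t,\<theta>). vector_derivative (\<lambda>\<phi>. f (t, \<phi>)) (at \<theta>))"

definition C1_strip :: "real \<Rightarrow> (real \<times> real \<Rightarrow> 'a::real_normed_vector) \<Rightarrow> bool" where
  "C1_strip T f \<longleftrightarrow> continuous_on (strip T) f \<and>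
     (\<forall>t \<theta>. t \<in> {-T..T} \<longrightarrow>
        (\<lambda>s. f (s, \<theta>)) differentiable (at t within {-T..T}) \<and>
        (\<lambda>\<phi>. f (t, \<phi>)) differentiable (at \<theta>)) \<and>
     continuous_on (strip T) (dt T f) \<and> continuous_on (strip T) (dth f)"

definition C2_strip :: "real \<Rightarrow> (real \<times> real \<Rightarrow> 'a::real_normed_vector) \<Rightarrow> bool" where
  "C2_strip T f \<longleftrightarrow> C1_strip T f \<and> C1_strip T (dt T f) \<and> C1_strip T (dth f)"

text \<open>Harmonic w.r.t. the induced metric = harmonic in conformal coordinates (2D).\<close>
definition harmonic_strip :: "real \<Rightarrow> (real \<times> real \<Rightarrow> 'a::real_normed_vector) \<Rightarrow> bool" where
  "harmonic_strip T f \<longleftrightarrow> C2_strip T f \<and>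
     (\<forall>p \<in> strip T. dt T (dt T f) p + dth (dth f) p = 0)"

text \<open>u is a conformal parametrization of a (branch-point free) free boundary minimal
  Moebius band in the unit ball: conformal harmonic immersion, interior in the open ball,
  boundary on the sphere, outward conormal equal to the position vector.\<close>
definition fb_minimal_mobius :: "real \<Rightarrow> (real \<times> real \<Rightarrow> 'a::euclidean_space) \<Rightarrow> bool" where
  "fb_minimal_mobius T u \<longleftrightarrow> T > 0 \<and> mobius_sym T u \<and> harmonic_strip T u \<and>
     (\<forall>p \<in> strip T. dt T u p \<noteq> 0 \<and> norm (dt T u p) = norm (dth u p) \<and>
                    inner (dt T u p) (dth u p) = 0) \<and>
     (\<forall>t \<theta>. \<bar>t\<bar> < T \<longrightarrow> norm (u (t, \<theta>)) < 1) \<and>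
     (\<forall>\<theta>. norm (u (T, \<theta>)) = 1 \<and> norm (u (-T, \<theta>)) = 1) \<and>
     (\<forall>\<theta>. dt T u (T, \<theta>) = norm (dt T u (T, \<theta>)) *\<^sub>R u (T, \<theta>) \<and>
          dt T u (-T, \<theta>) = - (norm (dt T u (-T, \<theta>)) *\<^sub>R u (-T, \<theta>)))"

text \<open>Steklov eigenfunctions (eigenfunctions of the Dirichlet-to-Neumann map) of the
  surface with the induced metric g = |u_t|^2 (dt^2 + dtheta^2): harmonic functions f with
  outward normal derivative d f / d nu = sigma f on the boundary, where at t = T the
  outward unit normal is (1/|u_t|) d/dt and at t = -T it is -(1/|u_t|) d/dt.\<close>
definition steklov_eigenfunction ::
  "real \<Rightarrow> (real \<times> real \<Rightarrow> 'a::euclidean_space) \<Rightarrow> real \<Rightarrow> (real \<times> real \<Rightarrow> real) \<Rightarrow> bool" where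
  "steklov_eigenfunction T u \<sigma> f \<longleftrightarrow> mobius_sym T f \<and> harmonic_strip T f \<and>
     (\<exists>p \<in> strip T. f p \<noteq> 0) \<and>
     (\<forall>\<theta>. dt T f (T, \<theta>) = \<sigma> * norm (dt T u (T, \<theta>)) * f (T, \<theta>) \<and>
          - dt T f (-T, \<theta>) = \<sigma> * norm (dt T u (-T, \<theta>)) * f (-T, \<theta>))"

definition steklov_eigenvalue :: "real \<Rightarrow> (real \<times> real \<Rightarrow> 'a::euclidean_space) \<Rightarrow> real \<Rightarrow> bool" where
  "steklov_eigenvalue T u \<sigma> \<longleftrightarrow> (\<exists>f. steklov_eigenfunction T u \<sigma> f)"

definition sigma1 :: "real \<Rightarrow> (real \<times> real \<Rightarrow> 'a::euclidean_space) \<Rightarrow> real" where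
  "sigma1 T u = Inf {\<sigma>. \<sigma> > 0 \<and> steklov_eigenvalue T u \<sigma>}"

definition first_steklov_eigenfunction ::
  "real \<Rightarrow> (real \<times> real \<Rightarrow> 'a::euclidean_space) \<Rightarrow> (real \<times> real \<Rightarrow> real) \<Rightarrow> bool" where
  "first_steklov_eigenfunction T u f \<longleftrightarrow> steklov_eigenfunction T u (sigma1 T u) f"

definition T0 :: real where
  "T0 = (THE t. t > 0 \<and> cosh t / sinh t = 2 * tanh (2 * t))"

definition crit_phi :: "real \<times> real \<Rightarrow> real ^ 4" where
  "crit_phi = (\<lambda>(t,\<theta>). vector [2 * sinh t * cos \<theta>, 2 * sinh t * sin \<theta>,
                                 cosh (2*t) * cos (2*\<theta>), cosh (2*t) * sin (2*\<theta>)])"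

definition critical_mobius_band :: "(real ^ 4) set" where
  "critical_mobius_band =
     (\<lambda>p. (1 / sqrt (4 * (sinh T0)\<^sup>2 + (cosh (2 * T0))\<^sup>2)) *\<^sub>R crit_phi p) ` strip T0"

end

theory Submission
  imports Defs
begin

text \<open>
  Write \<open>h\<close> for the boundary values of \<open>u\<close> at \<open>t = T\<close> and \<open>lam = \<bar>u\<^sub>t\<bar> = \<bar>h'\<bar>\<close> for the boundary density.
  On boundary values the Dirichlet-to-Neumann operator is a Fourier multiplier \<open>Lam\<close>, and the
  free boundary condition reads \<open>Lam h = lam h\<close>. As the coordinates are first eigenfunctions, the
  form \<open>Q(g) = \<integral> (Lam g) g - lam g\<^sup>2\<close> is nonnegative on all \<open>g\<close> with \<open>\<integral> lam g = 0\<close>. The field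
  \<open>Lam h - i h'\<close> is the boundary value of a holomorphic one, so its products with suitable
  holomorphic functions yield fields \<open>U = w - (w \<bullet> h) h + (b\<^sub>w + c) h'\<close>, parametrized by a vector \<open>w\<close>
  and a number \<open>c\<close>, with \<open>Q(U) = 2 \<integral> lam (w \<bullet> h)\<^sup>2 - \<bar>w\<bar>\<^sup>2 \<integral> lam\<close>. This is negative for \<open>w \<noteq> 0\<close>,
  because no constant vector is tangent to a Moebius band everywhere. A dimension count
  produces an admissible \<open>U \<noteq> 0\<close>; hence \<open>w = 0\<close>, the field \<open>h'\<close> is admissible with \<open>Q(h') = 0\<close>,
  and minimality forces \<open>Lam h' = lam h'\<close>, that is, \<open>lam\<close> is constant. Then only the
  Fourier modes \<open>1\<close> and \<open>2\<close> survive in \<open>u\<close>, and conformality along the core circle determines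
  their coefficients up to congruence.
\<close>

section \<open>Fourier coefficients of periodic functions\<close>

text \<open>\<open>sigma1\<close> is only the infimum of the positive eigenvalues that have C2
  eigenfunctions, so the sign of \<open>Q\<close> is not part of any definition: a violating
  \<open>g\<close> must be turned into a genuine eigenfunction with eigenvalue below 1, which takes
  compactness and then regularity. The involution makes the boundary line \<open>t = -T\<close> a
  rotated copy of \<open>t = T\<close>, so all analysis takes place on one circle, and the
  multiplier \<open>mu\<close> remembers the twist through the parity of the mode. The holomorphic
  factor must respect the twist as well: conjugation combined with the involution sends
  \<open>u_t - i u_theta\<close> to its negative, and only a factor with the same behaviour gives a
  product whose real part lives on the band. Real constants fail this, imaginary ones satisfy it;
  hence the parameter \<open>c\<close> and the dimension \<open>n + 1\<close>. As \<open>u\<close>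
  is merely C2 up to the boundary while the fields involve \<open>1 / lam\<close> and derivatives of
  \<open>phi\<close>, regularity has to be gained. Weighted Wiener algebras serve for this because
  products and the multiplier are both controlled by absolute sums of coefficients.\<close>

definition mode :: "int \<Rightarrow> real \<Rightarrow> complex" where
  "mode k x = cis (of_int k * x)"

lemma norm_mode [simp]: "norm (mode k x) = 1"
  by (simp add: mode_def)

lemma mode_0 [simp]: "mode 0 x = 1"
  by (simp add: mode_def)

lemma mode_add: "mode (j + k) x = mode j x * mode k x"
  by (simp add: mode_def cis_mult algebra_simps)

lemma cnj_mode [simp]: "cnj (mode k x) = mode (- k) x"
  by (simp add: mode_def cis_cnj)

lemma mode_arg_add: "mode k (x + y) = mode k x * mode k y"
  by (simp add: mode_def cis_mult algebra_simps)

lemma mode_at_0 [simp]: "mode k 0 = 1"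
  by (simp add: mode_def)

lemma mode_2pi [simp]: "mode k (2 * pi) = 1"
  by (metis mode_def Ints_of_int cis_multiple_2pi mult.commute)

lemma mode_periodic [simp]: "mode k (x + 2 * pi) = mode k x"
  by (simp add: mode_arg_add)

lemma continuous_on_mode [continuous_intros]:
  "continuous_on S f \<Longrightarrow> continuous_on S (\<lambda>x. mode k (f x))"
  unfolding mode_def by (intro continuous_intros)

lemma mode_has_vector_derivative:
  "(mode k has_vector_derivative \<i> * of_int k * mode k x) (at x within S)"
proof -
  have "((\<lambda>x. cis (of_int k * x)) has_derivative
      (\<lambda>t. (of_int k * t) *\<^sub>R (\<i> * cis (of_int k * x)))) (at x within S)"
    by (rule derivative_eq_intros refl | simp)+
  moreover have "(\<lambda>t. (of_int k * t) *\<^sub>R (\<i> * cis (of_int k * x)))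
      = (\<lambda>t. t *\<^sub>R (\<i> * of_int k * cis (of_int k * x)))"
    by (rule ext) (simp add: scaleR_conv_of_real algebra_simps)
  ultimately show ?thesis
    by (simp add: has_vector_derivative_def mode_def[abs_def])
qed

lemma has_integral_mode:
  "(mode k has_integral (if k = 0 then of_real (2 * pi) else 0)) {0..2 * pi}"
proof (cases "k = 0")
  case True
  have "((\<lambda>x. 1 :: complex) has_integral of_real (2 * pi)) {0..2 * pi}"
    using has_integral_const_real[of "1::complex" 0 "2*pi"] by (simp add: scaleR_conv_of_real)
  moreover have "mode k = (\<lambda>x. 1)" using True by auto
  ultimately show ?thesis using True by simp
next
  case False
  have "((\<lambda>x. \<i> * of_int k * mode k x) has_integral (mode k (2 * pi) - mode k 0)) {0..2 * pi}"
    by (rule fundamental_theorem_of_calculus) (auto intro: mode_has_vector_derivative)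
  then have "((\<lambda>x. \<i> * of_int k * mode k x) has_integral 0) {0..2 * pi}"
    by simp
  from has_integral_mult_right[OF this, of "1 / (\<i> * of_int k)"] False
  show ?thesis by (simp add: field_simps)
qed

definition cper :: "(real \<Rightarrow> 'a::real_normed_vector) \<Rightarrow> bool" where
  "cper f \<longleftrightarrow> continuous_on UNIV f \<and> (\<forall>x. f (x + 2 * pi) = f x)"

lemma cperI: "continuous_on UNIV f \<Longrightarrow> (\<And>x. f (x + 2 * pi) = f x) \<Longrightarrow> cper f"
  by (simp add: cper_def)

lemma cper_cont: "cper f \<Longrightarrow> continuous_on S f"
  unfolding cper_def using continuous_on_subset by blast

lemma cper_shift: "cper f \<Longrightarrow> f (x + 2 * pi) = f x"
  by (simp add: cper_def)

lemma cper_const [simp]: "cper (\<lambda>x. c)"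
  by (simp add: cper_def)

lemma cper_mode [simp]: "cper (mode k)"
  by (auto simp: cper_def intro!: continuous_intros)

lemma cper_add: "cper f \<Longrightarrow> cper g \<Longrightarrow> cper (\<lambda>x. f x + g x)"
  by (auto simp: cper_def intro!: continuous_intros)

lemma cper_diff: "cper f \<Longrightarrow> cper g \<Longrightarrow> cper (\<lambda>x. f x - g x)"
  by (auto simp: cper_def intro!: continuous_intros)

lemma cper_mult: "cper f \<Longrightarrow> cper g \<Longrightarrow> cper (\<lambda>x. f x * g x :: 'a :: real_normed_algebra)"
  by (auto simp: cper_def intro!: continuous_intros)

lemma cper_sum: "(\<And>i. i \<in> I \<Longrightarrow> cper (f i)) \<Longrightarrow> cper (\<lambda>x. \<Sum>i\<in>I. f i x)"
  by (auto simp: cper_def intro!: continuous_intros)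

lemma cper_cnj: "cper f \<Longrightarrow> cper (\<lambda>x. cnj (f x))"
  by (auto simp: cper_def intro!: continuous_intros)

lemma cper_of_real: "cper f \<Longrightarrow> cper (\<lambda>x. of_real (f x) :: 'a :: real_normed_algebra_1)"
  by (auto simp: cper_def intro!: continuous_intros)

lemma cper_Re: "cper f \<Longrightarrow> cper (\<lambda>x. Re (f x))"
  by (auto simp: cper_def intro!: continuous_intros)

text \<open>Lets a periodic function be read as a function on the unit circle, whichever branch of
  the argument is used.\<close>

lemma cper_cis_eq:
  assumes "cper f" "cis x = cis y"
  shows "f x = f y"
proof -
  have p: "f (z + 2 * pi * real n) = f z" for z n
  proof (induction n)
    case (Suc n)
    have "f (z + 2 * pi * real (Suc n)) = f (z + 2 * pi * real n + 2 * pi)"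
      by (simp add: algebra_simps)
    also have "\<dots> = f z" using Suc cper_shift[OF assms(1)] by simp
    finally show ?case .
  qed simp
  have "sin x = sin y \<and> cos x = cos y"
    using assms(2) by (simp add: complex_eq_iff)
  then obtain n :: int where n: "x = y + 2 * pi * n"
    using sin_cos_eq_iff by blast
  show ?thesis
  proof (cases "n \<ge> 0")
    case True
    then show ?thesis using n p[of y "nat n"] by simp
  next
    case False
    then have "y = x + 2 * pi * real (nat (- n))" using n by simp
    then show ?thesis using p[of x "nat (- n)"] by simp
  qed
qed

definition fc :: "(real \<Rightarrow> complex) \<Rightarrow> int \<Rightarrow> complex" where
  "fc f k = integral {0..2 * pi} (\<lambda>x. f x * mode (- k) x) / of_real (2 * pi)"

lemma cper_integrable: "cper f \<Longrightarrow> f integrable_on {0..2 * pi}"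
  for f :: "real \<Rightarrow> 'a :: banach"
  by (rule integrable_continuous_real) (rule cper_cont)

lemma fc_integrable: "cper f \<Longrightarrow> (\<lambda>x. f x * mode k x) integrable_on {0..2 * pi}"
  by (intro cper_integrable cper_mult) auto

lemma fc_add: "cper f \<Longrightarrow> cper g \<Longrightarrow> fc (\<lambda>x. f x + g x) k = fc f k + fc g k"
  by (simp add: fc_def ring_distribs integral_add fc_integrable add_divide_distrib)

lemma fc_cmult: "fc (\<lambda>x. c * f x) k = c * fc f k"
  by (simp add: fc_def mult.assoc)

lemma fc_diff: "cper f \<Longrightarrow> cper g \<Longrightarrow> fc (\<lambda>x. f x - g x) k = fc f k - fc g k"
  by (simp add: fc_def ring_distribs integral_diff fc_integrable diff_divide_distrib)

lemma fc_sum: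
  "finite I \<Longrightarrow> (\<And>i. i \<in> I \<Longrightarrow> cper (f i)) \<Longrightarrow> fc (\<lambda>x. \<Sum>i\<in>I. f i x) k = (\<Sum>i\<in>I. fc (f i) k)"
proof (induction I rule: finite_induct)
  case empty
  then show ?case by (simp add: fc_def)
next
  case (insert i I)
  then show ?case by (simp add: fc_add cper_sum)
qed

lemma fc_mode_mult: "fc (\<lambda>x. mode j x * f x) k = fc f (k - j)"
proof -
  have eq: "mode j x * f x * mode (- k) x = f x * mode (j - k) x" for x
    using mode_add[of j "- k" x] by simp
  then show ?thesis unfolding fc_def eq by simp
qed

lemma fc_cnj: "fc (\<lambda>x. cnj (f x)) k = cnj (fc f (- k))"
proof -
  have "integral {0..2 * pi} (\<lambda>x. cnj (f x * mode k x)) = cnj (integral {0..2 * pi} (\<lambda>x. f x * mode k x))"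
    by (rule integral_cnj[symmetric])
  then show ?thesis by (simp add: fc_def)
qed

lemma fc_0: "fc f 0 = integral {0..2 * pi} f / of_real (2 * pi)"
  by (simp add: fc_def)

lemma fc_mode: "fc (mode j) k = (if k = j then 1 else 0)"
proof -
  have "(\<lambda>x. mode j x * mode (- k) x) = mode (j - k)"
    by (simp add: mode_add[symmetric])
  then show ?thesis
    by (simp add: fc_def integral_unique[OF has_integral_mode])
qed

lemma fc_const: "fc (\<lambda>x. c) k = (if k = 0 then c else 0)"
proof -
  have "fc (\<lambda>x. c * mode 0 x) k = (if k = 0 then c else 0)"
    unfolding fc_cmult fc_mode by simp
  then show ?thesis by simp
qed

text \<open>Multiplication by \<open>mode j\<close> only shifts coefficients, and a real linear form
  of \<open>cis x\<close> is a combination of \<open>mode 1\<close> and \<open>mode (- 1)\<close>.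
  Real polynomials on the circle are what Stone-Weierstrass supplies in
  \<open>fc_unique_0\<close>.\<close>

lemma zero_coeffs_mult_poly:
  fixes p :: "complex \<Rightarrow> real"
  assumes "real_polynomial_function p" "cper f" "\<And>k. fc f k = 0"
  shows "cper (\<lambda>x. of_real (p (cis x)) * f x) \<and> (\<forall>k. fc (\<lambda>x. of_real (p (cis x)) * f x) k = 0)"
  using assms
proof (induction arbitrary: f rule: real_polynomial_function.induct)
  case (linear p)
  interpret p: bounded_linear p by fact
  define \<alpha> where "\<alpha> = (of_real (p 1) - \<i> * of_real (p \<i>)) / 2"
  define \<beta> where "\<beta> = (of_real (p 1) + \<i> * of_real (p \<i>)) / 2"
  have *: "of_real (p (cis x)) = \<alpha> * mode 1 x + \<beta> * mode (- 1) x" for x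
  proof -
    have "p (cis x) = p (cos x *\<^sub>R 1 + sin x *\<^sub>R \<i>)"
      by (rule arg_cong[of _ _ p]) (simp add: complex_eq_iff)
    also have "\<dots> = cos x * p 1 + sin x * p \<i>"
      by (simp only: p.add p.scaleR real_scaleR_def)
    finally show ?thesis
      by (simp add: complex_eq_iff \<alpha>_def \<beta>_def mode_def field_simps)
  qed
  have eq: "(\<lambda>x. of_real (p (cis x)) * f x)
      = (\<lambda>x. \<alpha> * (mode 1 x * f x) + \<beta> * (mode (- 1) x * f x))"
    by (auto simp: * algebra_simps)
  have "cper (\<lambda>x. \<alpha> * (mode 1 x * f x))" "cper (\<lambda>x. \<beta> * (mode (- 1) x * f x))"
    using linear by (auto intro!: cper_mult)
  then show ?case unfolding eq
    using linear by (simp add: cper_add fc_add fc_cmult fc_mode_mult)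
next
  case (const c)
  then show ?case by (simp add: cper_mult fc_cmult)
next
  case (add p q)
  then show ?case by (simp add: ring_distribs cper_add fc_add)
next
  case (mult p q)
  have 1: "cper (\<lambda>x. of_real (q (cis x)) * f x) \<and> (\<forall>k. fc (\<lambda>x. of_real (q (cis x)) * f x) k = 0)"
    using mult.IH(2)[of f] mult.prems by blast
  have 2: "cper (\<lambda>x. of_real (p (cis x)) * (of_real (q (cis x)) * f x))
      \<and> (\<forall>k. fc (\<lambda>x. of_real (p (cis x)) * (of_real (q (cis x)) * f x)) k = 0)"
    using mult.IH(1)[of "\<lambda>x. of_real (q (cis x)) * f x"] 1 by blast
  then show ?case by (simp add: mult.assoc)
qed

text \<open>\<open>Arg\<close> jumps on the negative axis and \<open>Arg2pi\<close> on the positive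
  one. By periodicity the two compositions agree off the origin, so near each point one of them
  shows continuity.\<close>

lemma continuous_circle:
  assumes f: "cper f"
  shows "continuous_on (sphere 0 1) (\<lambda>z. f (Arg z))"
proof -
  have eq: "f (Arg z) = f (Arg2pi z)" if "z \<noteq> 0" for z
  proof (rule cper_cis_eq[OF f])
    have "of_real (norm z) * cis (Arg z) = of_real (norm z) * cis (Arg2pi z)"
      using Arg_eq[OF that] Arg2pi_eq[of z] by (simp add: cis_conv_exp mult.commute)
    then show "cis (Arg z) = cis (Arg2pi z)" using that by simp
  qed
  have fc: "isCont f x" for x
    using f by (auto simp: cper_def continuous_on_eq_continuous_at)
  show ?thesis
  proof (rule continuous_at_imp_continuous_on, rule ballI)
    fix z :: complex assume z: "z \<in> sphere 0 1"
    then have z0: "z \<noteq> 0" by auto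
    show "isCont (\<lambda>z. f (Arg z)) z"
    proof (cases "z \<in> \<real>\<^sub>\<le>\<^sub>0")
      case False
      then show ?thesis
        by (intro isCont_o2[OF continuous_at_Arg fc])
    next
      case True
      then have "z \<notin> \<real>\<^sub>\<ge>\<^sub>0"
        using z0 by (auto simp: complex_nonneg_Reals_iff complex_nonpos_Reals_iff complex_eq_iff)
      then have "isCont (\<lambda>z. f (Arg2pi z)) z"
        by (intro isCont_o2[OF continuous_at_Arg2pi fc])
      moreover have "\<forall>\<^sub>F w in nhds z. f (Arg w) = f (Arg2pi w)"
        using t1_space_nhds[OF z0] by eventually_elim (rule eq)
      ultimately show ?thesis
        by (subst isCont_cong)
    qed
  qed
qed

lemma integral_pos_zero:
  fixes g :: "real \<Rightarrow> real"
  assumes "cper g" "\<And>x. g x \<ge> 0" "integral {0..2 * pi} g = 0"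
  shows "g x = 0"
proof -
  have "(g has_integral 0) (cbox 0 (2 * pi))"
    using integrable_integral[OF cper_integrable[OF assms(1)]] assms(3) by simp
  then have z: "\<forall>x\<in>cbox 0 (2 * pi). g x = 0"
    using has_integral_0_cbox_imp_0[of 0 "2 * pi" g, OF cper_cont[OF assms(1)] assms(2)]
    using pi_gt_zero by (auto simp: not_le)
  have "cis x = cis (Arg2pi (cis x))"
    using Arg2pi_eq[of "cis x"] by (simp add: cis_conv_exp)
  then have "g x = g (Arg2pi (cis x))" by (rule cper_cis_eq[OF assms(1)])
  also have "\<dots> = 0"
    using z Arg2pi_ge_0[of "cis x"] Arg2pi_lt_2pi[of "cis x"] by auto
  finally show ?thesis .
qed

text \<open>Approximate \<open>cnj f\<close> on the circle by a polynomial \<open>g\<close> within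
  \<open>e\<close>. The product of \<open>g\<close> and \<open>f\<close> has mean zero, so the
  integral of the square of \<open>norm f\<close> is at most \<open>e\<close> times the integral of
  \<open>norm f\<close>, for every \<open>e > 0\<close>.\<close>

theorem fc_unique_0:
  assumes f: "cper f" and z: "\<And>k. fc f k = 0"
  shows "f x = 0"
proof -
  define N where "N = integral {0..2 * pi} (\<lambda>x. (norm (f x))\<^sup>2)"
  have cn: "cper (\<lambda>x. (norm (f x))\<^sup>2)" "cper (\<lambda>x. norm (f x))"
    using f by (auto simp: cper_def intro!: continuous_intros)
  have N: "norm N \<le> e * (integral {0..2 * pi} (\<lambda>x. norm (f x)))" if e: "e > 0" for e
  proof -
    have "continuous_on (sphere 0 1) (\<lambda>z. cnj (f (Arg z)))"
      by (rule continuous_circle[OF cper_cnj[OF f]])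
    then obtain g where g: "polynomial_function g"
        "\<And>z. z \<in> sphere 0 1 \<Longrightarrow> norm (cnj (f (Arg z)) - g z) < e"
      using Stone_Weierstrass_polynomial_function[of "sphere (0::complex) 1" "\<lambda>z. cnj (f (Arg z))" e] e
      by auto
    have p: "real_polynomial_function (Re \<circ> g)" "real_polynomial_function (Im \<circ> g)"
      using g(1) bounded_linear_Re bounded_linear_Im unfolding polynomial_function_def by blast+
    note pR = zero_coeffs_mult_poly[OF p(1) f z] and pI = zero_coeffs_mult_poly[OF p(2) f z]
    have geq: "(\<lambda>x. g (cis x) * f x)
        = (\<lambda>x. of_real ((Re \<circ> g) (cis x)) * f x + \<i> * (of_real ((Im \<circ> g) (cis x)) * f x))"
      by (rule ext) (simp add: complex_eq_iff)
    have cg: "cper (\<lambda>x. g (cis x) * f x)"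
      unfolding geq using pR pI by (intro cper_add cper_mult[OF cper_const]) auto
    have "fc (\<lambda>x. g (cis x) * f x) 0 = 0"
      unfolding geq using pR pI
      by (subst fc_add) (auto simp: fc_cmult intro: cper_mult[OF cper_const])
    then have ig: "integral {0..2 * pi} (\<lambda>x. g (cis x) * f x) = 0"
      by (simp add: fc_0)
    have "of_real N = integral {0..2 * pi} (\<lambda>x. of_real ((norm (f x))\<^sup>2) :: complex)"
      unfolding N_def using integral_linear[OF cper_integrable[OF cn(1)] bounded_linear_of_real, symmetric]
      by (simp add: o_def)
    also have "\<dots> = integral {0..2 * pi} (\<lambda>x. cnj (f x) * f x)"
      by (intro integral_cong) (simp add: complex_norm_square[symmetric] mult.commute del: of_real_power)
    also have "\<dots> = integral {0..2 * pi} (\<lambda>x. cnj (f x) * f x - g (cis x) * f x)"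
      by (subst integral_diff) (auto intro!: cper_integrable cper_mult cper_cnj f cg simp: ig)
    finally have "norm N = norm (integral {0..2 * pi} (\<lambda>x. cnj (f x) * f x - g (cis x) * f x))"
      by (metis norm_of_real real_norm_def)
    also have "\<dots> \<le> integral {0..2 * pi} (\<lambda>x. e * norm (f x))"
    proof (rule integral_norm_bound_integral)
      show "(\<lambda>x. cnj (f x) * f x - g (cis x) * f x) integrable_on {0..2 * pi}"
        by (intro cper_integrable cper_diff cper_mult cper_cnj f cg)
      show "(\<lambda>x. e * norm (f x)) integrable_on {0..2 * pi}"
        by (intro cper_integrable cper_mult cper_const cn)
      fix x :: real
      have "cis x = cis (Arg (cis x))"
        using Arg_eq[of "cis x"] by (simp add: cis_conv_exp)
      then have "f x = f (Arg (cis x))" by (rule cper_cis_eq[OF f])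
      then have "norm (cnj (f x) - g (cis x)) \<le> e"
        using g(2)[of "cis x"] by simp
      then show "norm (cnj (f x) * f x - g (cis x) * f x) \<le> e * norm (f x)"
        by (simp add: left_diff_distrib[symmetric] norm_mult mult_right_mono)
    qed
    finally show ?thesis by simp
  qed
  have "N = 0"
  proof (rule ccontr)
    assume "N \<noteq> 0"
    define J where "J = integral {0..2 * pi} (\<lambda>x. norm (f x))"
    have J: "J \<ge> 0" unfolding J_def by (intro integral_nonneg cper_integrable cn) auto
    \<comment> \<open>This value of \<open>e\<close> makes the bound strictly smaller than
      \<open>norm N\<close>; the summand 1 covers the case \<open>J = 0\<close>.\<close>
    have "norm N \<le> norm N / (2 * (J + 1)) * J"
      unfolding J_def by (rule N) (use \<open>N \<noteq> 0\<close> J J_def in auto)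
    also have "\<dots> < norm N"
      using J \<open>N \<noteq> 0\<close> by (simp add: field_simps add_nonneg_pos)
    finally show False by simp
  qed
  then have "(norm (f x))\<^sup>2 = 0"
    unfolding N_def by (intro integral_pos_zero[OF cn(1)]) auto
  then show ?thesis by simp
qed

corollary fc_unique:
  assumes "cper f" "cper g" "\<And>k. fc f k = fc g k"
  shows "f = g"
proof
  fix x
  have "f x - g x = 0"
    by (rule fc_unique_0[of "\<lambda>x. f x - g x"]) (auto simp: cper_diff fc_diff assms)
  then show "f x = g x" by simp
qed

section \<open>Weighted Wiener algebras\<close>

abbreviation asum :: "(int \<Rightarrow> complex) \<Rightarrow> bool" where
  "asum c \<equiv> (\<lambda>k. norm (c k)) summable_on UNIV"

text \<open>\<open>int_decode\<close> turns the sums into ordinary series, whose termwise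
  differentiation requires uniform convergence of the derivatives; the majorant \<open>B\<close>
  provides it. Derivatives are taken within \<open>S\<close> because the radial interval
  \<open>{-T..T}\<close> includes its end points.\<close>

lemma infsum_has_vector_derivative:
  fixes f :: "int \<Rightarrow> real \<Rightarrow> complex"
  assumes S: "convex S"
    and f': "\<And>k x. x \<in> S \<Longrightarrow> (f k has_vector_derivative f' k x) (at x within S)"
    and B: "\<And>k x. x \<in> S \<Longrightarrow> norm (f' k x) \<le> B k" "B summable_on UNIV"
    and f: "\<And>x. x \<in> S \<Longrightarrow> (\<lambda>k. f k x) summable_on UNIV"
    and x: "x \<in> S"
  shows "((\<lambda>x. \<Sum>\<^sub>\<infinity>k. f k x) has_vector_derivative (\<Sum>\<^sub>\<infinity>k. f' k x)) (at x within S)"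
proof -
  define g where "g n = f (int_decode n)" for n
  define g' where "g' n = f' (int_decode n)" for n
  have Bs: "summable (\<lambda>n. B (int_decode n))"
    using B(2) by (intro summable_on_imp_summable) (subst summable_on_reindex_bij_betw[OF bij_int_decode])
  have sums: "(\<lambda>n. g n y) sums (\<Sum>\<^sub>\<infinity>k. f k y)" if "y \<in> S" for y
    unfolding g_def
    by (rule has_sum_imp_sums, subst has_sum_reindex_bij_betw[OF bij_int_decode]) (simp add: f that)
  have fs': "(\<lambda>k. f' k y) summable_on UNIV" if "y \<in> S" for y
    by (rule abs_summable_summable, rule summable_on_comparison_test[OF B(2)]) (auto simp: B that)
  have sums': "(\<lambda>n. g' n y) sums (\<Sum>\<^sub>\<infinity>k. f' k y)" if "y \<in> S" for y
    unfolding g'_def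
    by (rule has_sum_imp_sums, subst has_sum_reindex_bij_betw[OF bij_int_decode]) (simp add: fs' that)
  have ul: "uniform_limit S (\<lambda>n y. \<Sum>i<n. g' i y) (\<lambda>y. \<Sum>i. g' i y) sequentially"
    by (rule Weierstrass_m_test[OF _ Bs]) (auto simp: g'_def B)
  have "\<exists>h. \<forall>y\<in>S. (\<lambda>n. g n y) sums h y \<and>
      (h has_derivative (\<lambda>t. t *\<^sub>R (\<Sum>\<^sub>\<infinity>k. f' k y))) (at y within S)"
  proof (rule has_derivative_series[where f = g and f' = "\<lambda>n y t. t *\<^sub>R g' n y"
        and g' = "\<lambda>y t. t *\<^sub>R (\<Sum>\<^sub>\<infinity>k. f' k y)", OF S _ _ x sums[OF x]])
    show "(g n has_derivative (\<lambda>t. t *\<^sub>R g' n y)) (at y within S)" if "y \<in> S" for n y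
      using f'[OF that] by (simp add: g_def g'_def has_vector_derivative_def)
    fix e :: real assume e: "e > 0"
    have "\<forall>\<^sub>F n in sequentially. \<forall>y\<in>S. dist (\<Sum>i<n. g' i y) (\<Sum>i. g' i y) < e"
      using ul e by (simp add: uniform_limit_iff)
    then show "\<forall>\<^sub>F n in sequentially. \<forall>y\<in>S. \<forall>h.
        norm ((\<Sum>i<n. h *\<^sub>R g' i y) - h *\<^sub>R (\<Sum>\<^sub>\<infinity>k. f' k y)) \<le> e * norm h"
    proof eventually_elim
      case (elim n)
      show ?case
      proof (intro ballI allI)
        fix y h assume y: "y \<in> S"
        have "norm ((\<Sum>i<n. h *\<^sub>R g' i y) - h *\<^sub>R (\<Sum>\<^sub>\<infinity>k. f' k y))
            = norm h * norm ((\<Sum>i<n. g' i y) - (\<Sum>i. g' i y))"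
          using sums_unique[OF sums'[OF y]]
          by (simp add: scaleR_sum_right[symmetric] scaleR_diff_right[symmetric])
        also have "\<dots> \<le> norm h * e"
          using elim y by (intro mult_left_mono) (auto simp: dist_norm less_imp_le)
        finally show "norm ((\<Sum>i<n. h *\<^sub>R g' i y) - h *\<^sub>R (\<Sum>\<^sub>\<infinity>k. f' k y)) \<le> e * norm h"
          by (simp add: mult.commute)
      qed
    qed
  qed
  then obtain h where h: "\<And>y. y \<in> S \<Longrightarrow> (\<lambda>n. g n y) sums h y"
      "\<And>y. y \<in> S \<Longrightarrow> (h has_derivative (\<lambda>t. t *\<^sub>R (\<Sum>\<^sub>\<infinity>k. f' k y))) (at y within S)"
    by blast
  have "(\<Sum>\<^sub>\<infinity>k. f k y) = h y" if "y \<in> S" for y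
    using sums_unique2[OF sums[OF that] h(1)[OF that]] .
  then show ?thesis
    unfolding has_vector_derivative_def
    by (rule has_derivative_transform[OF x _ h(2)[OF x]])
qed

definition fser :: "(int \<Rightarrow> complex) \<Rightarrow> real \<Rightarrow> complex" where
  "fser c x = (\<Sum>\<^sub>\<infinity>k. c k * mode k x)"

lemma fser_summable: "asum c \<Longrightarrow> (\<lambda>k. c k * mode k x) summable_on UNIV"
  by (rule abs_summable_summable) (simp add: norm_mult)

lemma continuous_infsum:
  fixes f :: "'i \<Rightarrow> 'a::topological_space \<Rightarrow> 'b::banach"
  assumes "\<And>k. continuous_on S (f k)" "\<And>k x. x \<in> S \<Longrightarrow> norm (f k x) \<le> B k" "B summable_on UNIV"
  shows "continuous_on S (\<lambda>x. \<Sum>\<^sub>\<infinity>k. f k x)"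
proof (rule uniform_limit_theorem)
  show "uniform_limit S (\<lambda>X x. \<Sum>k\<in>X. f k x) (\<lambda>x. \<Sum>\<^sub>\<infinity>k. f k x) (finite_subsets_at_top UNIV)"
    by (rule Weierstrass_m_test_general) (use assms in auto)
  show "\<forall>\<^sub>F X in finite_subsets_at_top UNIV. continuous_on S (\<lambda>x. \<Sum>k\<in>X. f k x)"
    using assms(1) by (intro always_eventually allI continuous_on_sum)
qed simp

lemma cper_fser:
  assumes "asum c"
  shows "cper (fser c)"
proof (rule cperI)
  show "continuous_on UNIV (fser c)"
    unfolding fser_def[abs_def]
    by (rule continuous_infsum[OF _ _ assms]) (auto simp: norm_mult intro!: continuous_intros)
qed (simp add: fser_def)

text \<open>The series converges uniformly, also after multiplication by the bounded
  \<open>g\<close>, so it may be integrated term by term. The convolution and Parseval identities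
  below rest on this.\<close>

lemma integral_fser_mult:
  assumes c: "asum c" and g: "cper g"
  shows "((\<lambda>k. c k * integral {0..2 * pi} (\<lambda>x. mode k x * g x)) has_sum
          integral {0..2 * pi} (\<lambda>x. fser c x * g x)) UNIV"
proof -
  have "bounded (g ` {0..2 * pi})"
    by (intro compact_imp_bounded compact_continuous_image cper_cont g) auto
  then obtain B where "\<forall>y\<in>g ` {0..2 * pi}. norm y \<le> B"
    unfolding bounded_iff by blast
  then have B: "norm (g x) \<le> B" if "x \<in> {0..2 * pi}" for x
    using that by blast
  have ul: "uniform_limit {0..2 * pi} (\<lambda>X x. \<Sum>k\<in>X. c k * mode k x * g x) (\<lambda>x. fser c x * g x)
      (finite_subsets_at_top UNIV)"
  proof (rule Weierstrass_m_test_general')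
    show "norm (c k * mode k x * g x) \<le> norm (c k) * B" if "x \<in> {0..2 * pi}" for k x
      using B[OF that] by (simp add: norm_mult mult_left_mono)
    show "((\<lambda>k. c k * mode k x * g x) has_sum fser c x * g x) UNIV" for x
      unfolding fser_def by (intro has_sum_cmult_left has_sum_infsum fser_summable c)
    show "(\<lambda>k. norm (c k) * B) summable_on UNIV"
      by (intro summable_on_cmult_left c)
  qed
  obtain I J where IJ: "\<And>X. ((\<lambda>x. \<Sum>k\<in>X. c k * mode k x * g x) has_integral I X) {0..2 * pi}"
      "((\<lambda>x. fser c x * g x) has_integral J) {0..2 * pi}" "(I \<longlongrightarrow> J) (finite_subsets_at_top UNIV)"
    by (rule uniform_limit_integral[OF ul])
       (auto intro!: continuous_intros cper_cont[OF g])
  have I: "I X = (\<Sum>k\<in>X. c k * integral {0..2 * pi} (\<lambda>x. mode k x * g x))" if "finite X" for X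
  proof -
    have "((\<lambda>x. \<Sum>k\<in>X. c k * (mode k x * g x)) has_integral
        (\<Sum>k\<in>X. c k * integral {0..2 * pi} (\<lambda>x. mode k x * g x))) {0..2 * pi}"
      by (intro has_integral_sum that has_integral_mult_right integrable_integral cper_integrable
            cper_mult cper_mode g)
    with IJ(1)[of X] show ?thesis
      by (simp add: mult.assoc has_integral_unique)
  qed
  have "((\<lambda>X. \<Sum>k\<in>X. c k * integral {0..2 * pi} (\<lambda>x. mode k x * g x)) \<longlongrightarrow> J) (finite_subsets_at_top UNIV)"
    using IJ(3) by (rule Lim_transform_eventually)
      (auto intro!: eventually_finite_subsets_at_top_weakI simp: I)
  then show ?thesis
    using integral_unique[OF IJ(2)] by (simp add: has_sum_def)
qed

lemma fc_fser_mult: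
  assumes c: "asum c" and g: "cper g"
  shows "((\<lambda>k. c k * fc g (m - k)) has_sum fc (\<lambda>x. fser c x * g x) m) UNIV"
proof -
  have "((\<lambda>k. c k * integral {0..2 * pi} (\<lambda>x. mode k x * (g x * mode (- m) x))) has_sum
          integral {0..2 * pi} (\<lambda>x. fser c x * (g x * mode (- m) x))) UNIV"
    by (intro integral_fser_mult c cper_mult g cper_mode)
  then have "((\<lambda>k. c k * integral {0..2 * pi} (\<lambda>x. mode k x * g x * mode (- m) x) / of_real (2 * pi)) has_sum
          fc (\<lambda>x. fser c x * g x) m) UNIV"
    unfolding fc_def by (intro has_sum_divide_const) (simp add: mult.assoc)
  moreover have "c k * integral {0..2 * pi} (\<lambda>x. mode k x * g x * mode (- m) x) / of_real (2 * pi)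
      = c k * fc g (m - k)" for k
    using fc_mode_mult[of k g m] by (simp add: fc_def)
  ultimately show ?thesis by simp
qed

lemma fc_fser:
  assumes "asum c"
  shows "fc (fser c) m = c m"
proof -
  have "((\<lambda>k. c k * fc (\<lambda>x. 1) (m - k)) has_sum c m) UNIV"
    by (rule has_sum_finite_neutralI[of "{m}"]) (auto simp: fc_const)
  with fc_fser_mult[OF assms, of "\<lambda>x. 1" m] show ?thesis
    by (simp add: has_sum_unique)
qed

lemma fser_fc:
  assumes "cper f" "asum (fc f)"
  shows "fser (fc f) = f"
  using assms by (intro fc_unique) (auto simp: cper_fser fc_fser)

lemma fc_mult_has_sum:
  assumes "cper f" "asum (fc f)" "cper g"
  shows "((\<lambda>k. fc f k * fc g (m - k)) has_sum fc (\<lambda>x. f x * g x) m) UNIV"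
  using fc_fser_mult[OF assms(2,3)] by (simp add: fser_fc assms)

section \<open>Weights, weighted summability and the algebra property\<close>

definition wt :: "nat \<Rightarrow> int \<Rightarrow> real" where
  "wt s k = (1 + \<bar>real_of_int k\<bar>) ^ s"

lemma wt_ge_1: "1 \<le> wt s k"
  by (simp add: wt_def)

lemma wt_pos: "0 < wt s k"
  using wt_ge_1[of s k] by linarith

lemma wt_nonneg [simp]: "0 \<le> wt s k"
  using wt_pos[of s k] by linarith

lemma wt_0 [simp]: "wt 0 k = 1"
  by (simp add: wt_def)

lemma wt_minus [simp]: "wt s (- k) = wt s k"
  by (simp add: wt_def)

lemma wt_Suc: "wt (Suc s) k = (1 + \<bar>real_of_int k\<bar>) * wt s k"
  by (simp add: wt_def)

lemma wt_mono: "s \<le> t \<Longrightarrow> wt s k \<le> wt t k"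
  unfolding wt_def by (rule power_increasing) auto

lemma wt_mono_arg: "\<bar>j\<bar> \<le> \<bar>k\<bar> \<Longrightarrow> wt s j \<le> wt s k"
  unfolding wt_def by (rule power_mono) auto

lemma wt_submult: "wt s (j + k) \<le> wt s j * wt s k"
proof -
  have "1 + \<bar>real_of_int (j + k)\<bar> \<le> 1 + \<bar>real_of_int j\<bar> + \<bar>real_of_int k\<bar>"
    by simp
  also have "\<dots> \<le> (1 + \<bar>real_of_int j\<bar>) * (1 + \<bar>real_of_int k\<bar>)"
    by (simp add: algebra_simps)
  finally have "1 + \<bar>real_of_int (j + k)\<bar> \<le> (1 + \<bar>real_of_int j\<bar>) * (1 + \<bar>real_of_int k\<bar>)" .
  from power_mono[OF this, of s] show ?thesis
    by (simp add: wt_def power_mult_distrib)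
qed

definition wsum :: "nat \<Rightarrow> (int \<Rightarrow> complex) \<Rightarrow> bool" where
  "wsum s c \<longleftrightarrow> (\<lambda>k. wt s k * norm (c k)) summable_on UNIV"

text \<open>The weighted Wiener algebra, roughly \<open>s\<close> continuous derivatives. Absolute
  rather than square summability is used because it passes to products without loss; the multiplier
  \<open>mu\<close> costs exactly one order.\<close>

definition wiener :: "nat \<Rightarrow> (real \<Rightarrow> complex) \<Rightarrow> bool" where
  "wiener s f \<longleftrightarrow> cper f \<and> wsum s (fc f)"

lemma wsum_bound:
  assumes "wsum t c" "\<And>k. wt s k * norm (d k) \<le> C * (wt t k * norm (c k))"
  shows "wsum s d"
  unfolding wsum_def
  by (rule summable_on_comparison_test[OF summable_on_cmult_right[OF assms(1)[unfolded wsum_def], of C]])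
     (auto simp: assms(2))

lemma wsum_mono: "wsum t c \<Longrightarrow> s \<le> t \<Longrightarrow> wsum s c"
  by (rule wsum_bound[of t c s c 1]) (auto intro!: mult_right_mono wt_mono)

lemma wsum_abs: "wsum s c \<Longrightarrow> asum c"
  using wsum_mono[of s c 0] by (simp add: wsum_def)

lemma wiener_cper: "wiener s f \<Longrightarrow> cper f"
  by (simp add: wiener_def)

lemma wiener_abs: "wiener s f \<Longrightarrow> asum (fc f)"
  using wsum_abs unfolding wiener_def by blast

lemma wiener_mono: "wiener t f \<Longrightarrow> s \<le> t \<Longrightarrow> wiener s f"
  using wsum_mono unfolding wiener_def by blast

lemma wiener_fser:
  assumes "wsum s c"
  shows "wiener s (fser c)"
proof -
  have "fc (fser c) = c" using fc_fser[OF wsum_abs[OF assms]] by auto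
  then show ?thesis
    using assms by (simp add: wiener_def cper_fser wsum_abs)
qed

lemma fser_fc_wiener: "wiener s f \<Longrightarrow> fser (fc f) = f"
  by (simp add: fser_fc wiener_cper wiener_abs)

lemma wsum_add: "wsum s c \<Longrightarrow> wsum s d \<Longrightarrow> wsum s (\<lambda>k. c k + d k)"
  unfolding wsum_def
  by (rule summable_on_comparison_test[OF summable_on_add, of "\<lambda>k. wt s k * norm (c k)" _ "\<lambda>k. wt s k * norm (d k)"])
     (auto simp: distrib_left[symmetric] intro!: mult_left_mono norm_triangle_ineq)

lemma wsum_cmult: "wsum s c \<Longrightarrow> wsum s (\<lambda>k. a * c k)"
  by (rule wsum_bound[of s c s _ "norm a"]) (auto simp: norm_mult)

lemma wsum_reflect:
  assumes "wsum s c"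
  shows "wsum s (\<lambda>k. c (- k))"
proof -
  have "bij (uminus :: int \<Rightarrow> int)" by (rule bij_uminus)
  from summable_on_reindex_bij_betw[OF this, of "\<lambda>k. wt s k * norm (c k)"] assms
  show ?thesis by (simp add: wsum_def)
qed

lemma wiener_add:
  assumes "wiener s f" "wiener s g"
  shows "wiener s (\<lambda>x. f x + g x)"
proof -
  have "fc (\<lambda>x. f x + g x) = (\<lambda>k. fc f k + fc g k)"
    using assms by (auto simp: fc_add wiener_cper)
  then show ?thesis
    using assms by (simp add: wiener_def cper_add wsum_add)
qed

lemma wiener_cmult: "wiener s f \<Longrightarrow> wiener s (\<lambda>x. a * f x)"
  unfolding wiener_def using wsum_cmult[of s "fc f" a]
  by (auto simp: cper_mult fc_cmult[abs_def] wsum_def fc_cmult)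

lemma wiener_uminus: "wiener s f \<Longrightarrow> wiener s (\<lambda>x. - f x)"
  using wiener_cmult[of s f "- 1"] by simp

lemma wiener_diff: "wiener s f \<Longrightarrow> wiener s g \<Longrightarrow> wiener s (\<lambda>x. f x - g x)"
  using wiener_add[of s f "\<lambda>x. - g x"] wiener_uminus by simp

lemma wiener_mode [simp]: "wiener s (mode j)"
proof -
  have "(\<lambda>k. wt s k * norm (fc (mode j) k)) summable_on UNIV"
    by (rule finite_nonzero_values_imp_summable_on, rule finite_subset[of _ "{j}"]) (auto simp: fc_mode)
  then show ?thesis by (simp add: wiener_def wsum_def)
qed

lemma wiener_const [simp]: "wiener s (\<lambda>x. c)"
proof -
  have "(\<lambda>x. c * mode 0 x) = (\<lambda>x. c)" by simp
  then show ?thesis using wiener_cmult[OF wiener_mode[of s 0], of c] by simp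
qed

lemma wiener_cnj: "wiener s f \<Longrightarrow> wiener s (\<lambda>x. cnj (f x))"
  unfolding wiener_def using wsum_reflect[of s "fc f"]
  by (auto simp: cper_cnj fc_cnj wsum_def)

lemma wiener_sum: "(\<And>i. i \<in> I \<Longrightarrow> wiener s (f i)) \<Longrightarrow> wiener s (\<lambda>x. \<Sum>i\<in>I. f i x)"
  by (induction I rule: infinite_finite_induct) (auto intro: wiener_add)

text \<open>Fubini for the product of two summable families after the shear sending
  \<open>(m, k)\<close> to \<open>(k, m - k)\<close>.\<close>

lemma conv_summable:
  fixes a b :: "int \<Rightarrow> real"
  assumes "a summable_on UNIV" "b summable_on UNIV" "\<And>k. a k \<ge> 0" "\<And>k. b k \<ge> 0"
  shows "(\<lambda>(m, k). a k * b (m - k)) summable_on UNIV"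
    and "(\<lambda>k. a k * b (m - k)) summable_on UNIV"
    and "(\<lambda>m. \<Sum>\<^sub>\<infinity>k. a k * b (m - k)) summable_on UNIV"
proof -
  have "(\<lambda>(k, j). a k * b j) summable_on UNIV \<times> UNIV"
    by (rule summable_on_SigmaI[where g = "\<lambda>k. a k * infsum b UNIV"])
       (auto simp: assms intro!: has_sum_cmult_right summable_on_cmult_left)
  moreover have bij: "bij_betw (\<lambda>(m, k). (k, m - k)) (UNIV :: (int \<times> int) set) UNIV"
    by (rule bij_betwI[where g = "\<lambda>(k, j). (j + k, k)"]) auto
  ultimately show 1: "(\<lambda>(m, k). a k * b (m - k)) summable_on UNIV"
    using summable_on_reindex_bij_betw[OF bij, of "\<lambda>(k, j). a k * b j"]
    by (simp add: case_prod_unfold)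
  have 2: "(\<lambda>(m, k). a k * b (m - k)) summable_on (SIGMA m:UNIV. UNIV)"
    using 1 by simp
  show "(\<lambda>k. a k * b (m - k)) summable_on UNIV"
    using summable_on_SigmaD1[OF 2, of m] by (auto simp: assms)
  show "(\<lambda>m. \<Sum>\<^sub>\<infinity>k. a k * b (m - k)) summable_on UNIV"
    using summable_on_Sigma_banach[OF 2] by simp
qed

text \<open>Convolution of summable sequences is summable, and \<open>wt_submult\<close> distributes
  the weight over the two factors.\<close>

lemma wiener_mult:
  assumes f: "wiener s f" and g: "wiener s g"
  shows "wiener s (\<lambda>x. f x * g x)"
proof -
  define a where "a k = wt s k * norm (fc f k)" for k
  define b where "b k = wt s k * norm (fc g k)" for k
  have ab: "a summable_on UNIV" "b summable_on UNIV" "\<And>k. a k \<ge> 0" "\<And>k. b k \<ge> 0"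
    using f g by (auto simp: a_def[abs_def] b_def[abs_def] wiener_def wsum_def)
  have "wt s m * norm (fc (\<lambda>x. f x * g x) m) \<le> (\<Sum>\<^sub>\<infinity>k. a k * b (m - k))" for m
  proof -
    have "((\<lambda>k. of_real (wt s m) * (fc f k * fc g (m - k))) has_sum
        of_real (wt s m) * fc (\<lambda>x. f x * g x) m) UNIV"
      by (intro has_sum_cmult_right fc_mult_has_sum wiener_cper[OF f] wiener_abs[OF f] wiener_cper[OF g])
    then have "norm (of_real (wt s m) * fc (\<lambda>x. f x * g x) m) \<le> (\<Sum>\<^sub>\<infinity>k. a k * b (m - k))"
    proof (rule norm_infsum_le[OF _ has_sum_infsum[OF conv_summable(2)[OF ab]]])
      fix k
      have "wt s m \<le> wt s k * wt s (m - k)" using wt_submult[of s k "m - k"] by simp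
      then have "wt s m * norm (fc f k * fc g (m - k)) \<le> wt s k * wt s (m - k) * norm (fc f k * fc g (m - k))"
        by (intro mult_right_mono) auto
      also have "\<dots> = a k * b (m - k)" by (simp add: a_def b_def norm_mult)
      finally show "norm (of_real (wt s m) * (fc f k * fc g (m - k))) \<le> a k * b (m - k)"
        by (simp add: norm_mult)
    qed
    then show ?thesis by (simp add: norm_mult)
  qed
  then have "wsum s (fc (\<lambda>x. f x * g x))"
    unfolding wsum_def by (intro summable_on_comparison_test[OF conv_summable(3)[OF ab]]) auto
  then show ?thesis
    using f g by (simp add: wiener_def cper_mult)
qed

section \<open>Differentiation in Fourier coefficients\<close>

definition fd :: "(real \<Rightarrow> complex) \<Rightarrow> real \<Rightarrow> complex" where
  "fd f = fser (\<lambda>k. \<i> * of_int k * fc f k)"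

lemma wsum_deriv: "wsum (Suc s) c \<Longrightarrow> wsum s (\<lambda>k. \<i> * of_int k * c k)"
  by (rule wsum_bound[of "Suc s" c s _ 1]) (auto simp: norm_mult wt_Suc algebra_simps)

lemma wiener_fd: "wiener (Suc s) f \<Longrightarrow> wiener s (fd f)"
  unfolding fd_def by (intro wiener_fser wsum_deriv) (simp add: wiener_def)

lemma fc_fd: "wiener (Suc s) f \<Longrightarrow> fc (fd f) k = \<i> * of_int k * fc f k"
  unfolding fd_def by (rule fc_fser, rule wsum_abs, rule wsum_deriv[of s]) (simp add: wiener_def)

lemma fd_has_vector_derivative:
  assumes f: "wiener (Suc s) f"
  shows "(f has_vector_derivative fd f x) (at x)"
proof -
  have "((\<lambda>x. \<Sum>\<^sub>\<infinity>k. fc f k * mode k x) has_vector_derivative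
      (\<Sum>\<^sub>\<infinity>k. fc f k * (\<i> * of_int k * mode k x))) (at x within UNIV)"
  proof (rule infsum_has_vector_derivative)
    show "((\<lambda>x. fc f k * mode k x) has_vector_derivative fc f k * (\<i> * of_int k * mode k x)) (at x within UNIV)" for k x
      by (rule has_vector_derivative_mult_right[OF mode_has_vector_derivative])
    show "norm (fc f k * (\<i> * of_int k * mode k x)) \<le> norm (\<i> * of_int k * fc f k)" for k x
      by (simp add: norm_mult)
    show "(\<lambda>k. norm (\<i> * of_int k * fc f k)) summable_on UNIV"
      using wsum_abs[OF wsum_deriv] f unfolding wiener_def by blast
  qed (auto intro: fser_summable wiener_abs[OF f])
  moreover have "(\<lambda>x. \<Sum>\<^sub>\<infinity>k. fc f k * mode k x) = f"
    using fser_fc_wiener[OF f] by (simp add: fser_def[abs_def])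
  ultimately show ?thesis
    by (simp add: fd_def fser_def mult_ac)
qed

text \<open>Integration by parts over one period. In contrast to \<open>fc_fd\<close>, a continuous
  derivative is all that is asked of \<open>f\<close>.\<close>

lemma fc_deriv:
  assumes f: "cper f" and f': "cper f'" and d: "\<And>x. (f has_vector_derivative f' x) (at x)"
  shows "fc f' k = \<i> * of_int k * fc f k"
proof -
  have "((\<lambda>x. f x * (\<i> * of_int (- k) * mode (- k) x) + f' x * mode (- k) x) has_integral
      (f (2 * pi) * mode (- k) (2 * pi) - f 0 * mode (- k) 0)) {0..2 * pi}"
    by (rule fundamental_theorem_of_calculus)
       (auto intro: has_vector_derivative_mult[OF has_vector_derivative_at_within[OF d] mode_has_vector_derivative]
         simp del: of_int_minus)
  moreover have "f (2 * pi) = f 0" using cper_shift[OF f, of 0] by simp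
  ultimately have "((\<lambda>x. f x * (\<i> * of_int (- k) * mode (- k) x) + f' x * mode (- k) x) has_integral 0) {0..2 * pi}"
    by (simp only: mode_2pi mode_at_0 mult_1_right diff_self)
  then have "((\<lambda>x. (- \<i> * of_int k) * (f x * mode (- k) x) + f' x * mode (- k) x) has_integral 0) {0..2 * pi}"
    by (simp add: algebra_simps)
  then have "integral {0..2 * pi} (\<lambda>x. (- \<i> * of_int k) * (f x * mode (- k) x) + f' x * mode (- k) x) = 0"
    by (rule integral_unique)
  then have "(- \<i> * of_int k) * integral {0..2 * pi} (\<lambda>x. f x * mode (- k) x)
      + integral {0..2 * pi} (\<lambda>x. f' x * mode (- k) x) = 0"
    by (subst (asm) integral_add) (auto intro!: fc_integrable integrable_on_mult_right integrable_neg f f')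
  then show ?thesis by (simp add: fc_def field_simps add_eq_0_iff)
qed

section \<open>Bessel's inequality and functions of class C2\<close>

lemma bessel:
  assumes g: "cper g" and F: "finite F"
  shows "(\<Sum>k\<in>F. (norm (fc g k))\<^sup>2) \<le> integral {0..2 * pi} (\<lambda>x. (norm (g x))\<^sup>2) / (2 * pi)"
proof -
  \<comment> \<open>\<open>P\<close> is the orthogonal projection of \<open>g\<close> to the modes
    in \<open>F\<close>; expanding the squared norm of \<open>g - P\<close>, which is nonnegative,
    gives the bound.\<close>
  define P where "P x = (\<Sum>k\<in>F. fc g k * mode k x)" for x
  have P: "cper P" unfolding P_def[abs_def] by (intro cper_sum cper_mult cper_const cper_mode)
  have fcP: "fc P k = fc g k" if "k \<in> F" for k
    using that F unfolding P_def[abs_def]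
    by (subst fc_sum) (auto simp: fc_cmult fc_mode cper_mult if_distrib sum.delta cong: if_cong)
  have 1: "fc (\<lambda>x. g x - P x) k = 0" if "k \<in> F" for k
    using that by (simp add: fc_diff g P fcP)
  have PI: "integral {0..2 * pi} (\<lambda>x. P x * cnj (q x)) = of_real (2 * pi) * (\<Sum>k\<in>F. fc g k * cnj (fc q k))"
    if q: "cper q" for q
  proof -
    have "integral {0..2 * pi} (\<lambda>x. P x * cnj (q x)) = of_real (2 * pi) * fc (\<lambda>x. \<Sum>k\<in>F. fc g k * (mode k x * cnj (q x))) 0"
      by (simp add: fc_0 P_def sum_distrib_right mult.assoc)
    also have "fc (\<lambda>x. \<Sum>k\<in>F. fc g k * (mode k x * cnj (q x))) 0 = (\<Sum>k\<in>F. fc g k * cnj (fc q k))"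
      using q by (subst fc_sum[OF F]) (auto simp: fc_cmult fc_mode_mult fc_cnj intro!: cper_mult cper_cnj)
    finally show ?thesis .
  qed
  have cn: "cper (\<lambda>x. (norm (g x))\<^sup>2)" "cper (\<lambda>x. (norm (g x - P x))\<^sup>2)"
    using g P by (auto simp: cper_def intro!: continuous_intros)
  have ofr: "of_real (integral {0..2 * pi} f) = (integral {0..2 * pi} (\<lambda>x. of_real (f x)) :: complex)"
    if "cper f" for f
    using integral_linear[OF cper_integrable[OF that] bounded_linear_of_real, symmetric] by (simp add: o_def)
  have "of_real (integral {0..2 * pi} (\<lambda>x. (norm (g x - P x))\<^sup>2))
      = integral {0..2 * pi} (\<lambda>x. (g x - P x) * cnj (g x - P x))"
    unfolding ofr[OF cn(2)] by (intro integral_cong) (simp add: complex_norm_square del: of_real_power)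
  also have "\<dots> = integral {0..2 * pi} (\<lambda>x. (g x * cnj (g x) - cnj (P x * cnj (g x))) - P x * cnj (g x - P x))"
    by (intro integral_cong) (simp add: algebra_simps)
  also have "\<dots> = integral {0..2 * pi} (\<lambda>x. g x * cnj (g x)) - integral {0..2 * pi} (\<lambda>x. cnj (P x * cnj (g x)))
      - integral {0..2 * pi} (\<lambda>x. P x * cnj (g x - P x))"
  proof -
    have "cper (\<lambda>x. g x * cnj (g x))" "cper (\<lambda>x. cnj (P x * cnj (g x)))" "cper (\<lambda>x. P x * cnj (g x - P x))"
      using g P by (auto intro!: cper_mult cper_cnj cper_diff simp del: complex_cnj_mult complex_cnj_diff)
    then show ?thesis
      by (simp only: integral_diff integrable_diff cper_integrable)
  qed
  also have "integral {0..2 * pi} (\<lambda>x. P x * cnj (g x - P x)) = 0"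
    using PI[of "\<lambda>x. g x - P x"] 1 g P by (simp add: cper_diff)
  also have "integral {0..2 * pi} (\<lambda>x. cnj (P x * cnj (g x))) = of_real (2 * pi) * (\<Sum>k\<in>F. of_real ((norm (fc g k))\<^sup>2))"
    unfolding integral_cnj[symmetric] PI[OF g]
    by (simp add: complex_norm_square mult.commute del: of_real_power)
  also have "integral {0..2 * pi} (\<lambda>x. g x * cnj (g x)) = of_real (integral {0..2 * pi} (\<lambda>x. (norm (g x))\<^sup>2))"
    unfolding ofr[OF cn(1)] by (intro integral_cong) (simp add: complex_norm_square del: of_real_power)
  also have "of_real (integral {0..2 * pi} (\<lambda>x. (norm (g x))\<^sup>2)) -
      of_real (2 * pi) * (\<Sum>k\<in>F. of_real ((norm (fc g k))\<^sup>2)) - 0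
     = complex_of_real (integral {0..2 * pi} (\<lambda>x. (norm (g x))\<^sup>2) - 2 * pi * (\<Sum>k\<in>F. (norm (fc g k))\<^sup>2))"
    by simp
  finally have "integral {0..2 * pi} (\<lambda>x. (norm (g x - P x))\<^sup>2)
      = integral {0..2 * pi} (\<lambda>x. (norm (g x))\<^sup>2) - 2 * pi * (\<Sum>k\<in>F. (norm (fc g k))\<^sup>2)"
    by (simp only: of_real_eq_iff)
  moreover have "0 \<le> integral {0..2 * pi} (\<lambda>x. (norm (g x - P x))\<^sup>2)"
    by (rule integral_nonneg) (auto intro!: cper_integrable cn)
  ultimately show ?thesis by (simp add: field_simps)
qed

lemma summable_fc_sq:
  assumes "cper g"
  shows "(\<lambda>k. (norm (fc g k))\<^sup>2) summable_on UNIV"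
  by (rule nonneg_bdd_above_summable_on) (auto intro!: bdd_aboveI2 bessel assms)

lemma summable_inverse_squares_int: "(\<lambda>k::int. 1 / (1 + \<bar>real_of_int k\<bar>)\<^sup>2) summable_on UNIV"
proof -
  have 1: "(\<lambda>n::nat. 1 / (1 + real n)\<^sup>2) summable_on UNIV"
  proof (rule norm_summable_imp_summable_on)
    have "summable (\<lambda>n. 1 / real ((n + 1)\<^sup>2))"
      using inverse_squares_sums by (rule sums_summable)
    then show "summable (\<lambda>n. norm (1 / (1 + real n)\<^sup>2))" by (simp add: add.commute)
  qed
  have p: "(\<lambda>k::int. 1 / (1 + \<bar>real_of_int k\<bar>)\<^sup>2) summable_on (int ` UNIV)"
    using 1 by (subst summable_on_reindex) (auto simp: o_def)
  have m: "(\<lambda>k::int. 1 / (1 + \<bar>real_of_int k\<bar>)\<^sup>2) summable_on ((\<lambda>n. - int n) ` UNIV)"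
    using 1 by (subst summable_on_reindex) (auto simp: o_def inj_on_def)
  have "(UNIV :: int set) = int ` UNIV \<union> (\<lambda>n. - int n) ` UNIV"
  proof -
    have "k \<in> int ` UNIV \<union> (\<lambda>n. - int n) ` UNIV" for k
      by (cases k rule: int_cases2) auto
    then show ?thesis by blast
  qed
  with summable_on_union[OF p m] show ?thesis by simp
qed

text \<open>Two derivatives make \<open>k^2\<close> times the coefficients square summable; pairing
  them by AM-GM with the summable \<open>1 / (1 + |k|)^2\<close> yields absolute summability with
  one power of \<open>1 + |k|\<close>. This is how C2 hypotheses enter the Wiener scale.\<close>

lemma wiener_1_C2:
  assumes f: "cper f" "cper f'" "cper f''"
    and d: "\<And>x. (f has_vector_derivative f' x) (at x)" "\<And>x. (f' has_vector_derivative f'' x) (at x)"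
  shows "wiener 1 f"
proof -
  define B where "B k = norm (fc f k) * (if k = 0 then 1 else 0) + 4 * (1 / (1 + \<bar>real_of_int k\<bar>)\<^sup>2) + (norm (fc f'' k))\<^sup>2" for k :: int
  have "(\<lambda>k. norm (fc f k) * (if k = 0 then 1 else 0)) summable_on UNIV"
    by (rule finite_nonzero_values_imp_summable_on, rule finite_subset[of _ "{0}"]) auto
  then have "B summable_on UNIV"
    unfolding B_def[abs_def]
    by (intro summable_on_add summable_on_cmult_right summable_inverse_squares_int summable_fc_sq f)
  moreover have "wt 1 k * norm (fc f k) \<le> B k" for k
  proof (cases "k = 0")
    case True
    then show ?thesis by (simp add: B_def wt_def)
  next
    case False
    define r where "r = \<bar>real_of_int k\<bar>"
    define y where "y = norm (fc f'' k)"
    have r: "r \<ge> 1" using False by (simp add: r_def)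
    have "fc f'' k = - (of_int k)\<^sup>2 * fc f k"
      using fc_deriv[OF f(1,2) d(1), of k] fc_deriv[OF f(2,3) d(2), of k] by (simp add: power2_eq_square algebra_simps)
    then have y: "y = r\<^sup>2 * norm (fc f k)"
      by (simp add: y_def r_def norm_mult norm_power)
    have "norm (fc f k) = y / r\<^sup>2" using y r by simp
    then have "wt 1 k * norm (fc f k) = (1 + r) / r\<^sup>2 * y"
      by (simp add: wt_def r_def)
    also have "\<dots> \<le> (4 / (1 + r)) * y"
    proof (rule mult_right_mono)
      have "(1 + r)\<^sup>2 \<le> (2 * r)\<^sup>2" using r by (intro power_mono) auto
      then show "(1 + r) / r\<^sup>2 \<le> 4 / (1 + r)"
        using r by (simp add: field_simps power2_eq_square)
    qed (simp add: y_def)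
    also have "\<dots> \<le> 4 * (1 / (1 + r)\<^sup>2) + y\<^sup>2"
    proof -
      have "0 \<le> (2 / (1 + r) - y)\<^sup>2" by simp
      also have "\<dots> = 4 * (1 / (1 + r)\<^sup>2) + y\<^sup>2 - (4 / (1 + r)) * y"
        by (simp add: power2_diff power_divide)
      finally show ?thesis by simp
    qed
    finally show ?thesis using False by (simp add: B_def r_def y_def)
  qed
  ultimately have "wsum 1 (fc f)"
    unfolding wsum_def by (rule summable_on_comparison_test) auto
  then show ?thesis by (simp add: wiener_def f)
qed

lemma fd_eqI:
  assumes "wiener (Suc s) f" "\<And>x. (f has_vector_derivative f' x) (at x)"
  shows "fd f = f'"
  using vector_derivative_unique_at[OF fd_has_vector_derivative[OF assms(1)] assms(2)] by auto

lemma integral_mult_has_sum: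
  assumes "wiener s f" "cper g"
  shows "((\<lambda>k. fc f k * fc g (- k)) has_sum (integral {0..2 * pi} (\<lambda>x. f x * g x) / of_real (2 * pi))) UNIV"
  using fc_mult_has_sum[OF wiener_cper[OF assms(1)] wiener_abs[OF assms(1)] assms(2), of 0]
  by (simp add: fc_0)

section \<open>Eigenvectors of Hilbert-Schmidt forms\<close>

definition sqsum :: "('i \<Rightarrow> complex) \<Rightarrow> bool" where
  "sqsum y \<longleftrightarrow> (\<lambda>k. (norm (y k))\<^sup>2) summable_on UNIV"

definition sqn :: "('i \<Rightarrow> complex) \<Rightarrow> real" where
  "sqn y = (\<Sum>\<^sub>\<infinity>k. (norm (y k))\<^sup>2)"

definition hform :: "('i \<Rightarrow> 'i \<Rightarrow> complex) \<Rightarrow> ('i \<Rightarrow> complex) \<Rightarrow> ('i \<Rightarrow> complex) \<Rightarrow> complex" where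
  "hform N x y = (\<Sum>\<^sub>\<infinity>(j, k). cnj (x j) * N j k * y k)"

definition hilbert_schmidt :: "('i \<Rightarrow> 'i \<Rightarrow> complex) \<Rightarrow> bool" where
  "hilbert_schmidt N \<longleftrightarrow> (\<lambda>(j, k). (norm (N j k))\<^sup>2) summable_on UNIV"

lemma sqsum_add:
  assumes "sqsum x" "sqsum y"
  shows "sqsum (\<lambda>k. x k + y k)"
  unfolding sqsum_def
proof (rule summable_on_comparison_test)
  show "(\<lambda>k. 2 * (norm (x k))\<^sup>2 + 2 * (norm (y k))\<^sup>2) summable_on UNIV"
    using assms unfolding sqsum_def by (intro summable_on_add summable_on_cmult_right)
  fix k
  have "(norm (x k + y k))\<^sup>2 \<le> (norm (x k) + norm (y k))\<^sup>2"
    by (intro power_mono norm_triangle_ineq) auto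
  also have "\<dots> \<le> 2 * (norm (x k))\<^sup>2 + 2 * (norm (y k))\<^sup>2"
    using sum_squares_bound[of "norm (x k)" "norm (y k)"] by (simp add: power2_sum)
  finally show "(norm (x k + y k))\<^sup>2 \<le> 2 * (norm (x k))\<^sup>2 + 2 * (norm (y k))\<^sup>2" .
qed auto

lemma sqsum_cmult: "sqsum x \<Longrightarrow> sqsum (\<lambda>k. a * x k)"
  unfolding sqsum_def by (simp add: norm_mult power_mult_distrib summable_on_cmult_right)

lemma sqsum_single: "sqsum (\<lambda>k. if k = j then a else 0)"
  unfolding sqsum_def
  by (rule finite_nonzero_values_imp_summable_on, rule finite_subset[of _ "{j}"]) auto

lemma sqn_cmult: "sqn (\<lambda>k. a * x k) = (norm a)\<^sup>2 * sqn x"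
  by (simp add: sqn_def norm_mult power_mult_distrib infsum_cmult_right')

lemma sqn_nonneg: "0 \<le> sqn x"
  unfolding sqn_def by (rule infsum_nonneg) auto

lemma sqn_eq_0:
  assumes "sqsum x" "sqn x = 0"
  shows "x k = 0"
proof -
  have "(norm (x k))\<^sup>2 = 0"
    by (rule nonneg_infsum_le_0D[of "\<lambda>k. (norm (x k))\<^sup>2" UNIV k])
       (use assms in \<open>auto simp: sqn_def sqsum_def\<close>)
  then show ?thesis by simp
qed

lemma sq_prod_summable:
  assumes "sqsum x" "sqsum y"
  shows "(\<lambda>(j, k). (norm (x j))\<^sup>2 * (norm (y k))\<^sup>2) summable_on UNIV"
    and "(\<Sum>\<^sub>\<infinity>(j, k). (norm (x j))\<^sup>2 * (norm (y k))\<^sup>2) = sqn x * sqn y"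
proof -
  have 1: "(\<lambda>(j, k). (norm (x j))\<^sup>2 * (norm (y k))\<^sup>2) summable_on (SIGMA j:UNIV. UNIV)"
    by (rule summable_on_SigmaI[where g = "\<lambda>j. (norm (x j))\<^sup>2 * sqn y"])
       (use assms in \<open>auto simp: sqn_def sqsum_def intro!: has_sum_cmult_right summable_on_cmult_left\<close>)
  then show "(\<lambda>(j, k). (norm (x j))\<^sup>2 * (norm (y k))\<^sup>2) summable_on UNIV" by simp
  show "(\<Sum>\<^sub>\<infinity>(j, k). (norm (x j))\<^sup>2 * (norm (y k))\<^sup>2) = sqn x * sqn y"
    using infsum_Sigma_banach[OF 1]
    by (simp add: infsum_cmult_right' infsum_cmult_left' sqn_def)
qed

text \<open>Young's inequality with a free parameter, which later balances the tail of the matrix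
  against the size of the vector.\<close>

lemma hform_term_bound:
  fixes e :: real
  assumes "e > 0"
  shows "norm (cnj a * n * b) \<le> (norm n)\<^sup>2 / (2 * e) + e / 2 * ((norm a)\<^sup>2 * (norm b)\<^sup>2)"
proof -
  define p where "p = norm a * norm b"
  define q where "q = norm n"
  have "0 \<le> (q - e * p)\<^sup>2 / (2 * e)" using assms by simp
  also have "\<dots> = q\<^sup>2 / (2 * e) + e / 2 * p\<^sup>2 - p * q"
    using assms by (simp add: power2_diff field_simps power2_eq_square)
  finally have "p * q \<le> q\<^sup>2 / (2 * e) + e / 2 * p\<^sup>2" by simp
  then show ?thesis
    by (simp add: p_def q_def norm_mult power_mult_distrib mult_ac)
qed

lemma hform_abs_summable:
  assumes "hilbert_schmidt N" "sqsum x" "sqsum y"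
  shows "(\<lambda>p. norm (cnj (x (fst p)) * N (fst p) (snd p) * y (snd p))) summable_on UNIV"
proof (rule summable_on_comparison_test)
  show "(\<lambda>p. (norm (N (fst p) (snd p)))\<^sup>2 * (1 / 2) + 1 / 2 * ((norm (x (fst p)))\<^sup>2 * (norm (y (snd p)))\<^sup>2)) summable_on UNIV"
    using assms(1)[unfolded hilbert_schmidt_def case_prod_unfold]
      sq_prod_summable(1)[OF assms(2,3), unfolded case_prod_unfold]
    by (intro summable_on_add summable_on_cmult_right summable_on_cmult_left)
  show "norm (cnj (x (fst p)) * N (fst p) (snd p) * y (snd p))
      \<le> (norm (N (fst p) (snd p)))\<^sup>2 * (1 / 2) + 1 / 2 * ((norm (x (fst p)))\<^sup>2 * (norm (y (snd p)))\<^sup>2)" for p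
    using hform_term_bound[of 1 "x (fst p)" "N (fst p) (snd p)" "y (snd p)"] by simp
qed auto

lemma hform_summable:
  assumes "hilbert_schmidt N" "sqsum x" "sqsum y"
  shows "(\<lambda>(j, k). cnj (x j) * N j k * y k) summable_on UNIV"
  using abs_summable_summable[OF hform_abs_summable[OF assms]] by (simp add: case_prod_unfold)

lemma hform_add_right:
  assumes "hilbert_schmidt N" "sqsum x" "sqsum y" "sqsum z"
  shows "hform N x (\<lambda>k. y k + z k) = hform N x y + hform N x z"
  using infsum_add[OF hform_summable[OF assms(1,2,3)] hform_summable[OF assms(1,2,4)]]
  by (simp add: hform_def case_prod_unfold ring_distribs)

lemma hform_add_left:
  assumes "hilbert_schmidt N" "sqsum x" "sqsum y" "sqsum z"
  shows "hform N (\<lambda>k. x k + y k) z = hform N x z + hform N y z"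
  using infsum_add[OF hform_summable[OF assms(1,2,4)] hform_summable[OF assms(1,3,4)]]
  by (simp add: hform_def case_prod_unfold ring_distribs)

lemma hform_cmult_right: "hform N x (\<lambda>k. a * y k) = a * hform N x y"
  by (simp add: hform_def case_prod_unfold infsum_cmult_right'[symmetric] mult_ac)

lemma hform_cmult_left: "hform N (\<lambda>k. a * x k) y = cnj a * hform N x y"
  by (simp add: hform_def case_prod_unfold infsum_cmult_right'[symmetric] mult_ac)

lemma hform_herm:
  assumes "\<And>j k. N j k = cnj (N k j)"
  shows "hform N y x = cnj (hform N x y)"
proof -
  have "cnj (hform N x y) = (\<Sum>\<^sub>\<infinity>p. cnj (cnj (x (fst p)) * N (fst p) (snd p) * y (snd p)))"
    by (simp add: hform_def case_prod_unfold infsum_cnj[symmetric] del: complex_cnj_mult infsum_cnj)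
  also have "\<dots> = (\<Sum>\<^sub>\<infinity>p. cnj (y (snd p)) * N (snd p) (fst p) * x (fst p))"
    by (intro infsum_cong) (subst (2) assms, simp add: mult_ac)
  also have "\<dots> = hform N y x"
    unfolding hform_def
    by (rule infsum_reindex_bij_witness[where i = prod.swap and j = prod.swap]) auto
  finally show ?thesis by simp
qed

text \<open>Recovers the entries of the operator from its form, for the first order condition at a
  maximum.\<close>

lemma hform_single:
  assumes "hilbert_schmidt N" "sqsum y"
  shows "hform N (\<lambda>k. if k = j then a else 0) y = cnj a * (\<Sum>\<^sub>\<infinity>k. N j k * y k)"
proof -
  define x where "x = (\<lambda>k. if k = j then a else 0 :: complex)"
  have 1: "(\<lambda>(i, k). cnj (x i) * N i k * y k) summable_on (SIGMA i:UNIV. UNIV)"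
    using hform_summable[OF assms(1) sqsum_single[of j a] assms(2)] by (simp add: x_def)
  have "hform N x y = (\<Sum>\<^sub>\<infinity>i. \<Sum>\<^sub>\<infinity>k. cnj (x i) * N i k * y k)"
    unfolding hform_def using infsum_Sigma_banach[OF 1] by simp
  also have "\<dots> = (\<Sum>\<^sub>\<infinity>i\<in>{j}. \<Sum>\<^sub>\<infinity>k. cnj (x i) * N i k * y k)"
    by (rule infsum_cong_neutral) (auto simp: x_def)
  also have "\<dots> = cnj a * (\<Sum>\<^sub>\<infinity>k. N j k * y k)"
    by (simp add: x_def mult.assoc infsum_cmult_right')
  finally show ?thesis by (simp add: x_def)
qed

text \<open>A quadratic that vanishes at 0 and is nowhere negative has slope 0 there. This is the
  first order condition at both extremal arguments of the proof: the eigenvector and the minimizer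
  \<open>h1 i\<close>.\<close>

lemma nonneg_quadratic_linear_coeff:
  fixes R K :: real
  assumes "\<And>e. 0 \<le> 2 * e * R + e\<^sup>2 * K"
  shows "R = 0"
proof (rule ccontr)
  assume R: "R \<noteq> 0"
  define d where "d = \<bar>K\<bar> + 1"
  have d: "d > 0" "K < d" by (auto simp: d_def)
  have "0 \<le> 2 * (- R / d) * R + (- R / d)\<^sup>2 * K" by (rule assms)
  also have "\<dots> = (R / d)\<^sup>2 * (K - 2 * d)"
    using d by (simp add: field_simps power2_eq_square)
  also have "\<dots> < 0" using R d by (intro mult_pos_neg) auto
  finally show False by simp
qed

section \<open>Weak compactness and the extremal problem\<close>

definition l2ball :: "('i \<Rightarrow> complex) set" where
  "l2ball = {y. \<forall>X. finite X \<longrightarrow> (\<Sum>k\<in>X. (norm (y k))\<^sup>2) \<le> 1}"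

lemma l2ball_iff: "y \<in> l2ball \<longleftrightarrow> sqsum y \<and> sqn y \<le> 1"
proof
  assume y: "y \<in> l2ball"
  then have "sqsum y"
    unfolding sqsum_def by (intro nonneg_bdd_above_summable_on) (auto simp: l2ball_def intro!: bdd_aboveI2)
  moreover have "sqn y \<le> 1"
    unfolding sqn_def using y \<open>sqsum y\<close>
    by (intro infsum_le_finite_sums) (auto simp: l2ball_def sqsum_def)
  ultimately show "sqsum y \<and> sqn y \<le> 1" ..
next
  assume y: "sqsum y \<and> sqn y \<le> 1"
  have "(\<Sum>k\<in>X. (norm (y k))\<^sup>2) \<le> sqn y" if "finite X" for X
    unfolding sqn_def using y that by (intro finite_sum_le_infsum) (auto simp: sqsum_def)
  then show "y \<in> l2ball" using y unfolding l2ball_def by force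
qed

lemma continuous_on_coord:
  "continuous_on S (\<lambda>y :: 'i \<Rightarrow> complex. y k)"
  by (rule continuous_on_subset[OF continuous_on_product_coordinates subset_UNIV])

text \<open>Tychonoff: the ball is a closed subset of a product of discs for coordinatewise
  convergence. Describing \<open>l2ball\<close> by finite partial sums is what makes it closed in
  that topology.\<close>

lemma compact_l2ball: "compact (l2ball :: ('i \<Rightarrow> complex) set)"
proof -
  have "compactin (product_topology (\<lambda>i. euclidean) UNIV) (PiE (UNIV :: 'i set) (\<lambda>i. cball (0::complex) 1))"
    unfolding compactin_PiE by simp
  then have c: "compact (PiE (UNIV :: 'i set) (\<lambda>i. cball (0::complex) 1))"
    by (simp add: euclidean_product_topology)
  have "closed (\<Inter>X\<in>Collect finite. {y :: 'i \<Rightarrow> complex. (\<Sum>k\<in>X. (norm (y k))\<^sup>2) \<le> 1})"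
    by (intro closed_INT ballI closed_Collect_le continuous_on_sum continuous_on_power continuous_on_norm
          continuous_on_coord continuous_on_const)
  moreover have "(\<Inter>X\<in>Collect finite. {y :: 'i \<Rightarrow> complex. (\<Sum>k\<in>X. (norm (y k))\<^sup>2) \<le> 1}) = l2ball"
    by (auto simp: l2ball_def)
  ultimately have "compact (PiE (UNIV :: 'i set) (\<lambda>i. cball (0::complex) 1) \<inter> l2ball)"
    using c by (simp add: compact_Int_closed)
  moreover have "l2ball \<subseteq> PiE (UNIV :: 'i set) (\<lambda>i. cball (0::complex) 1)"
  proof
    fix y :: "'i \<Rightarrow> complex" assume "y \<in> l2ball"
    then have "(norm (y k))\<^sup>2 \<le> 1" for k
      unfolding l2ball_def by (auto dest: spec[of _ "{k}"])
    then show "y \<in> PiE UNIV (\<lambda>i. cball 0 1)" by (auto simp: PiE_def power_le_one_iff)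
  qed
  ultimately show ?thesis by (simp add: Int_absorb1)
qed

text \<open>In the topology of coordinatewise convergence a merely bounded form need not be
  continuous. For a Hilbert-Schmidt matrix the finite partial sums converge uniformly on the ball,
  since the remainder is controlled by the tail of the squared entries.\<close>

lemma continuous_on_hform:
  fixes N :: "'i \<Rightarrow> 'i \<Rightarrow> complex"
  assumes N: "hilbert_schmidt N"
  shows "continuous_on l2ball (\<lambda>y. Re (hform N y y))"
proof (rule uniform_limit_theorem)
  define g where "g = (\<lambda>p. (norm (N (fst p) (snd p)))\<^sup>2)"
  define T where "T y p = cnj (y (fst p)) * N (fst p) (snd p) * y (snd p)" for y :: "'i \<Rightarrow> complex" and p
  have g: "g summable_on UNIV" using N by (simp add: g_def hilbert_schmidt_def case_prod_unfold)
  show "\<forall>\<^sub>F X in finite_subsets_at_top UNIV. continuous_on l2ball (\<lambda>y. Re (\<Sum>p\<in>X. T y p))"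
    unfolding T_def
    by (intro always_eventually allI continuous_on_Re continuous_on_sum continuous_on_mult
          continuous_on_cnj continuous_on_const continuous_on_coord)
  show "uniform_limit l2ball (\<lambda>X y. Re (\<Sum>p\<in>X. T y p)) (\<lambda>y. Re (hform N y y)) (finite_subsets_at_top UNIV)"
  proof (rule uniform_limitI)
    fix e :: real assume e: "e > 0"
    have "(sum g \<longlongrightarrow> infsum g UNIV) (finite_subsets_at_top UNIV)"
      using has_sum_infsum[OF g] by (simp add: has_sum_def)
    \<comment> \<open>The tail is required to be below \<open>e^2\<close> because Young's inequality
      divides it by \<open>2 * e\<close>, which leaves \<open>e / 2\<close>.\<close>
    then have "\<forall>\<^sub>F X in finite_subsets_at_top UNIV. dist (sum g X) (infsum g UNIV) < e\<^sup>2"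
      using e by (intro tendstoD) auto
    moreover have "\<forall>\<^sub>F X :: ('i \<times> 'i) set in finite_subsets_at_top UNIV. finite X"
      by (rule eventually_finite_subsets_at_top_weakI)
    ultimately show "\<forall>\<^sub>F X in finite_subsets_at_top UNIV. \<forall>y\<in>l2ball.
        dist (Re (\<Sum>p\<in>X. T y p)) (Re (hform N y y)) < e"
    proof (eventually_elim, intro ballI, goal_cases)
      case (1 X y)
      then have y: "sqsum y" "sqn y \<le> 1" by (auto simp: l2ball_iff)
      define h where "h = (\<lambda>p. (norm (y (fst p)))\<^sup>2 * (norm (y (snd p)))\<^sup>2)"
      have h: "h summable_on UNIV" "infsum h UNIV \<le> 1"
        using sq_prod_summable[OF y(1) y(1)] y(2) sqn_nonneg[of y]
        by (auto simp: h_def case_prod_unfold mult_le_one)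
      have Ts: "(\<lambda>p. norm (T y p)) summable_on UNIV"
        using hform_abs_summable[OF N y(1) y(1)] by (simp add: T_def)
      have gX: "infsum g (UNIV - X) < e\<^sup>2"
        using 1(1) infsum_Diff[OF g, of X] 1(2) by (auto simp: dist_norm)
      have hX: "infsum h (UNIV - X) \<le> 1"
      proof -
        have "infsum h (UNIV - X) \<le> infsum h UNIV"
          by (rule infsum_mono_neutral) (auto simp: h_def intro: summable_on_subset[OF h(1), unfolded h_def] h(1)[unfolded h_def])
        then show ?thesis using h(2) by simp
      qed
      have gs: "g summable_on (UNIV - X)" and hs: "h summable_on (UNIV - X)" and Tsx: "(\<lambda>p. norm (T y p)) summable_on (UNIV - X)"
        using g h(1) Ts by (auto intro: summable_on_subset)
      have "hform N y y - (\<Sum>p\<in>X. T y p) = infsum (T y) (UNIV - X)"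
        using infsum_Diff[OF abs_summable_summable[OF Ts], of X] 1(2)
        by (simp add: hform_def T_def[abs_def] case_prod_unfold)
      then have "dist (Re (\<Sum>p\<in>X. T y p)) (Re (hform N y y)) = \<bar>Re (infsum (T y) (UNIV - X))\<bar>"
        by (metis abs_minus_commute dist_real_def minus_complex.sel(1))
      also have "\<dots> \<le> norm (infsum (T y) (UNIV - X))" by (rule abs_Re_le_cmod)
      also have "\<dots> \<le> infsum (\<lambda>p. norm (T y p)) (UNIV - X)"
        by (rule norm_infsum_bound) (rule Tsx)
      also have "\<dots> \<le> infsum (\<lambda>p. g p * (1 / (2 * e)) + e / 2 * h p) (UNIV - X)"
      proof (rule infsum_mono[OF Tsx])
        show "(\<lambda>p. g p * (1 / (2 * e)) + e / 2 * h p) summable_on (UNIV - X)"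
          by (intro summable_on_add summable_on_cmult_left summable_on_cmult_right gs hs)
        show "norm (T y p) \<le> g p * (1 / (2 * e)) + e / 2 * h p" for p
          using hform_term_bound[OF e, of "y (fst p)" "N (fst p) (snd p)" "y (snd p)"]
          by (simp add: T_def g_def h_def)
      qed
      also have "\<dots> = infsum g (UNIV - X) * (1 / (2 * e)) + e / 2 * infsum h (UNIV - X)"
        by (simp only: infsum_add[OF summable_on_cmult_left[OF gs] summable_on_cmult_right[OF hs]]
            infsum_cmult_left' infsum_cmult_right')
      also have "\<dots> < e\<^sup>2 * (1 / (2 * e)) + e / 2 * 1"
        using gX hX e by (intro add_less_le_mono mult_strict_right_mono mult_left_mono) auto
      also have "\<dots> = e" using e by (simp add: power2_eq_square)
      finally show ?case .
    qed
  qed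
qed simp

text \<open>The form attains a maximum \<open>\<nu>\<close> on the ball, \<open>z\<close> forces
  \<open>\<nu> > 1\<close>, and the first order condition in each coordinate direction is the
  eigenvalue equation.\<close>

theorem hilbert_schmidt_eigenvector:
  fixes N :: "'i \<Rightarrow> 'i \<Rightarrow> complex"
  assumes N: "hilbert_schmidt N" and herm: "\<And>j k. N j k = cnj (N k j)"
    and z: "sqsum z" "Re (hform N z z) > sqn z"
  obtains \<nu> y where "\<nu> > 1" "sqsum y" "\<exists>j. y j \<noteq> 0" "\<And>j. (\<Sum>\<^sub>\<infinity>k. N j k * y k) = of_real \<nu> * y j"
proof -
  define F where "F y = Re (hform N y y)" for y
  have Fscale: "F (\<lambda>k. a * y k) = (norm a)\<^sup>2 * F y" for a y
  proof -
    have "cnj a * (a * h) = of_real ((norm a)\<^sup>2) * h" for h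
      unfolding complex_norm_square by (simp add: mult_ac)
    then have "hform N (\<lambda>k. a * y k) (\<lambda>k. a * y k) = of_real ((norm a)\<^sup>2) * hform N y y"
      by (simp only: hform_cmult_left hform_cmult_right)
    then show ?thesis
      by (simp add: F_def del: of_real_power)
  qed
  have "(\<lambda>k. 0) \<in> (l2ball :: ('i \<Rightarrow> complex) set)" by (auto simp: l2ball_def)
  then have "(l2ball :: ('i \<Rightarrow> complex) set) \<noteq> {}" by auto
  from continuous_attains_sup[OF compact_l2ball this continuous_on_hform[OF N]]
  obtain y where y: "y \<in> l2ball" and ymax: "\<And>x. x \<in> l2ball \<Longrightarrow> F x \<le> F y"
    unfolding F_def by auto
  define \<nu> where "\<nu> = F y"
  have F_le: "F x \<le> \<nu> * sqn x" if x: "sqsum x" "sqn x > 0" for x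
  proof -
    define r where "r = 1 / sqrt (sqn x)"
    have r: "(norm (of_real r :: complex))\<^sup>2 = 1 / sqn x"
      using x by (simp add: r_def power_divide norm_divide)
    have "(\<lambda>k. of_real r * x k) \<in> l2ball"
      unfolding l2ball_iff sqn_cmult r using x by (simp add: sqsum_cmult)
    from ymax[OF this, unfolded Fscale r, folded \<nu>_def] have "F x / sqn x \<le> \<nu>" by simp
    then show ?thesis using x by (simp add: field_simps)
  qed
  have "sqn z \<noteq> 0"
  proof
    assume "sqn z = 0"
    have "z k = 0" for k by (rule sqn_eq_0[OF z(1) \<open>sqn z = 0\<close>])
    then have "hform N z z = 0" by (simp add: hform_def case_prod_unfold)
    then show False using z(2) \<open>sqn z = 0\<close> by simp
  qed
  then have z0: "sqn z > 0" using sqn_nonneg[of z] by simp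
  have "1 * sqn z < \<nu> * sqn z" using F_le[OF z(1) z0] z(2) by (simp add: F_def)
  then have nu: "\<nu> > 1" using z0 mult_less_cancel_right_pos by blast
  have ys: "sqsum y" "sqn y \<le> 1" using y by (auto simp: l2ball_iff)
  have y0: "sqn y \<noteq> 0"
  proof
    assume "sqn y = 0"
    have "y k = 0" for k by (rule sqn_eq_0[OF ys(1) \<open>sqn y = 0\<close>])
    then have "F y = 0" by (simp add: F_def hform_def case_prod_unfold)
    then show False using nu by (simp add: \<nu>_def)
  qed
  have F_le0: "F x \<le> \<nu> * sqn x" if x: "sqsum x" for x
  proof (cases "sqn x = 0")
    case True
    have "x k = 0" for k by (rule sqn_eq_0[OF x True])
    then show ?thesis using True by (simp add: F_def hform_def case_prod_unfold)
  qed (use F_le[OF x] sqn_nonneg[of x] in auto)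
  \<comment> \<open>Only \<open>sqn y \<le> 1\<close> is known about the maximizer; this inequality
    does the work of a normalization.\<close>
  have G0: "\<nu> * sqn y - F y \<le> 0"
    using mult_left_mono[OF ys(2), of \<nu>] nu unfolding \<nu>_def[symmetric] by simp
  \<comment> \<open>The values \<open>a = 1\<close> and \<open>a = \<i>\<close> will give the real
    and the imaginary part of the eigenvalue equation.\<close>
  have key: "Re (cnj a * (of_real \<nu> * y j - (\<Sum>\<^sub>\<infinity>k. N j k * y k))) = 0" for a j
  proof (rule nonneg_quadratic_linear_coeff)
    fix e :: real
    define d where "d = (\<lambda>k. if k = j then a else 0)"
    define d' where "d' = (\<lambda>k. of_real e * d k)"
    have d: "sqsum d" "sqsum d'" unfolding d'_def d_def by (intro sqsum_cmult sqsum_single)+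
    have "F (\<lambda>k. y k + d' k) = F y + Re (hform N d' y) + Re (hform N y d') + Re (hform N d' d')"
      unfolding F_def
      by (simp add: hform_add_left[OF N] hform_add_right[OF N] ys d sqsum_add)
    also have "hform N y d' = cnj (hform N d' y)" by (rule hform_herm[OF herm])
    finally have F1: "F (\<lambda>k. y k + d' k) = F y + 2 * e * Re (cnj a * (\<Sum>\<^sub>\<infinity>k. N j k * y k)) + e\<^sup>2 * F d"
      using hform_single[OF N ys(1), of j a]
      by (simp add: d'_def hform_cmult_left hform_cmult_right F_def power2_eq_square d_def)
    have "(norm (y k + d' k))\<^sup>2 = (norm (y k))\<^sup>2 + (if k = j then 2 * e * Re (cnj a * y j) + e\<^sup>2 * (norm a)\<^sup>2 else 0)" for k
    proof -
      have "(norm (u + of_real e * a))\<^sup>2 = (norm u)\<^sup>2 + (2 * e * Re (cnj a * u) + e\<^sup>2 * (norm a)\<^sup>2)" for u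
        unfolding cmod_power2 by (simp add: power2_eq_square algebra_simps)
      then show ?thesis by (simp add: d'_def d_def)
    qed
    then have "sqn (\<lambda>k. y k + d' k) = (\<Sum>\<^sub>\<infinity>k. (norm (y k))\<^sup>2 + (if k = j then 2 * e * Re (cnj a * y j) + e\<^sup>2 * (norm a)\<^sup>2 else 0))"
      unfolding sqn_def by (simp only:)
    also have "\<dots> = sqn y + (\<Sum>\<^sub>\<infinity>k. (if k = j then 2 * e * Re (cnj a * y j) + e\<^sup>2 * (norm a)\<^sup>2 else 0))"
      unfolding sqn_def
      by (rule infsum_add) (use ys in \<open>auto simp: sqsum_def intro!: finite_nonzero_values_imp_summable_on
            intro: finite_subset[of _ "{j}"]\<close>)
    also have "(\<Sum>\<^sub>\<infinity>k. (if k = j then 2 * e * Re (cnj a * y j) + e\<^sup>2 * (norm a)\<^sup>2 else 0))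
        = (\<Sum>\<^sub>\<infinity>k\<in>{j}. (if k = j then 2 * e * Re (cnj a * y j) + e\<^sup>2 * (norm a)\<^sup>2 else 0))"
      by (rule infsum_cong_neutral) auto
    finally have S1: "sqn (\<lambda>k. y k + d' k) = sqn y + 2 * e * Re (cnj a * y j) + e\<^sup>2 * (norm a)\<^sup>2"
      by simp
    have "0 \<le> \<nu> * sqn (\<lambda>k. y k + d' k) - F (\<lambda>k. y k + d' k)"
      using F_le0[of "\<lambda>k. y k + d' k"] by (simp add: sqsum_add ys d)
    also have "\<dots> = (\<nu> * sqn y - F y) + 2 * e * Re (cnj a * (of_real \<nu> * y j - (\<Sum>\<^sub>\<infinity>k. N j k * y k)))
        + e\<^sup>2 * (\<nu> * (norm a)\<^sup>2 - F d)"
      unfolding F1 S1 by (simp add: algebra_simps)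
    finally show "0 \<le> 2 * e * Re (cnj a * (of_real \<nu> * y j - (\<Sum>\<^sub>\<infinity>k. N j k * y k)))
        + e\<^sup>2 * (\<nu> * (norm a)\<^sup>2 - F d)"
      using G0 by linarith
  qed
  have "(\<Sum>\<^sub>\<infinity>k. N j k * y k) = of_real \<nu> * y j" for j
    using key[of 1 j] key[of \<i> j] by (simp add: complex_eq_iff)
  moreover have "\<exists>j. y j \<noteq> 0"
  proof (rule ccontr)
    assume "\<not> (\<exists>j. y j \<noteq> 0)"
    then have "sqn y = 0" by (simp add: sqn_def)
    with y0 show False by simp
  qed
  ultimately show ?thesis using that nu ys(1) by blast
qed

section \<open>Harmonic functions on the Moebius strip\<close>

lemma strip_mem [simp]: "(t, \<theta>) \<in> strip T \<longleftrightarrow> t \<in> {-T..T}"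
  by (simp add: strip_def)

lemma continuous_strip_slice:
  assumes "continuous_on (strip T) f" "t \<in> {-T..T}"
  shows "continuous_on UNIV (\<lambda>\<theta>. f (t, \<theta>))"
  using assms by (intro continuous_on_compose2[OF assms(1)] continuous_intros) auto

lemma C1_dt:
  assumes "C1_strip T f" "t \<in> {-T..T}"
  shows "((\<lambda>s. f (s, \<theta>)) has_vector_derivative dt T f (t, \<theta>)) (at t within {-T..T})"
  using assms by (auto simp: C1_strip_def dt_def vector_derivative_works[symmetric])

lemma C1_dth:
  assumes "C1_strip T f" "t \<in> {-T..T}"
  shows "((\<lambda>\<phi>. f (t, \<phi>)) has_vector_derivative dth f (t, \<theta>)) (at \<theta>)"
  using assms by (auto simp: C1_strip_def dth_def vector_derivative_works[symmetric])

lemma dt_eqI: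
  assumes "T > 0" "t \<in> {-T..T}"
    and "((\<lambda>s. f (s, \<theta>)) has_vector_derivative d) (at t within {-T..T})"
  shows "dt T f (t, \<theta>) = d"
  using vector_derivative_within_cbox[of "-T" T t _ d] assms
  by (simp add: dt_def)

lemma dth_eqI:
  assumes "((\<lambda>\<phi>. f (t, \<phi>)) has_vector_derivative d) (at \<theta>)"
  shows "dth f (t, \<theta>) = d"
  using vector_derivative_at[OF assms] by (simp add: dth_def)

lemma const_of_zero_derivative:
  assumes "\<And>t. t \<in> {a..b} \<Longrightarrow> (g has_vector_derivative 0) (at t within {a..b})"
  shows "\<exists>q. \<forall>t\<in>{a..b :: real}. g t = q"
  using has_vector_derivative_zero_constant[OF convex_real_interval(5), of a b g] assms by metis

lemma mobius_shift:
  assumes "mobius_sym T f" "t \<in> {-T..T}"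
  shows "f (- t, \<theta>) = f (t, \<theta> + pi)" "f (t, \<theta> + 2 * pi) = f (t, \<theta>)"
proof -
  show 2: "f (t, \<theta> + 2 * pi) = f (t, \<theta>)" for \<theta> using assms by (auto simp: mobius_sym_def)
  have "f (- t, \<theta>) = f (- t, (\<theta> - pi) + pi)" by simp
  also have "\<dots> = f (t, \<theta> - pi)" using assms unfolding mobius_sym_def by blast
  also have "\<dots> = f (t, \<theta> - pi + 2 * pi)" using 2[of "\<theta> - pi"] by simp
  finally show "f (- t, \<theta>) = f (t, \<theta> + pi)" by (simp add: algebra_simps)
qed

text \<open>The involution reverses \<open>t\<close> and preserves the orientation of the angle, so
  \<open>dt\<close> picks up a sign and \<open>dth\<close> does not. The twist of the band acts on
  first derivatives through this difference alone.\<close>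

lemma dt_sym:
  assumes T: "T > 0" and f: "mobius_sym T f" "C1_strip T f" and t: "t \<in> {-T..T}"
  shows "dt T f (- t, \<theta>) = - dt T f (t, \<theta> + pi)" "dt T f (t, \<theta> + 2 * pi) = dt T f (t, \<theta>)"
proof -
  have t': "- t \<in> {-T..T}" using t by auto
  have im: "uminus ` {-T..T} = {-T..T}" by (auto simp: image_iff intro: bexI[of _ "- x" for x])
  have "((\<lambda>s. f (- s, \<theta> + pi)) has_vector_derivative (- 1) *\<^sub>R dt T f (t, \<theta> + pi)) (at (- t) within {-T..T})"
    using vector_diff_chain_within[of uminus "- 1" "- t" "{-T..T}" "\<lambda>s. f (s, \<theta> + pi)" "dt T f (t, \<theta> + pi)"]
      C1_dt[OF f(2) t, of "\<theta> + pi"]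
    by (simp add: im o_def has_vector_derivative_minus[OF has_vector_derivative_id, simplified])
  then have "((\<lambda>s. f (s, \<theta>)) has_vector_derivative (- 1) *\<^sub>R dt T f (t, \<theta> + pi)) (at (- t) within {-T..T})"
    by (rule has_vector_derivative_transform[OF t', rotated])
       (metis mobius_shift(1)[OF f(1)] add.inverse_inverse atLeastAtMost_iff minus_le_iff le_minus_iff)
  from dt_eqI[OF T t' this] show "dt T f (- t, \<theta>) = - dt T f (t, \<theta> + pi)" by simp
  have "((\<lambda>s. f (s, \<theta> + 2 * pi)) has_vector_derivative dt T f (t, \<theta>)) (at t within {-T..T})"
    by (rule has_vector_derivative_transform[OF t _ C1_dt[OF f(2) t]]) (rule mobius_shift(2)[OF f(1)])
  from dt_eqI[OF T t this] show "dt T f (t, \<theta> + 2 * pi) = dt T f (t, \<theta>)" .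
qed

lemma dth_sym:
  assumes f: "mobius_sym T f" "C1_strip T f" and t: "t \<in> {-T..T}"
  shows "dth f (- t, \<theta>) = dth f (t, \<theta> + pi)" "dth f (t, \<theta> + 2 * pi) = dth f (t, \<theta>)"
proof -
  have sh: "((\<lambda>\<phi>. f (t, \<phi> + a)) has_vector_derivative dth f (t, \<theta> + a)) (at \<theta>)" for a \<theta>
  proof -
    have "((\<lambda>\<phi>. \<phi> + a) has_vector_derivative 1) (at \<theta>)"
      by (auto intro!: derivative_eq_intros)
    from vector_diff_chain_at[OF this C1_dth[OF f(2) t, of "\<theta> + a"]]
    show ?thesis by (simp add: o_def)
  qed
  show "dth f (- t, \<theta>) = dth f (t, \<theta> + pi)"
    using sh[of pi] mobius_shift(1)[OF f(1) t] by (intro dth_eqI) simp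
  show "dth f (t, \<theta> + 2 * pi) = dth f (t, \<theta>)"
    using sh[of "2 * pi" \<theta>] mobius_shift(2)[OF f(1) t] by (intro dth_eqI[symmetric]) simp
qed

lemma integral_shift_pi:
  fixes F :: "real \<Rightarrow> complex"
  assumes F: "cper F"
  shows "integral {0..2 * pi} (\<lambda>x. F (x + pi)) = integral {0..2 * pi} F"
proof -
  have i: "F integrable_on {a..b}" for a b
    by (rule integrable_continuous_real[OF cper_cont[OF F]])
  have sh: "integral {a..b} (\<lambda>x. F (x + c)) = integral {a + c..b + c} F" for a b c
    using integral_shift[of a c b F] cper_cont[OF F] by (simp add: o_def add.commute)
  have "integral {0..2 * pi} (\<lambda>x. F (x + pi)) = integral {pi..3 * pi} F"
    using sh[of 0 "2 * pi" pi] by simp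
  also have "\<dots> = integral {pi..2 * pi} F + integral {2 * pi..3 * pi} F"
    using Henstock_Kurzweil_Integration.integral_combine[of pi "2 * pi" "3 * pi" F] i by simp
  also have "integral {2 * pi..3 * pi} F = integral {0..pi} (\<lambda>x. F (x + 2 * pi))"
    using sh[of 0 pi "2 * pi"] by simp
  also have "\<dots> = integral {0..pi} F" using cper_shift[OF F] by simp
  also have "integral {pi..2 * pi} F + integral {0..pi} F = integral {0..2 * pi} F"
    using Henstock_Kurzweil_Integration.integral_combine[of 0 pi "2 * pi" F] i by (simp add: add.commute)
  finally show ?thesis .
qed

section \<open>Radial profiles and the Dirichlet-to-Neumann multiplier\<close>

definition sg :: "int \<Rightarrow> real" where
  "sg k = (if even k then 1 else - 1)"

lemma sg_minus [simp]: "sg (- k) = sg k"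
  by (simp add: sg_def)

lemma sg_sq [simp]: "sg k * sg k = 1"
  by (simp add: sg_def)

lemma abs_sg [simp]: "\<bar>sg k\<bar> = 1"
  by (simp add: sg_def)

lemma mode_pi: "mode k pi = of_real (sg k)"
proof (cases "even k")
  case True
  then obtain m where "k = 2 * m" by blast
  then have "mode k pi = cis (2 * pi * of_int m)" by (simp add: mode_def mult_ac)
  then show ?thesis using True by (simp add: sg_def)
next
  case False
  then obtain m where "k = 2 * m + 1" by (elim oddE)
  then have "mode k pi = cis (2 * pi * of_int m + pi)" by (simp add: mode_def algebra_simps)
  also have "\<dots> = cis (2 * pi * of_int m) * cis pi" by (simp only: cis_mult)
  finally show ?thesis using False by (simp add: sg_def)
qed

lemma fc_shift_pi:
  assumes "cper f"
  shows "fc (\<lambda>x. f (x + pi)) k = of_real (sg k) * fc f k"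
proof -
  have eq: "mode (- k) x = of_real (sg k) * mode (- k) (x + pi)" for x
    by (simp add: mode_arg_add mode_pi sg_def)
  have "integral {0..2 * pi} (\<lambda>x. f (x + pi) * mode (- k) x)
      = integral {0..2 * pi} (\<lambda>x. of_real (sg k) * (f (x + pi) * mode (- k) (x + pi)))"
    by (intro integral_cong) (subst eq, simp only: mult_ac)
  also have "\<dots> = of_real (sg k) * integral {0..2 * pi} (\<lambda>x. f x * mode (- k) x)"
    using integral_shift_pi[of "\<lambda>x. f x * mode (- k) x"] assms by (simp add: cper_mult)
  finally show ?thesis by (simp add: fc_def)
qed

text \<open>Up to a factor, \<^term>\<open>XC k t\<close> is \<^term>\<open>cosh (of_int k * t)\<close> for even \<open>k\<close> and
  \<^term>\<open>sinh (of_int k * t)\<close> for odd \<open>k\<close>: the radial profiles compatible with the involution.\<close>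

definition XC :: "int \<Rightarrow> real \<Rightarrow> real" where
  "XC k t = exp (of_int k * t) + sg k * exp (- of_int k * t)"

definition XS :: "int \<Rightarrow> real \<Rightarrow> real" where
  "XS k t = exp (of_int k * t) - sg k * exp (- of_int k * t)"

text \<open>The eigenvalue of the Dirichlet-to-Neumann map of the flat band on mode
  \<open>k\<close>, namely the logarithmic derivative of the profile at \<open>t = T\<close>:
  \<open>k tanh (k T)\<close> for even \<open>k\<close> and \<open>k coth (k T)\<close> for odd
  \<open>k\<close>.\<close>

definition mu :: "real \<Rightarrow> int \<Rightarrow> real" where
  "mu T k = of_int k * XS k T / XC k T"

lemma XC_minus: "XC (- k) t = sg k * XC k t"
  by (simp add: XC_def sg_def)

lemma XS_minus: "XS (- k) t = - sg k * XS k t"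
  by (simp add: XS_def sg_def)

lemma XC_neg_arg: "XC k (- t) = sg k * XC k t"
  by (simp add: XC_def sg_def)

lemma mu_minus [simp]: "mu T (- k) = mu T k"
  by (auto simp: mu_def XC_minus XS_minus sg_def)

lemma mu_0 [simp]: "mu T 0 = 0"
  by (simp add: mu_def)

lemma XC_has_derivative:
  "(XC k has_vector_derivative of_int k * XS k t) (at t within S)"
  unfolding XC_def[abs_def] XS_def has_real_derivative_iff_has_vector_derivative[symmetric]
  by (auto intro!: derivative_eq_intros simp: algebra_simps)

lemma XS_has_derivative:
  "(XS k has_vector_derivative of_int k * XC k t) (at t within S)"
  unfolding XC_def XS_def[abs_def] has_real_derivative_iff_has_vector_derivative[symmetric]
  by (auto intro!: derivative_eq_intros simp: algebra_simps)

text \<open>A lower bound, uniform in \<open>k > 0\<close>, for the quotient of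
  \<open>exp (k T) - exp (- k T)\<close> by \<open>2 exp (k T)\<close>; the estimates of
  \<open>mu\<close> carry this constant.\<close>

definition cT :: "real \<Rightarrow> real" where
  "cT T = (1 - exp (- 2 * T)) / 2"

context
  fixes T :: real
  assumes T: "T > 0"
begin

lemma cT_pos: "cT T > 0"
  using T by (simp add: cT_def)

lemma XC_XS_lower:
  assumes "k > 0"
  shows "2 * cT T * exp (of_int k * T) \<le> XC k T" "2 * cT T * exp (of_int k * T) \<le> XS k T"
proof -
  have k: "real_of_int k \<ge> 1" using assms by linarith
  have "exp (- of_int k * T) = exp (of_int k * T) * exp (- 2 * of_int k * T)"
    by (simp add: exp_add[symmetric])
  also have "\<dots> \<le> exp (of_int k * T) * exp (- 2 * T)"
    using k T by (intro mult_left_mono) auto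
  finally have "exp (- of_int k * T) \<le> exp (of_int k * T) * exp (- 2 * T)" .
  moreover have "2 * cT T * exp (of_int k * T) = exp (of_int k * T) - exp (of_int k * T) * exp (- 2 * T)"
    by (simp add: cT_def field_simps)
  ultimately have *: "2 * cT T * exp (of_int k * T) \<le> exp (of_int k * T) - exp (- of_int k * T)"
    by linarith
  have "exp (of_int k * T) - exp (- of_int k * T) \<le> XC k T" "exp (of_int k * T) - exp (- of_int k * T) \<le> XS k T"
    by (auto simp: XC_def XS_def sg_def)
  with * show "2 * cT T * exp (of_int k * T) \<le> XC k T" "2 * cT T * exp (of_int k * T) \<le> XS k T"
    by linarith+
qed

lemma XC_pos: "k \<ge> 0 \<Longrightarrow> XC k T > 0"
proof (cases "k = 0")
  case True
  then show ?thesis by (simp add: XC_def sg_def)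
next
  case False
  moreover assume "k \<ge> 0"
  ultimately have "k > 0" by simp
  then show ?thesis using XC_XS_lower(1)[of k] cT_pos
    by (smt (verit) exp_gt_zero mult_pos_pos)
qed

lemma XS_pos: "k > 0 \<Longrightarrow> XS k T > 0"
  using XC_XS_lower(2)[of k] cT_pos by (smt (verit) exp_gt_zero mult_pos_pos)

lemma XC_nz: "XC k T \<noteq> 0"
  using XC_pos[of k] XC_pos[of "- k"] by (cases "k \<ge> 0") (auto simp: XC_minus sg_def)

lemma XS_nz: "k \<noteq> 0 \<Longrightarrow> XS k T \<noteq> 0"
  using XS_pos[of k] XS_pos[of "- k"] by (cases "k > 0") (auto simp: XS_minus sg_def)

lemma XC_XS_upper:
  assumes "\<bar>t\<bar> \<le> T"
  shows "\<bar>XC k t\<bar> \<le> 2 * exp (\<bar>of_int k\<bar> * T)" "\<bar>XS k t\<bar> \<le> 2 * exp (\<bar>of_int k\<bar> * T)"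
proof -
  have "\<bar>of_int k * t\<bar> \<le> \<bar>of_int k\<bar> * T"
    using assms by (simp add: abs_mult mult_left_mono)
  then have "exp (of_int k * t) \<le> exp (\<bar>of_int k\<bar> * T)" "exp (- of_int k * t) \<le> exp (\<bar>of_int k\<bar> * T)"
    by auto
  moreover have "exp (of_int k * t) > 0" "exp (- of_int k * t) > 0" by simp_all
  moreover have "XC k t = exp (of_int k * t) + exp (- of_int k * t) \<or> XC k t = exp (of_int k * t) - exp (- of_int k * t)"
      "XS k t = exp (of_int k * t) + exp (- of_int k * t) \<or> XS k t = exp (of_int k * t) - exp (- of_int k * t)"
    by (auto simp: XC_def XS_def sg_def)
  ultimately show "\<bar>XC k t\<bar> \<le> 2 * exp (\<bar>of_int k\<bar> * T)" "\<bar>XS k t\<bar> \<le> 2 * exp (\<bar>of_int k\<bar> * T)"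
    by linarith+
qed

lemma X_ratio_bound:
  assumes "\<bar>t\<bar> \<le> T"
  shows "\<bar>XC k t / XC k T\<bar> \<le> 1 / cT T" "\<bar>XS k t / XC k T\<bar> \<le> 1 / cT T"
proof -
  have le: "\<bar>a / XC k T\<bar> \<le> 1 / cT T" if a: "\<bar>a\<bar> \<le> 2 * exp (\<bar>of_int k\<bar> * T)" "k \<noteq> 0" for a
  proof -
    have low: "2 * cT T * exp (\<bar>of_int k\<bar> * T) \<le> \<bar>XC k T\<bar>"
      using XC_XS_lower(1)[of k] XC_XS_lower(1)[of "- k"] that(2)
      by (cases "k > 0") (auto simp: XC_minus abs_mult sg_def split: if_splits)
    have "\<bar>a\<bar> / \<bar>XC k T\<bar> \<le> (2 * exp (\<bar>of_int k\<bar> * T)) / (2 * cT T * exp (\<bar>of_int k\<bar> * T))"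
      using a low cT_pos by (intro frac_le) auto
    then show ?thesis by (simp add: field_simps)
  qed
  have c: "cT T \<le> 1" unfolding cT_def
    by (rule order_trans[of _ "1 / 2"]) auto
  show "\<bar>XC k t / XC k T\<bar> \<le> 1 / cT T"
    using le[OF XC_XS_upper(1)[OF assms]] c cT_pos
    by (cases "k = 0") (auto simp: XC_def sg_def field_simps)
  show "\<bar>XS k t / XC k T\<bar> \<le> 1 / cT T"
    using le[OF XC_XS_upper(2)[OF assms]] c cT_pos
    by (cases "k = 0") (auto simp: XS_def sg_def field_simps)
qed

lemma mu_pos: "k \<noteq> 0 \<Longrightarrow> mu T k > 0"
proof -
  have *: "mu T k > 0" if "k > 0" for k
    unfolding mu_def using XC_pos[of k] XS_pos[of k] that by auto
  assume "k \<noteq> 0"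
  then show ?thesis using *[of k] *[of "- k"] by (cases "k > 0") auto
qed

lemma mu_nonneg: "mu T k \<ge> 0"
  using mu_pos[of k] by (cases "k = 0") auto

lemma mu_upper: "mu T k \<le> \<bar>of_int k\<bar> / cT T"
proof -
  have "mu T k \<le> \<bar>of_int k\<bar> * \<bar>XS k T / XC k T\<bar>"
    unfolding mu_def by (metis abs_ge_self abs_mult times_divide_eq_right)
  also have "\<dots> \<le> \<bar>of_int k\<bar> * (1 / cT T)"
    using X_ratio_bound(2)[of T k] T by (intro mult_left_mono) auto
  finally show ?thesis by simp
qed

lemma mu_lower: "cT T * \<bar>of_int k\<bar> \<le> mu T k"
proof -
  have *: "cT T * of_int k \<le> mu T k" if "k > 0" for k
  proof -
    have "2 * cT T * exp (of_int k * T) / (2 * exp (of_int k * T)) \<le> XS k T / XC k T"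
      using XC_XS_lower(2)[OF that] XC_XS_upper(1)[of T k] XC_pos[of k] XS_pos[of k] that T
      by (intro frac_le) auto
    then have "cT T \<le> XS k T / XC k T" by simp
    then have "of_int k * cT T \<le> of_int k * (XS k T / XC k T)" using that by (intro mult_left_mono) auto
    then show ?thesis by (simp add: mu_def mult.commute)
  qed
  show ?thesis
    using *[of k] *[of "- k"] by (cases "k > 0"; cases "k = 0") auto
qed

text \<open>For \<open>k < 0\<close> the sum is \<open>|k|\<close> times the deviation of
  \<open>tanh\<close> or \<open>coth\<close> from 1, hence exponentially small. Behind it: a mode
  \<open>k < 0\<close> of a holomorphic function on the strip is largest at the far end
  \<open>t = -T\<close>.\<close>

lemma mu_decay: "\<exists>C. \<forall>k<0. wt s k * \<bar>mu T k + of_int k\<bar> \<le> C"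
proof -
  define n where "n = Suc s"
  \<comment> \<open>Chosen so that \<open>1 + m \<le> K exp (2 T m / n)\<close>. The
    \<open>n\<close>-th power absorbs the weight together with one additional factor
    \<open>1 + m\<close>, hence \<open>n = Suc s\<close>.\<close>
  define K where "K = max 1 (real n / (2 * T))"
  have K: "K \<ge> 1" "K * (2 * T / real n) \<ge> 1"
    using T by (auto simp: K_def n_def field_simps max_def)
  have "wt s k * \<bar>mu T k + of_int k\<bar> \<le> K ^ n / cT T" if "k < 0" for k
  proof -
    define m where "m = - k"
    have m: "m > 0" using that by (simp add: m_def)
    then have m1: "real_of_int m \<ge> 1" by linarith
    have "mu T k + of_int k = - 2 * of_int m * sg m * exp (- of_int m * T) / XC m T"
    proof -
      have "mu T k + of_int k = mu T m - of_int m" by (simp add: m_def)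
      also have "\<dots> = of_int m * (XS m T - XC m T) / XC m T"
        using XC_nz[of m] by (simp add: mu_def field_simps)
      also have "XS m T - XC m T = - 2 * sg m * exp (- of_int m * T)"
        by (simp add: XC_def XS_def)
      finally show ?thesis by (simp add: mult_ac)
    qed
    then have "\<bar>mu T k + of_int k\<bar> = 2 * of_int m * exp (- of_int m * T) / XC m T"
      using m XC_pos[of m] by (simp add: abs_mult)
    also have "\<dots> \<le> 2 * of_int m * exp (- of_int m * T) / (2 * cT T * exp (of_int m * T))"
      using XC_XS_lower(1)[OF m] XC_pos[of m] cT_pos m by (intro divide_left_mono) auto
    also have "\<dots> = of_int m * exp (- 2 * of_int m * T) / cT T"
    proof -
      have eq: "exp (- 2 * of_int m * T) = exp (- of_int m * T) / exp (of_int m * T)"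
        by (simp add: exp_diff[symmetric])
      then show ?thesis unfolding eq by simp
    qed
    also have "\<dots> \<le> (1 + of_int m) * exp (- 2 * of_int m * T) / cT T"
      using cT_pos by (intro divide_right_mono mult_right_mono) auto
    finally have 1: "wt s k * \<bar>mu T k + of_int k\<bar> \<le> wt s k * ((1 + of_int m) * exp (- 2 * of_int m * T) / cT T)"
      by (intro mult_left_mono) auto
    have 2: "wt s k * (1 + of_int m) = (1 + of_int m) ^ n"
      using m by (simp add: wt_def m_def n_def)
    have "1 + of_int m \<le> K * (1 + 2 * T * of_int m / real n)"
    proof -
      have "of_int m * 1 \<le> of_int m * (K * (2 * T / real n))"
        using K(2) m1 by (intro mult_left_mono) auto
      then show ?thesis using K(1) by (simp add: algebra_simps)
    qed
    also have "\<dots> \<le> K * exp (2 * T * of_int m / real n)"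
      using K(1) by (intro mult_left_mono exp_ge_add_one_self) auto
    finally have "(1 + of_int m) ^ n \<le> (K * exp (2 * T * of_int m / real n)) ^ n"
      using m1 by (intro power_mono) auto
    also have "\<dots> = K ^ n * exp (2 * T * of_int m)"
      by (simp add: power_mult_distrib exp_of_nat_mult[symmetric] n_def del: of_nat_Suc power_Suc)
    finally have "(1 + of_int m) ^ n * exp (- 2 * of_int m * T) \<le> K ^ n * exp (2 * T * of_int m) * exp (- 2 * of_int m * T)"
      by (intro mult_right_mono) auto
    also have "\<dots> = K ^ n" by (simp add: mult.assoc exp_add[symmetric])
    finally have "(1 + of_int m) ^ n * exp (- 2 * of_int m * T) / cT T \<le> K ^ n / cT T"
      using cT_pos by (intro divide_right_mono) auto
    with 1 2 show ?thesis by (simp add: mult.assoc[symmetric])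
  qed
  then show ?thesis by blast
qed

end

section \<open>Fourier coefficients of harmonic functions on the strip\<close>

lemma cper_slice:
  fixes f :: "real \<times> real \<Rightarrow> real"
  assumes "continuous_on (strip T) f" "t \<in> {-T..T}" "\<And>\<theta>. f (t, \<theta> + 2 * pi) = f (t, \<theta>)"
  shows "cper (\<lambda>\<theta>. complex_of_real (f (t, \<theta>)))"
  using assms by (intro cperI continuous_on_of_real continuous_strip_slice) auto

lemma fc_slice_deriv:
  fixes f :: "real \<times> real \<Rightarrow> real"
  assumes f: "C1_strip T f" and t: "t \<in> {-T..T}"
  shows "((\<lambda>t. fc (\<lambda>\<theta>. of_real (f (t, \<theta>))) k) has_vector_derivative
      fc (\<lambda>\<theta>. of_real (dt T f (t, \<theta>))) k) (at t within {-T..T})"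
proof -
  have cf: "continuous_on (strip T) f" "continuous_on (strip T) (dt T f)"
    using f by (auto simp: C1_strip_def)
  have "((\<lambda>t. integral (cbox 0 (2 * pi)) (\<lambda>\<theta>. of_real (f (t, \<theta>)) * mode (- k) \<theta>)) has_vector_derivative
      integral (cbox 0 (2 * pi)) (\<lambda>\<theta>. of_real (dt T f (t, \<theta>)) * mode (- k) \<theta>)) (at t within {-T..T})"
  proof (rule leibniz_rule_vector_derivative[where fx = "\<lambda>t \<theta>. of_real (dt T f (t, \<theta>)) * mode (- k) \<theta>"])
    show "((\<lambda>t. of_real (f (t, \<theta>)) * mode (- k) \<theta>) has_vector_derivative of_real (dt T f (t, \<theta>)) * mode (- k) \<theta>)
        (at t within {-T..T})" if "t \<in> {-T..T}" for t \<theta>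
      by (intro has_vector_derivative_mult_left has_vector_derivative_of_real
          C1_dt[OF f that, folded has_real_derivative_iff_has_vector_derivative])
    show "(\<lambda>\<theta>. of_real (f (t, \<theta>)) * mode (- k) \<theta>) integrable_on cbox 0 (2 * pi)" if "t \<in> {-T..T}" for t
      by (rule integrable_continuous) (intro continuous_intros continuous_on_subset[OF continuous_strip_slice[OF cf(1) that]]; simp)
    have "continuous_on ({-T..T} \<times> cbox 0 (2 * pi)) (\<lambda>p. complex_of_real (dt T f p) * mode (- k) (snd p))"
      by (intro continuous_intros continuous_on_subset[OF cf(2)]) (auto simp: strip_def)
    then show "continuous_on ({-T..T} \<times> cbox 0 (2 * pi)) (\<lambda>(t, \<theta>). complex_of_real (dt T f (t, \<theta>)) * mode (- k) \<theta>)"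
      by (simp add: case_prod_unfold)
  qed (use t in auto)
  from has_vector_derivative_divide[OF this, of "of_real (2 * pi)"] show ?thesis
    by (simp add: fc_def)
qed

text \<open>A coefficient \<open>c\<close> solves \<open>c'' = k^2 c\<close>, which factors into two
  first order equations; the involution gives \<open>c (- t) = sg k * c t\<close> and removes one of
  the two independent solutions.\<close>

theorem harmonic_coeffs:
  fixes f :: "real \<times> real \<Rightarrow> real"
  assumes T: "T > 0" and sym: "mobius_sym T f" and h: "harmonic_strip T f"
  obtains \<alpha> where "\<And>t. t \<in> {-T..T} \<Longrightarrow> fc (\<lambda>\<theta>. of_real (f (t, \<theta>))) k = \<alpha> * of_real (XC k t)"
    "\<And>t. t \<in> {-T..T} \<Longrightarrow> fc (\<lambda>\<theta>. of_real (dt T f (t, \<theta>))) k = \<alpha> * of_int k * of_real (XS k t)"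
proof -
  have C: "C1_strip T f" "C1_strip T (dt T f)" "C1_strip T (dth f)"
    using h by (auto simp: harmonic_strip_def C2_strip_def)
  define c0 where "c0 t = fc (\<lambda>\<theta>. of_real (f (t, \<theta>))) k" for t
  define c1 where "c1 t = fc (\<lambda>\<theta>. of_real (dt T f (t, \<theta>))) k" for t
  have c0: "(c0 has_vector_derivative c1 t) (at t within {-T..T})" if "t \<in> {-T..T}" for t
    unfolding c0_def[abs_def] c1_def by (rule fc_slice_deriv[OF C(1) that])
  have cp: "cper (\<lambda>\<theta>. complex_of_real (f (t, \<theta>)))" "cper (\<lambda>\<theta>. complex_of_real (dth f (t, \<theta>)))"
      "cper (\<lambda>\<theta>. complex_of_real (dth (dth f) (t, \<theta>)))" if t: "t \<in> {-T..T}" for t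
  proof -
    have p2: "dth (dth f) (t, \<theta> + 2 * pi) = dth (dth f) (t, \<theta>)" for \<theta>
    proof (rule dth_eqI[symmetric])
      have "((\<lambda>\<phi>. \<phi> + 2 * pi) has_vector_derivative 1) (at \<theta>)"
        by (auto intro!: derivative_eq_intros)
      from vector_diff_chain_at[OF this C1_dth[OF C(3) t, of "\<theta> + 2 * pi"]]
      show "((\<lambda>\<phi>. dth f (t, \<phi>)) has_vector_derivative dth (dth f) (t, \<theta> + 2 * pi)) (at \<theta>)"
        by (simp add: o_def dth_sym(2)[OF sym C(1) t])
    qed
    show "cper (\<lambda>\<theta>. complex_of_real (f (t, \<theta>)))" "cper (\<lambda>\<theta>. complex_of_real (dth f (t, \<theta>)))"
      "cper (\<lambda>\<theta>. complex_of_real (dth (dth f) (t, \<theta>)))"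
      using C t by (intro cper_slice[of T] mobius_shift(2)[OF sym] dth_sym(2)[OF sym] p2; simp add: C1_strip_def)+
  qed
  have c1: "(c1 has_vector_derivative (of_int k)\<^sup>2 * c0 t) (at t within {-T..T})" if t: "t \<in> {-T..T}" for t
  proof -
    have "fc (\<lambda>\<theta>. of_real (dt T (dt T f) (t, \<theta>))) k = fc (\<lambda>\<theta>. - 1 * of_real (dth (dth f) (t, \<theta>))) k"
    proof -
      have "dt T (dt T f) (t, \<theta>) = - dth (dth f) (t, \<theta>)" for \<theta>
        using h t unfolding harmonic_strip_def by (auto simp: add_eq_0_iff2 dest!: bspec[of _ _ "(t, \<theta>)"])
      then show ?thesis by simp
    qed
    also have "\<dots> = - fc (\<lambda>\<theta>. of_real (dth (dth f) (t, \<theta>))) k"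
      by (subst fc_cmult) simp
    also have "fc (\<lambda>\<theta>. of_real (dth (dth f) (t, \<theta>))) k = \<i> * of_int k * fc (\<lambda>\<theta>. of_real (dth f (t, \<theta>))) k"
      by (intro fc_deriv cp t has_vector_derivative_of_real
          C1_dth[OF C(3), folded has_real_derivative_iff_has_vector_derivative])
    also have "fc (\<lambda>\<theta>. of_real (dth f (t, \<theta>))) k = \<i> * of_int k * c0 t"
      unfolding c0_def by (intro fc_deriv cp t has_vector_derivative_of_real
          C1_dth[OF C(1), folded has_real_derivative_iff_has_vector_derivative])
    finally have "fc (\<lambda>\<theta>. of_real (dt T (dt T f) (t, \<theta>))) k = (of_int k)\<^sup>2 * c0 t"
      by (simp add: power2_eq_square algebra_simps)
    with fc_slice_deriv[OF C(2) t, of k] show ?thesis by (simp add: c1_def[abs_def])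
  qed
  have sym0: "c0 (- t) = of_real (sg k) * c0 t" if t: "t \<in> {-T..T}" for t
    unfolding c0_def mobius_shift(1)[OF sym t] using fc_shift_pi[OF cp(1)[OF t]] by simp
  \<comment> \<open>The cases \<open>j = k\<close> and \<open>j = - k\<close> are the two first
    integrals of the equation.\<close>
  have const: "\<exists>q. \<forall>t\<in>{-T..T}. (c1 t + of_int j * c0 t) * of_real (exp (- of_int j * t)) = q"
    if j: "j\<^sup>2 = k\<^sup>2" for j
  proof -
    have "(of_int j)\<^sup>2 = ((of_int k)\<^sup>2 :: complex)" using j by (metis of_int_power)
    then have "(c1 t + of_int j * c0 t) * of_real (- of_int j * exp (- of_int j * t))
        + ((of_int k)\<^sup>2 * c0 t + of_int j * c1 t) * of_real (exp (- of_int j * t)) = 0" for t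
      by (simp only: flip: \<open>(of_int j)\<^sup>2 = ((of_int k)\<^sup>2 :: complex)\<close>) (simp add: algebra_simps power2_eq_square)
    moreover have "((\<lambda>t. (c1 t + of_int j * c0 t) * of_real (exp (- of_int j * t))) has_vector_derivative
       (c1 t + of_int j * c0 t) * of_real (- of_int j * exp (- of_int j * t))
        + ((of_int k)\<^sup>2 * c0 t + of_int j * c1 t) * of_real (exp (- of_int j * t))) (at t within {-T..T})"
      if t: "t \<in> {-T..T}" for t
    proof (intro has_vector_derivative_mult has_vector_derivative_add has_vector_derivative_mult_right c0 c1 t
        has_vector_derivative_of_real)
      show "((\<lambda>t. exp (- of_int j * t)) has_real_derivative - of_int j * exp (- of_int j * t)) (at t within {-T..T})"
        by (auto intro!: derivative_eq_intros)
    qed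
    ultimately have "((\<lambda>t. (c1 t + of_int j * c0 t) * of_real (exp (- of_int j * t))) has_vector_derivative 0) (at t within {-T..T})"
      if t: "t \<in> {-T..T}" for t
      using t by simp
    then show ?thesis by (rule const_of_zero_derivative)
  qed
  obtain p where p: "\<And>t. t \<in> {-T..T} \<Longrightarrow> (c1 t + of_int k * c0 t) * of_real (exp (- of_int k * t)) = p"
    using const[of k] by auto
  obtain m where m: "\<And>t. t \<in> {-T..T} \<Longrightarrow> (c1 t - of_int k * c0 t) * of_real (exp (of_int k * t)) = m"
    using const[of "- k"] by auto
  have e: "of_real (exp (- of_int k * t)) * of_real (exp (of_int k * t)) = (1 :: complex)" for t
    by (simp add: of_real_mult[symmetric] exp_add[symmetric] del: of_real_mult)
  have P: "c1 t + of_int k * c0 t = p * of_real (exp (of_int k * t))" if "t \<in> {-T..T}" for t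
    using p[OF that] e[of t] by (metis mult.assoc mult.right_neutral)
  have M: "c1 t - of_int k * c0 t = m * of_real (exp (- of_int k * t))" if "t \<in> {-T..T}" for t
    using m[OF that] e[of t] by (metis mult.assoc mult.commute mult.right_neutral)
  have TT: "T \<in> {-T..T}" using T by auto
  have TT': "- T \<in> {-T..T}" using T by auto
  show ?thesis
  proof (cases "k = 0")
    case True
    then have c1p: "c1 t = p" if "t \<in> {-T..T}" for t using P[OF that] by simp
    have "((\<lambda>t. c0 t - t *\<^sub>R p) has_vector_derivative 0) (at t within {-T..T})" if t: "t \<in> {-T..T}" for t
    proof -
      have "((\<lambda>t. c0 t - t *\<^sub>R p) has_vector_derivative c1 t - 1 *\<^sub>R p) (at t within {-T..T})"
        by (intro has_vector_derivative_diff c0 t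
            bounded_linear.has_vector_derivative[OF bounded_linear_scaleR_left] has_vector_derivative_id)
      then show ?thesis using c1p[OF t] by simp
    qed
    from const_of_zero_derivative[OF this]
    obtain q where q: "\<And>t. t \<in> {-T..T} \<Longrightarrow> c0 t - t *\<^sub>R p = q" by blast
    \<comment> \<open>For \<open>k = 0\<close> the second solution is linear in \<open>t\<close>,
      and evenness excludes it.\<close>
    have "c0 (- T) = c0 T" using sym0[OF TT] True by (simp add: sg_def)
    then have "c0 T - T *\<^sub>R p = c0 T + T *\<^sub>R p" using q[OF TT] q[OF TT'] by simp
    then have "p = 0" using T by (simp add: complex_eq_iff)
    show ?thesis
    proof (rule that[of "q / 2"])
      fix t assume t: "t \<in> {-T..T}"
      show "fc (\<lambda>\<theta>. of_real (f (t, \<theta>))) k = q / 2 * of_real (XC k t)"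
        using q[OF t] \<open>p = 0\<close> True by (simp add: c0_def XC_def sg_def)
      show "fc (\<lambda>\<theta>. of_real (dt T f (t, \<theta>))) k = q / 2 * of_int k * of_real (XS k t)"
        using c1p[OF t] \<open>p = 0\<close> True by (simp add: c1_def)
    qed
  next
    case False
    have c0e: "2 * of_int k * c0 t = p * of_real (exp (of_int k * t)) - m * of_real (exp (- of_int k * t))"
      if "t \<in> {-T..T}" for t using P[OF that] M[OF that] by (simp add: algebra_simps) 
    have c1e: "2 * c1 t = p * of_real (exp (of_int k * t)) + m * of_real (exp (- of_int k * t))"
      if "t \<in> {-T..T}" for t using P[OF that, symmetric] M[OF that, symmetric] by (simp add: algebra_simps)
    define E where "E = complex_of_real (exp (of_int k * T))"
    define E' where "E' = complex_of_real (exp (- of_int k * T))"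
    define s where "s = complex_of_real (sg k)"
    have ss: "s * s = 1" by (simp add: s_def of_real_mult[symmetric] del: of_real_mult)
    have "p * E' - m * E = 2 * of_int k * c0 (- T)"
      using c0e[OF TT'] by (simp add: E_def E'_def)
    also have "\<dots> = s * (2 * of_int k * c0 T)"
      using sym0[OF TT] by (simp add: s_def)
    also have "\<dots> = s * (p * E - m * E')"
      using c0e[OF TT] by (simp add: E_def E'_def)
    finally have "p * E' - m * E = s * (p * E - m * E')" .
    moreover have "(p + s * m) * (E - s * E') = p * E - (s * s) * m * E' - s * (p * E' - m * E)"
      by (simp add: algebra_simps)
    ultimately have "(p + s * m) * (E - s * E') = p * E - (s * s) * m * E' - (s * s) * (p * E - m * E')"
      by (simp add: mult.assoc)
    then have "(p + s * m) * (E - s * E') = 0" using ss by simp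
    moreover have "E - s * E' = of_real (XS k T)" by (simp add: E_def E'_def s_def XS_def)
    ultimately have ms: "p = - s * m" using XS_nz[OF T False] by (simp add: add_eq_0_iff2)
    then have mp: "m = - s * p" using ss by (simp add: mult.assoc[symmetric])
    show ?thesis
    proof (rule that[of "p / (2 * of_int k)"])
      fix t assume t: "t \<in> {-T..T}"
      show "fc (\<lambda>\<theta>. of_real (f (t, \<theta>))) k = p / (2 * of_int k) * of_real (XC k t)"
        using c0e[OF t] False unfolding mp by (simp add: c0_def[symmetric] XC_def s_def field_simps)
      show "fc (\<lambda>\<theta>. of_real (dt T f (t, \<theta>))) k = p / (2 * of_int k) * of_int k * of_real (XS k t)"
        using c1e[OF t] False unfolding mp by (simp add: c1_def[symmetric] XS_def s_def field_simps)
    qed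
  qed
qed

corollary harmonic_dtn:
  fixes f :: "real \<times> real \<Rightarrow> real"
  assumes T: "T > 0" and "mobius_sym T f" "harmonic_strip T f"
  shows "fc (\<lambda>\<theta>. of_real (dt T f (T, \<theta>))) k = of_real (mu T k) * fc (\<lambda>\<theta>. of_real (f (T, \<theta>))) k"
proof -
  obtain \<alpha> where \<alpha>: "\<And>t. t \<in> {-T..T} \<Longrightarrow> fc (\<lambda>\<theta>. of_real (f (t, \<theta>))) k = \<alpha> * of_real (XC k t)"
    "\<And>t. t \<in> {-T..T} \<Longrightarrow> fc (\<lambda>\<theta>. of_real (dt T f (t, \<theta>))) k = \<alpha> * of_int k * of_real (XS k t)"
    using harmonic_coeffs[OF assms] by metis
  then show ?thesis using T XC_nz[OF T, of k] by (simp add: mu_def)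
qed

section \<open>Steklov eigenfunctions from Fourier series\<close>

lemma C1_stripI:
  assumes T: "T > 0" and f: "continuous_on (strip T) f"
    and d1: "\<And>t \<theta>. t \<in> {-T..T} \<Longrightarrow> ((\<lambda>s. f (s, \<theta>)) has_vector_derivative g (t, \<theta>)) (at t within {-T..T})"
    and d2: "\<And>t \<theta>. t \<in> {-T..T} \<Longrightarrow> ((\<lambda>\<phi>. f (t, \<phi>)) has_vector_derivative h (t, \<theta>)) (at \<theta>)"
    and g: "continuous_on (strip T) g" and h: "continuous_on (strip T) h"
  shows "C1_strip T f" "\<And>p. p \<in> strip T \<Longrightarrow> dt T f p = g p" "\<And>p. p \<in> strip T \<Longrightarrow> dth f p = h p"
proof -
  show 1: "dt T f p = g p" if "p \<in> strip T" for p
    using dt_eqI[OF T _ d1] that by (cases p) auto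
  show 2: "dth f p = h p" if "p \<in> strip T" for p
    using dth_eqI[OF d2] that by (cases p) auto
  have "continuous_on (strip T) (dt T f)" "continuous_on (strip T) (dth f)"
    using g h 1 2 by (auto cong: continuous_on_cong)
  then show "C1_strip T f"
    unfolding C1_strip_def
    by (intro conjI allI impI differentiableI_vector[OF d1] differentiableI_vector[OF d2] f)
qed

text \<open>First derivatives are computed only on the strip, so a second differentiation must be
  insensitive to values elsewhere before explicit formulas can be substituted.\<close>

lemma C1_strip_cong:
  assumes T: "T > 0" and eq: "\<And>p. p \<in> strip T \<Longrightarrow> f p = g p" and f: "C1_strip T f"
  shows "C1_strip T g" "\<And>p. p \<in> strip T \<Longrightarrow> dt T g p = dt T f p" "\<And>p. p \<in> strip T \<Longrightarrow> dth g p = dth f p"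
proof -
  have c: "continuous_on (strip T) g" "continuous_on (strip T) (dt T f)" "continuous_on (strip T) (dth f)"
    using f eq by (auto simp: C1_strip_def cong: continuous_on_cong)
  have d1: "((\<lambda>s. g (s, \<theta>)) has_vector_derivative dt T f (t, \<theta>)) (at t within {-T..T})" if "t \<in> {-T..T}" for t \<theta>
    by (rule has_vector_derivative_transform[OF that _ C1_dt[OF f that]]) (simp add: eq)
  have d2: "((\<lambda>\<phi>. g (t, \<phi>)) has_vector_derivative dth f (t, \<theta>)) (at \<theta>)" if "t \<in> {-T..T}" for t \<theta>
    using C1_dth[OF f that] eq that by simp
  show "C1_strip T g" "\<And>p. p \<in> strip T \<Longrightarrow> dt T g p = dt T f p" "\<And>p. p \<in> strip T \<Longrightarrow> dth g p = dth f p"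
    using C1_stripI[OF T c(1) d1 d2 c(2,3)] by auto
qed

lemma C1_strip_linear:
  assumes T: "T > 0" and h: "bounded_linear h" and f: "C1_strip T f"
  shows "C1_strip T (\<lambda>p. h (f p))" "\<And>p. p \<in> strip T \<Longrightarrow> dt T (\<lambda>p. h (f p)) p = h (dt T f p)"
    "\<And>p. p \<in> strip T \<Longrightarrow> dth (\<lambda>p. h (f p)) p = h (dth f p)"
proof -
  have c: "continuous_on (strip T) (\<lambda>p. h (f p))" "continuous_on (strip T) (\<lambda>p. h (dt T f p))"
      "continuous_on (strip T) (\<lambda>p. h (dth f p))"
    using f by (auto simp: C1_strip_def intro: bounded_linear.continuous_on[OF h])
  show "C1_strip T (\<lambda>p. h (f p))" "\<And>p. p \<in> strip T \<Longrightarrow> dt T (\<lambda>p. h (f p)) p = h (dt T f p)"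
    "\<And>p. p \<in> strip T \<Longrightarrow> dth (\<lambda>p. h (f p)) p = h (dth f p)"
    using C1_stripI[OF T c(1) bounded_linear.has_vector_derivative[OF h C1_dt[OF f]]
        bounded_linear.has_vector_derivative[OF h C1_dth[OF f]] c(2,3)] by auto
qed

lemma harmonic_strip_linear:
  assumes T: "T > 0" and h: "bounded_linear h" and f: "harmonic_strip T f"
  shows "harmonic_strip T (\<lambda>p. h (f p))"
proof -
  interpret h: bounded_linear h by fact
  have C: "C1_strip T f" "C1_strip T (dt T f)" "C1_strip T (dth f)"
    using f by (auto simp: harmonic_strip_def C2_strip_def)
  note L = C1_strip_linear[OF T h C(1)]
  note Lt = C1_strip_linear[OF T h C(2)] and Lth = C1_strip_linear[OF T h C(3)]
  have t: "C1_strip T (dt T (\<lambda>p. h (f p)))" "\<And>p. p \<in> strip T \<Longrightarrow> dt T (dt T (\<lambda>p. h (f p))) p = h (dt T (dt T f) p)"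
    using C1_strip_cong[OF T _ Lt(1), of "dt T (\<lambda>p. h (f p))"] L(2) Lt(2) by auto
  have th: "C1_strip T (dth (\<lambda>p. h (f p)))" "\<And>p. p \<in> strip T \<Longrightarrow> dth (dth (\<lambda>p. h (f p))) p = h (dth (dth f) p)"
    using C1_strip_cong[OF T _ Lth(1), of "dth (\<lambda>p. h (f p))"] L(3) Lth(3) by auto
  show ?thesis
    unfolding harmonic_strip_def C2_strip_def
    using L(1) t th f by (auto simp: harmonic_strip_def h.add[symmetric])
qed

lemma mobius_sym_comp: "mobius_sym T f \<Longrightarrow> mobius_sym T (\<lambda>p. h (f p))"
  unfolding mobius_sym_def by metis

text \<open>For \<open>W = XC\<close> this is the harmonic extension of the boundary function with
  coefficients \<open>c\<close>. The profile is a parameter because \<open>dt\<close> exchanges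
  \<open>XC\<close> and \<open>XS\<close>.\<close>

definition SF :: "real \<Rightarrow> (int \<Rightarrow> real \<Rightarrow> real) \<Rightarrow> (int \<Rightarrow> complex) \<Rightarrow> real \<times> real \<Rightarrow> complex" where
  "SF T W c p = (\<Sum>\<^sub>\<infinity>k. c k * of_real (W k (fst p) / XC k T) * mode k (snd p))"

context
  fixes T :: real and W W' :: "int \<Rightarrow> real \<Rightarrow> real"
  assumes T: "T > 0"
    and bd: "\<And>k t. t \<in> {-T..T} \<Longrightarrow> \<bar>W k t / XC k T\<bar> \<le> 1 / cT T"
            "\<And>k t. t \<in> {-T..T} \<Longrightarrow> \<bar>W' k t / XC k T\<bar> \<le> 1 / cT T"
    and dW: "\<And>k t. (W k has_vector_derivative of_int k * W' k t) (at t within {-T..T})"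
begin

lemma SF_bound:
  "t \<in> {-T..T} \<Longrightarrow> norm (c k * of_real (W k t / XC k T) * mode k \<theta>) \<le> norm (c k) * (1 / cT T)"
  using mult_left_mono[OF bd(1)[of t k], of "norm (c k)"] by (simp add: norm_mult norm_divide)

lemma SF_summable:
  "asum c \<Longrightarrow> t \<in> {-T..T} \<Longrightarrow> (\<lambda>k. c k * of_real (W k t / XC k T) * mode k \<theta>) summable_on UNIV"
  by (rule abs_summable_summable, rule summable_on_comparison_test[OF summable_on_cmult_left[where c = "1 / cT T"]])
     (assumption, rule SF_bound, simp_all)

lemma SF_continuous:
  assumes "asum c"
  shows "continuous_on (strip T) (SF T W c)"
proof -
  have "continuous_on (strip T) (\<lambda>p. c k * of_real (W k (fst p) / XC k T) * mode k (snd p))" for k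
  proof -
    have "continuous_on {-T..T} (W k)"
      using dW by (intro continuous_on_vector_derivative) blast
    then have "continuous_on (strip T) (\<lambda>p. W k (fst p))"
      by (rule continuous_on_compose2) (auto simp: strip_def intro!: continuous_intros)
    then show ?thesis
      by (intro continuous_intros) (auto simp: XC_nz[OF T])
  qed
  then show ?thesis
    unfolding SF_def[abs_def]
    by (rule continuous_infsum[where B = "\<lambda>k. norm (c k) * (1 / cT T)"])
       (auto simp: strip_def intro!: SF_bound[simplified] summable_on_cmult_left assms, simp add: assms summable_on_cmult_left divide_inverse)
qed

lemma SF_dt:
  assumes c: "wsum 1 c" and t: "t \<in> {-T..T}"
  shows "((\<lambda>s. SF T W c (s, \<theta>)) has_vector_derivative SF T W' (\<lambda>k. of_int k * c k) (t, \<theta>)) (at t within {-T..T})"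
  unfolding SF_def fst_conv snd_conv
proof (rule infsum_has_vector_derivative)
  show "((\<lambda>s. c k * of_real (W k s / XC k T) * mode k \<theta>) has_vector_derivative
      of_int k * c k * of_real (W' k s / XC k T) * mode k \<theta>) (at s within {-T..T})" for k s
  proof -
    have "((\<lambda>s. c k * of_real (W k s / XC k T) * mode k \<theta>) has_vector_derivative
      c k * of_real ((of_int k * W' k s) / XC k T) * mode k \<theta>) (at s within {-T..T})"
      by (intro has_vector_derivative_mult_left has_vector_derivative_mult_right has_vector_derivative_of_real
          DERIV_cdivide dW[folded has_real_derivative_iff_has_vector_derivative])
    then show ?thesis by (simp add: mult_ac)
  qed
  show "norm (of_int k * c k * of_real (W' k s / XC k T) * mode k \<theta>) \<le> norm (\<i> * of_int k * c k) * (1 / cT T)"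
    if "s \<in> {-T..T}" for k s
    using mult_left_mono[OF bd(2)[OF that, of k], of "\<bar>of_int k\<bar> * norm (c k)"]
    by (simp add: norm_mult del: of_real_divide)
  show "(\<lambda>k. norm (\<i> * of_int k * c k) * (1 / cT T)) summable_on UNIV"
    using wsum_abs[OF wsum_deriv[of 0 c]] c by (intro summable_on_cmult_left) simp
qed (auto intro: SF_summable[simplified] wsum_abs[OF c] t simp: t[simplified])

lemma SF_dth:
  assumes c: "wsum 1 c" and t: "t \<in> {-T..T}"
  shows "((\<lambda>\<phi>. SF T W c (t, \<phi>)) has_vector_derivative SF T W (\<lambda>k. \<i> * of_int k * c k) (t, \<theta>)) (at \<theta>)"
  unfolding SF_def fst_conv snd_conv
proof (rule infsum_has_vector_derivative[where S = UNIV, simplified])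
  show "((\<lambda>\<phi>. c k * of_real (W k t / XC k T) * mode k \<phi>) has_vector_derivative
      \<i> * of_int k * c k * of_real (W k t / XC k T) * mode k \<phi>) (at \<phi>)" for k \<phi>
  proof -
    have "((\<lambda>\<phi>. c k * of_real (W k t / XC k T) * mode k \<phi>) has_vector_derivative
      c k * of_real (W k t / XC k T) * (\<i> * of_int k * mode k \<phi>)) (at \<phi>)"
      by (intro has_vector_derivative_mult_right mode_has_vector_derivative)
    then show ?thesis by (simp add: mult_ac)
  qed
  show "norm (\<i> * of_int k * c k * of_real (W k t / XC k T) * mode k \<phi>) \<le> norm (\<i> * of_int k * c k) * (1 / cT T)" for k \<phi>
    using mult_left_mono[OF bd(1)[OF t, of k], of "\<bar>of_int k\<bar> * norm (c k)"]
    by (simp add: norm_mult del: of_real_divide)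
  show "(\<lambda>k. norm (\<i> * of_int k * c k) * (1 / cT T)) summable_on UNIV"
    using wsum_abs[OF wsum_deriv[of 0 c]] c by (intro summable_on_cmult_left) simp
  show "(\<lambda>k. c k * of_real (W k t / XC k T) * mode k \<phi>) summable_on UNIV" for \<phi>
    by (rule SF_summable[OF wsum_abs[OF c] t])
qed

end

lemma SF_C1:
  fixes W W' :: "int \<Rightarrow> real \<Rightarrow> real"
  assumes T: "T > 0"
    and bd: "\<And>k t. t \<in> {-T..T} \<Longrightarrow> \<bar>W k t / XC k T\<bar> \<le> 1 / cT T"
            "\<And>k t. t \<in> {-T..T} \<Longrightarrow> \<bar>W' k t / XC k T\<bar> \<le> 1 / cT T"
    and dW: "\<And>k t. (W k has_vector_derivative of_int k * W' k t) (at t within {-T..T})"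
    and dW': "\<And>k t. (W' k has_vector_derivative of_int k * W k t) (at t within {-T..T})"
    and c: "wsum 1 c"
  shows "C1_strip T (SF T W c)"
    "\<And>p. p \<in> strip T \<Longrightarrow> dt T (SF T W c) p = SF T W' (\<lambda>k. of_int k * c k) p"
    "\<And>p. p \<in> strip T \<Longrightarrow> dth (SF T W c) p = SF T W (\<lambda>k. \<i> * of_int k * c k) p"
proof -
  have s1: "asum (\<lambda>k. \<i> * of_int k * c k)" using wsum_abs[OF wsum_deriv[of 0 c]] c by simp
  then have s2: "asum (\<lambda>k. of_int k * c k)" by (simp add: norm_mult)
  note * = C1_stripI[OF T SF_continuous[OF T bd dW wsum_abs[OF c]] SF_dt[OF T bd dW c] SF_dth[OF T bd dW c]
      SF_continuous[OF T bd(2,1) dW' s2] SF_continuous[OF T bd dW s1]]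
  show "C1_strip T (SF T W c)"
    "\<And>p. p \<in> strip T \<Longrightarrow> dt T (SF T W c) p = SF T W' (\<lambda>k. of_int k * c k) p"
    "\<And>p. p \<in> strip T \<Longrightarrow> dth (SF T W c) p = SF T W (\<lambda>k. \<i> * of_int k * c k) p"
    using * by auto
qed

lemma SF_XC:
  assumes T: "T > 0" and c: "wsum 1 c"
  shows "C1_strip T (SF T XC c)"
    "\<And>p. p \<in> strip T \<Longrightarrow> dt T (SF T XC c) p = SF T XS (\<lambda>k. of_int k * c k) p"
    "\<And>p. p \<in> strip T \<Longrightarrow> dth (SF T XC c) p = SF T XC (\<lambda>k. \<i> * of_int k * c k) p"
proof -
  have b: "\<bar>XC k t / XC k T\<bar> \<le> 1 / cT T" "\<bar>XS k t / XC k T\<bar> \<le> 1 / cT T" if "t \<in> {-T..T}" for k t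
    using X_ratio_bound[OF T, of t k] that by auto
  note r = T c b XC_has_derivative XS_has_derivative
  show "C1_strip T (SF T XC c)"
    by (rule SF_C1(1)[of T XC XS c]) (rule r | assumption)+
  show "dt T (SF T XC c) p = SF T XS (\<lambda>k. of_int k * c k) p" if "p \<in> strip T" for p
    by (rule SF_C1(2)[of T XC XS c]) (rule r that | assumption)+
  show "dth (SF T XC c) p = SF T XC (\<lambda>k. \<i> * of_int k * c k) p" if "p \<in> strip T" for p
    by (rule SF_C1(3)[of T XC XS c]) (rule r that | assumption)+
qed

lemma SF_XS:
  assumes T: "T > 0" and c: "wsum 1 c"
  shows "C1_strip T (SF T XS c)"
    "\<And>p. p \<in> strip T \<Longrightarrow> dt T (SF T XS c) p = SF T XC (\<lambda>k. of_int k * c k) p"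
    "\<And>p. p \<in> strip T \<Longrightarrow> dth (SF T XS c) p = SF T XS (\<lambda>k. \<i> * of_int k * c k) p"
proof -
  have b: "\<bar>XC k t / XC k T\<bar> \<le> 1 / cT T" "\<bar>XS k t / XC k T\<bar> \<le> 1 / cT T" if "t \<in> {-T..T}" for k t
    using X_ratio_bound[OF T, of t k] that by auto
  note r = T c b XC_has_derivative XS_has_derivative
  show "C1_strip T (SF T XS c)"
    by (rule SF_C1(1)[of T XS XC c]) (rule r | assumption)+
  show "dt T (SF T XS c) p = SF T XC (\<lambda>k. of_int k * c k) p" if "p \<in> strip T" for p
    by (rule SF_C1(2)[of T XS XC c]) (rule r that | assumption)+
  show "dth (SF T XS c) p = SF T XS (\<lambda>k. \<i> * of_int k * c k) p" if "p \<in> strip T" for p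
    by (rule SF_C1(3)[of T XS XC c]) (rule r that | assumption)+
qed

lemma wsum_2_mult:
  assumes "wsum 2 c"
  shows "wsum 1 (\<lambda>k. of_int k * c k)" "wsum 1 (\<lambda>k. \<i> * of_int k * c k)"
proof -
  show 1: "wsum 1 (\<lambda>k. \<i> * of_int k * c k)" using wsum_deriv[of 1 c] assms by (simp add: numeral_2_eq_2)
  show "wsum 1 (\<lambda>k. of_int k * c k)" using 1 by (simp add: wsum_def norm_mult)
qed

text \<open>Relative to \<open>XC k T\<close> the profiles are bounded uniformly in \<open>k\<close>
  on the closed strip, so each derivative costs one power of \<open>k\<close> and
  \<open>wsum 2 c\<close> gives C2 up to the boundary.\<close>

theorem SF_harmonic:
  assumes T: "T > 0" and c: "wsum 2 c"
  shows "harmonic_strip T (SF T XC c)" "mobius_sym T (SF T XC c)"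
    "C1_strip T (SF T XC c)"
    "\<And>p. p \<in> strip T \<Longrightarrow> dt T (SF T XC c) p = SF T XS (\<lambda>k. of_int k * c k) p"
proof -
  note C = SF_XC[OF T] and S = SF_XS[OF T]
  have c1: "wsum 1 c" using wsum_mono[OF c] by simp
  note m = wsum_2_mult[OF c]
  show C1: "C1_strip T (SF T XC c)" by (rule C(1)[OF c1])
  show dt1: "\<And>p. p \<in> strip T \<Longrightarrow> dt T (SF T XC c) p = SF T XS (\<lambda>k. of_int k * c k) p" by (rule C(2)[OF c1])
  have ct: "C1_strip T (dt T (SF T XC c))"
      "\<And>p. p \<in> strip T \<Longrightarrow> dt T (dt T (SF T XC c)) p = dt T (SF T XS (\<lambda>k. of_int k * c k)) p"
    using C1_strip_cong[OF T _ S(1)[OF m(1)], of "dt T (SF T XC c)"] dt1 by auto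
  have cth: "C1_strip T (dth (SF T XC c))"
      "\<And>p. p \<in> strip T \<Longrightarrow> dth (dth (SF T XC c)) p = dth (SF T XC (\<lambda>k. \<i> * of_int k * c k)) p"
    using C1_strip_cong[OF T _ C(1)[OF m(2)], of "dth (SF T XC c)"] C(3)[OF c1] by auto
  have "dt T (dt T (SF T XC c)) p + dth (dth (SF T XC c)) p = 0" if p: "p \<in> strip T" for p
  proof -
    have "dt T (dt T (SF T XC c)) p = SF T XC (\<lambda>k. of_int k * (of_int k * c k)) p"
      using ct(2)[OF p] S(2)[OF m(1) p] by simp
    moreover have "dth (dth (SF T XC c)) p = SF T XC (\<lambda>k. \<i> * of_int k * (\<i> * of_int k * c k)) p"
      using cth(2)[OF p] C(3)[OF m(2) p] by simp
    moreover have "SF T XC (\<lambda>k. \<i> * of_int k * (\<i> * of_int k * c k)) p = - SF T XC (\<lambda>k. of_int k * (of_int k * c k)) p"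
      unfolding SF_def infsum_uminus[symmetric] by (intro infsum_cong) (simp add: algebra_simps)
    ultimately show ?thesis by simp
  qed
  then show "harmonic_strip T (SF T XC c)"
    unfolding harmonic_strip_def C2_strip_def using C1 ct(1) cth(1) by blast
  show "mobius_sym T (SF T XC c)"
    unfolding mobius_sym_def SF_def
  proof (intro allI impI conjI)
    fix t \<theta> :: real
    have eq: "c k * of_real (XC k (- t) / XC k T) * mode k (\<theta> + pi) = c k * of_real (XC k t / XC k T) * mode k \<theta>" for k
      by (simp add: XC_neg_arg mode_arg_add mode_pi sg_def)
    show "(\<Sum>\<^sub>\<infinity>k. c k * of_real (XC k (fst (- t, \<theta> + pi)) / XC k T) * mode k (snd (- t, \<theta> + pi)))
        = (\<Sum>\<^sub>\<infinity>k. c k * of_real (XC k (fst (t, \<theta>)) / XC k T) * mode k (snd (t, \<theta>)))"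
      by (simp only: fst_conv snd_conv eq)
  qed simp
qed

text \<open>The extension is complex valued; its real or its imaginary part is nonzero somewhere on
  the boundary and serves as eigenfunction. The condition at \<open>t = - T\<close> follows from the
  one at \<open>t = T\<close> by the involution.\<close>

theorem steklov_from_series:
  fixes u :: "real \<times> real \<Rightarrow> 'a::euclidean_space"
  assumes T: "T > 0" and c: "wsum 2 c" and c0: "c k0 \<noteq> 0"
    and eig: "\<And>\<theta>. fser (\<lambda>k. of_real (mu T k) * c k) \<theta> = of_real (\<sigma> * norm (dt T u (T, \<theta>))) * fser c \<theta>"
    and u: "\<And>\<theta>. norm (dt T u (- T, \<theta>)) = norm (dt T u (T, \<theta> + pi))"
  shows "steklov_eigenvalue T u \<sigma>"
proof -
  define F where "F = SF T XC c"
  note H = SF_harmonic[OF T c, folded F_def]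
  have TT: "T \<in> {-T..T}" using T by auto
  have FT: "F (T, \<theta>) = fser c \<theta>" for \<theta>
    using XC_nz[OF T] by (simp add: F_def SF_def fser_def)
  have dFT: "dt T F (T, \<theta>) = of_real (\<sigma> * norm (dt T u (T, \<theta>))) * F (T, \<theta>)" for \<theta>
  proof -
    have "dt T F (T, \<theta>) = fser (\<lambda>k. of_real (mu T k) * c k) \<theta>"
      unfolding H(4)[of "(T, \<theta>)", simplified, OF less_imp_le[OF T], simplified] using T
      by (simp add: SF_def fser_def mu_def mult_ac H(4))
    then show ?thesis by (simp only: eig FT)
  qed
  have dFmT: "- dt T F (- T, \<theta>) = of_real (\<sigma> * norm (dt T u (- T, \<theta>))) * F (- T, \<theta>)" for \<theta>
    using dFT[of "\<theta> + pi"] dt_sym(1)[OF T H(2,3) TT] mobius_shift(1)[OF H(2) TT] u by simp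
  have main: "steklov_eigenvalue T u \<sigma>" if h: "bounded_linear h" "\<And>r z. h (of_real r * z) = r * h z" "h (F (T, \<theta>0)) \<noteq> 0" for h \<theta>0
  proof -
    interpret h: bounded_linear h by fact
    have TT': "- T \<in> {-T..T}" using T by auto
    have "steklov_eigenfunction T u \<sigma> (\<lambda>p. h (F p))"
      unfolding steklov_eigenfunction_def
    proof (intro conjI allI)
      show "mobius_sym T (\<lambda>p. h (F p))" by (rule mobius_sym_comp[OF H(2)])
      show "harmonic_strip T (\<lambda>p. h (F p))" by (rule harmonic_strip_linear[OF T h(1) H(1)])
      show "\<exists>p\<in>strip T. h (F p) \<noteq> 0" using h(3) TT by (intro bexI[of _ "(T, \<theta>0)"]) auto
      note L = C1_strip_linear(2)[OF T h(1) H(3)]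
      fix \<theta>
      show "dt T (\<lambda>p. h (F p)) (T, \<theta>) = \<sigma> * norm (dt T u (T, \<theta>)) * h (F (T, \<theta>))"
        using L[of "(T, \<theta>)"] TT unfolding dFT h(2) by simp
      have "- h (dt T F (- T, \<theta>)) = h (- dt T F (- T, \<theta>))" by (simp add: linear_neg[OF h.linear])
      then show "- dt T (\<lambda>p. h (F p)) (- T, \<theta>) = \<sigma> * norm (dt T u (- T, \<theta>)) * h (F (- T, \<theta>))"
        using L[of "(- T, \<theta>)"] TT' unfolding dFmT h(2) by simp
    qed
    then show ?thesis unfolding steklov_eigenvalue_def by blast
  qed
  have "\<exists>\<theta>. F (T, \<theta>) \<noteq> 0"
  proof (rule ccontr)
    assume "\<not> (\<exists>\<theta>. F (T, \<theta>) \<noteq> 0)"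
    then have "fser c = (\<lambda>\<theta>. 0)" using FT by auto
    then have "fc (fser c) k0 = 0" by (simp add: fc_def)
    then show False using c0 fc_fser[OF wsum_abs[OF c]] by simp
  qed
  then obtain \<theta>0 where "F (T, \<theta>0) \<noteq> 0" by blast
  then have "Re (F (T, \<theta>0)) \<noteq> 0 \<or> Im (F (T, \<theta>0)) \<noteq> 0" by (simp add: complex_eq_iff)
  then show ?thesis
    using main[OF bounded_linear_Re, of \<theta>0] main[OF bounded_linear_Im, of \<theta>0] by auto
qed

section \<open>The Rayleigh quotient and the spectral gap\<close>

definition Lam :: "real \<Rightarrow> (real \<Rightarrow> complex) \<Rightarrow> real \<Rightarrow> complex" where
  "Lam T f = fser (\<lambda>k. of_real (mu T k) * fc f k)"

lemma wsum_mu: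
  assumes T: "T > 0" and c: "wsum (Suc s) c"
  shows "wsum s (\<lambda>k. of_real (mu T k) * c k)"
proof (rule wsum_bound[OF c, where C = "1 / cT T"])
  fix k
  have "mu T k \<le> (1 + \<bar>real_of_int k\<bar>) / cT T"
    using mu_upper[OF T, of k] cT_pos[OF T] by (simp add: field_simps)
  then have "wt s k * (mu T k * norm (c k)) \<le> wt s k * ((1 + \<bar>real_of_int k\<bar>) / cT T * norm (c k))"
    by (intro mult_left_mono mult_right_mono) auto
  then show "wt s k * norm (of_real (mu T k) * c k) \<le> 1 / cT T * (wt (Suc s) k * norm (c k))"
    using mu_nonneg[OF T, of k] by (simp add: norm_mult wt_Suc mult_ac)
qed

lemma mu_lower':
  assumes T: "T > 0" and k: "k \<noteq> 0"
  shows "cT T / 2 * (1 + \<bar>real_of_int k\<bar>) \<le> mu T k"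
proof -
  have "\<bar>real_of_int k\<bar> \<ge> 1" using k by linarith
  then have "cT T / 2 * (1 + \<bar>real_of_int k\<bar>) \<le> cT T * \<bar>real_of_int k\<bar>"
    using cT_pos[OF T] by (simp add: field_simps)
  then show ?thesis using mu_lower[OF T, of k] by simp
qed

text \<open>Inverting the multiplier gains one order. Mode 0, where \<open>mu\<close> vanishes, is
  added back as a single term.\<close>

lemma wsum_of_mu:
  assumes T: "T > 0" and c: "wsum s (\<lambda>k. of_real (mu T k) * c k)"
  shows "wsum (Suc s) c"
proof -
  define d where "d = (\<lambda>k::int. if k = 0 then c 0 else 0)"
  have "(\<lambda>k. wt s k * norm (d k)) summable_on UNIV"
    by (rule finite_nonzero_values_imp_summable_on, rule finite_subset[of _ "{0}"]) (auto simp: d_def)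
  then have d: "wsum s d" by (simp add: wsum_def)
  have "(\<lambda>k. wt s k * norm (of_real (mu T k) * c k) * (2 / cT T) + wt s k * norm (d k)) summable_on UNIV"
    using c d unfolding wsum_def by (intro summable_on_add summable_on_cmult_left)
  then show ?thesis
    unfolding wsum_def
  proof (rule summable_on_comparison_test)
    fix k
    show "wt (Suc s) k * norm (c k) \<le> wt s k * norm (of_real (mu T k) * c k) * (2 / cT T) + wt s k * norm (d k)"
    proof (cases "k = 0")
      case True
      then show ?thesis by (simp add: d_def wt_def)
    next
      case False
      have "1 + \<bar>real_of_int k\<bar> \<le> mu T k * (2 / cT T)"
        using mu_lower'[OF T False] cT_pos[OF T] by (simp add: field_simps)
      then have "wt s k * ((1 + \<bar>real_of_int k\<bar>) * norm (c k)) \<le> wt s k * (mu T k * (2 / cT T) * norm (c k))"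
        by (intro mult_left_mono mult_right_mono) auto
      then show ?thesis
        using False mu_nonneg[OF T, of k] by (simp add: d_def norm_mult wt_Suc mult_ac)
    qed
  qed auto
qed

lemma wiener_Lam: "T > 0 \<Longrightarrow> wiener (Suc s) f \<Longrightarrow> wiener s (Lam T f)"
  unfolding Lam_def by (rule wiener_fser, rule wsum_mu) (auto simp: wiener_def)

lemma fc_Lam: "T > 0 \<Longrightarrow> wiener (Suc s) f \<Longrightarrow> fc (Lam T f) k = of_real (mu T k) * fc f k"
  unfolding Lam_def by (rule fc_fser, rule wsum_abs, rule wsum_mu[of T s]) (auto simp: wiener_def)

abbreviation cr :: "(real \<Rightarrow> real) \<Rightarrow> real \<Rightarrow> complex" where
  "cr f \<equiv> (\<lambda>x. complex_of_real (f x))"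

lemma fc_cr_minus: "fc (cr g) (- k) = cnj (fc (cr g) k)"
  using fc_cnj[of "cr g" "- k"] by simp

lemma integral_cr: "cper f \<Longrightarrow> integral {0..2 * pi} (cr f) = of_real (integral {0..2 * pi} f)"
  using integral_linear[OF cper_integrable bounded_linear_of_real, of f] by (simp add: o_def)

definition ew :: "int \<Rightarrow> real" where
  "ew k = 1 / (1 + \<bar>real_of_int k\<bar>)\<^sup>2"

lemma ew_summable: "ew summable_on UNIV"
  using summable_inverse_squares_int by (simp add: ew_def[abs_def])

lemma ew_nonneg [simp]: "0 \<le> ew k"
  by (simp add: ew_def)

lemma inv_mu_bound:
  assumes T: "T > 0" and k: "k \<noteq> 0"
  shows "1 / mu T k \<le> 2 / cT T" "(1 / mu T k)\<^sup>2 \<le> (2 / cT T)\<^sup>2 * ew k"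
proof -
  have "1 / mu T k \<le> 1 / (cT T / 2 * (1 + \<bar>real_of_int k\<bar>))"
    using mu_lower'[OF T k] cT_pos[OF T] mu_pos[OF T k]
    by (intro divide_left_mono) (auto intro!: mult_pos_pos)
  then have *: "1 / mu T k \<le> 2 / cT T * (1 / (1 + \<bar>real_of_int k\<bar>))" by simp
  also have "\<dots> \<le> 2 / cT T * 1"
    using cT_pos[OF T] by (intro mult_left_mono) auto
  finally show "1 / mu T k \<le> 2 / cT T" by simp
  have "(1 / mu T k)\<^sup>2 \<le> (2 / cT T * (1 / (1 + \<bar>real_of_int k\<bar>)))\<^sup>2"
    using * mu_pos[OF T k] by (intro power_mono) auto
  then show "(1 / mu T k)\<^sup>2 \<le> (2 / cT T)\<^sup>2 * ew k"
    by (simp add: ew_def power_mult_distrib power_divide)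
qed

lemma infsum_diff_complex:
  fixes f g :: "'i \<Rightarrow> complex"
  assumes "f summable_on A" "g summable_on A"
  shows "(\<Sum>\<^sub>\<infinity>k\<in>A. f k - g k) = infsum f A - infsum g A"
  using infsum_add[OF assms(1) summable_on_cmult_right[OF assms(2), of "- 1"]]
  by (simp add: infsum_uminus)

lemma prod_summable:
  fixes a b :: "int \<Rightarrow> real"
  assumes "a summable_on UNIV" "b summable_on UNIV" "\<And>k. a k \<ge> 0" "\<And>k. b k \<ge> 0"
  shows "(\<lambda>(j, k). a j * b k) summable_on UNIV"
proof -
  have "(\<lambda>(j, k). a j * b k) summable_on UNIV \<times> UNIV"
    by (rule summable_on_SigmaI[where g = "\<lambda>k. a k * infsum b UNIV"])
       (auto simp: assms intro!: has_sum_cmult_right summable_on_cmult_left)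
  then show ?thesis by simp
qed

section \<open>The weighted eigenvalue problem in coefficient space\<close>

context
  fixes T :: real and lam :: "real \<Rightarrow> real"
  assumes T: "T > 0" and lam: "wiener 1 (cr lam)" and lam_pos: "\<And>x. lam x > 0"
begin

abbreviation "lhat \<equiv> fc (cr lam)"

lemma lam_cper: "cper lam"
  using cper_Re[OF wiener_cper[OF lam]] by simp

lemma lhat_abs: "asum lhat"
  by (rule wiener_abs[OF lam])

definition "lhat_norm = (\<Sum>\<^sub>\<infinity>k. norm (lhat k))"

lemma lhat_le: "norm (lhat k) \<le> lhat_norm"
  using finite_sum_le_infsum[OF lhat_abs, of "{k}"] by (simp add: lhat_norm_def)

lemma lhat_norm_nonneg: "lhat_norm \<ge> 0"
  using lhat_le[of 0] norm_ge_zero[of "lhat 0"] by linarith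

lemma norm_lhat_minus [simp]: "norm (lhat (- k)) = norm (lhat k)"
  by (simp add: fc_cr_minus)

definition "lhat_0 = Re (lhat 0)"

lemma lhat_0: "lhat 0 = of_real lhat_0" "lhat_0 > 0"
proof -
  have "cnj (lhat 0) = lhat 0" using fc_cr_minus[of lam 0] by simp
  then show 1: "lhat 0 = of_real lhat_0" by (simp add: lhat_0_def complex_eq_iff)
  have "complex_of_real (integral {0..2 * pi} lam) = integral {0..2 * pi} (cr lam)"
    by (rule integral_cr[OF lam_cper, symmetric])
  then have "lhat 0 = of_real (integral {0..2 * pi} lam / (2 * pi))" by (simp add: fc_0)
  then have "lhat_0 = integral {0..2 * pi} lam / (2 * pi)" using 1 by (metis of_real_eq_iff)
  moreover have "integral {0..2 * pi} lam \<noteq> 0"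
    using integral_pos_zero[OF lam_cper, of 0] lam_pos[of 0] less_imp_le[OF lam_pos] by force
  moreover have "integral {0..2 * pi} lam \<ge> 0"
    by (intro integral_nonneg cper_integrable lam_cper) (auto intro: less_imp_le lam_pos)
  ultimately show "lhat_0 > 0" by (simp add: less_le)
qed

text \<open>\<open>Mt\<close> is multiplication by \<open>lam\<close> with the constant mode eliminated through the mean
  constraint, and \<open>Nt\<close> its symmetrization by the inverse square root of the multiplier: an
  eigenvalue \<open>\<nu>\<close> of \<open>Nt\<close> gives the Steklov eigenvalue \<open>1 / \<nu>\<close>.\<close>

definition Mt :: "int \<Rightarrow> int \<Rightarrow> complex" where
  "Mt j k = lhat (j - k) - lhat j * lhat (- k) / lhat 0"

definition Nt :: "int \<Rightarrow> int \<Rightarrow> complex" where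
  "Nt j k = (if j = 0 \<or> k = 0 then 0 else Mt j k / of_real (sqrt (mu T j) * sqrt (mu T k)))"

lemma Nt_herm: "Nt j k = cnj (Nt k j)"
proof -
  have "Mt j k = cnj (Mt k j)"
    using fc_cr_minus[of lam "k - j"] fc_cr_minus[of lam k] fc_cr_minus[of lam "- j"]
    by (simp add: Mt_def lhat_0)
  then show ?thesis by (auto simp: Nt_def mult.commute)
qed

lemma Mt_bound:
  "norm (Mt j k) \<le> norm (lhat (j - k)) + norm (lhat j) * norm (lhat k) / lhat_0"
  "norm (Mt j k) \<le> lhat_norm + lhat_norm * lhat_norm / lhat_0"
proof -
  have "norm (lhat j * lhat (- k) / lhat 0) = norm (lhat j) * norm (lhat k) / lhat_0"
    using lhat_0 by (simp add: norm_mult norm_divide)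
  then show 1: "norm (Mt j k) \<le> norm (lhat (j - k)) + norm (lhat j) * norm (lhat k) / lhat_0"
    unfolding Mt_def using norm_triangle_ineq4[of "lhat (j - k)" "lhat j * lhat (- k) / lhat 0"] by simp
  also have "\<dots> \<le> lhat_norm + lhat_norm * lhat_norm / lhat_0"
    using lhat_0(2) lhat_norm_nonneg by (intro add_mono divide_right_mono mult_mono lhat_le) auto
  finally show "norm (Mt j k) \<le> lhat_norm + lhat_norm * lhat_norm / lhat_0" .
qed

text \<open>One factor \<open>norm (Mt j k)\<close> is bounded uniformly, the other by coefficients
  of \<open>lam\<close>; AM-GM replaces \<open>1 / (mu T j * mu T k)\<close> by a multiple of
  \<open>ew j + ew k\<close>. Each of the four resulting products is summable over pairs.\<close>

lemma Nt_hs: "hilbert_schmidt Nt"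
  unfolding hilbert_schmidt_def
proof (rule summable_on_comparison_test)
  define a where "a k = norm (lhat k)" for k
  define K where "K = (2 / cT T)\<^sup>2"
  define A where "A = lhat_norm + lhat_norm * lhat_norm / lhat_0"
  have a: "a summable_on UNIV" "\<And>k. a k \<ge> 0" using lhat_abs by (simp_all add: a_def[abs_def])
  have A: "A \<ge> 0" unfolding A_def using lhat_0(2) lhat_norm_nonneg by simp
  have s1: "(\<lambda>(j, k). ew k * a (j - k)) summable_on UNIV"
    by (rule conv_summable(1)[OF ew_summable a(1) ew_nonneg a(2)])
  have "(\<lambda>(j, k). ew k * a (j - k)) summable_on UNIV \<times> UNIV" using s1 by simp
  then have "(\<lambda>(j, k). ew j * a (k - j)) summable_on UNIV \<times> UNIV"
    by (subst (asm) summable_on_swap) (simp add: case_prod_unfold)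
  moreover have "a (k - j) = a (j - k)" for j k
    using norm_lhat_minus[of "j - k"] by (simp add: a_def)
  ultimately have s2: "(\<lambda>(j, k). ew j * a (j - k)) summable_on UNIV" by simp
  have s3: "(\<lambda>(j, k). ew j * a k) summable_on UNIV"
    by (rule prod_summable[OF ew_summable a(1) ew_nonneg a(2)])
  have s4: "(\<lambda>(j, k). a j * ew k) summable_on UNIV"
    by (rule prod_summable[OF a(1) ew_summable a(2) ew_nonneg])
  show "(\<lambda>p. A * K / 2 * ((case p of (j, k) \<Rightarrow> ew k * a (j - k)) + (case p of (j, k) \<Rightarrow> ew j * a (j - k)))
      + A * K * lhat_norm / (2 * lhat_0) * ((case p of (j, k) \<Rightarrow> ew j * a k) + (case p of (j, k) \<Rightarrow> a j * ew k))) summable_on UNIV"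
    by (intro summable_on_add summable_on_cmult_right s1 s2 s3 s4)
  fix p :: "int \<times> int"
  obtain j k where p: "p = (j, k)" by fastforce
  show "(case p of (j, k) \<Rightarrow> (norm (Nt j k))\<^sup>2) \<le> A * K / 2 * ((case p of (j, k) \<Rightarrow> ew k * a (j - k)) + (case p of (j, k) \<Rightarrow> ew j * a (j - k)))
      + A * K * lhat_norm / (2 * lhat_0) * ((case p of (j, k) \<Rightarrow> ew j * a k) + (case p of (j, k) \<Rightarrow> a j * ew k))"
  proof (cases "j = 0 \<or> k = 0")
    case True
    then show ?thesis unfolding p using A lhat_0(2) lhat_norm_nonneg a
      by (auto simp: Nt_def K_def intro!: add_nonneg_nonneg mult_nonneg_nonneg divide_nonneg_nonneg)
  next
    case False
    define x where "x = 1 / mu T j"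
    define y where "y = 1 / mu T k"
    have xy: "x > 0" "y > 0" "x\<^sup>2 \<le> K * ew j" "y\<^sup>2 \<le> K * ew k"
      using inv_mu_bound(2)[OF T, of j] inv_mu_bound(2)[OF T, of k] mu_pos[OF T] False
      by (auto simp: x_def y_def K_def)
    have "0 \<le> (x - y)\<^sup>2" by simp
    then have xy2: "x * y \<le> K / 2 * (ew j + ew k)"
      using xy(3,4) by (simp add: power2_diff algebra_simps)
    have sq: "(sqrt (mu T j) * sqrt (mu T k))\<^sup>2 = mu T j * mu T k"
      using mu_nonneg[OF T] by (simp add: power_mult_distrib)
    have "(norm (Nt j k))\<^sup>2 = (norm (Mt j k))\<^sup>2 / (sqrt (mu T j) * sqrt (mu T k))\<^sup>2"
      using False unfolding Nt_def by (simp add: norm_divide power_divide del: of_real_mult)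
    also have "\<dots> = (norm (Mt j k) * norm (Mt j k)) * (x * y)"
      unfolding sq by (simp add: x_def y_def power2_eq_square)
    also have "\<dots> \<le> (A * (a (j - k) + a j * a k / lhat_0)) * (K / 2 * (ew j + ew k))"
    proof (rule mult_mono[OF _ xy2])
      show "norm (Mt j k) * norm (Mt j k) \<le> A * (a (j - k) + a j * a k / lhat_0)"
        by (rule mult_mono) (use Mt_bound[of j k] A in \<open>auto simp: A_def a_def\<close>)
      show "0 \<le> A * (a (j - k) + a j * a k / lhat_0)"
        using A a lhat_0(2) by auto
    qed (use xy in auto)
    also have "\<dots> = A * K / 2 * (ew k * a (j - k) + ew j * a (j - k)) + A * K / (2 * lhat_0) * (ew j * (a j * a k) + a j * a k * ew k)"
      using lhat_0(2) by (simp add: field_simps)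
    also have "\<dots> \<le> A * K / 2 * (ew k * a (j - k) + ew j * a (j - k)) + A * K / (2 * lhat_0) * (ew j * (lhat_norm * a k) + a j * lhat_norm * ew k)"
      using A lhat_0(2) a lhat_le by (intro add_left_mono mult_left_mono add_mono mult_right_mono divide_nonneg_nonneg mult_nonneg_nonneg)
        (auto simp: K_def a_def)
    also have "\<dots> = A * K / 2 * (ew k * a (j - k) + ew j * a (j - k)) + A * K * lhat_norm / (2 * lhat_0) * (ew j * a k + a j * ew k)"
      by (simp add: algebra_simps add_divide_distrib)
    finally show ?thesis unfolding p by simp
  qed
qed (auto simp: case_prod_unfold)

lemma conv_lhat_summable:
  assumes "\<And>k. norm (c k) \<le> B"
  shows "(\<lambda>k. lhat (j - k) * c k) summable_on UNIV"
proof (rule abs_summable_summable, rule summable_on_comparison_test)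
  have "bij (\<lambda>k. j - k :: int)" by (rule bij_betwI[where g = "\<lambda>k. j - k"]) auto
  from summable_on_reindex_bij_betw[OF this, of "\<lambda>k. norm (lhat k)"] lhat_abs
  have "(\<lambda>k. norm (lhat (j - k))) summable_on UNIV" by simp
  then show "(\<lambda>k. norm (lhat (j - k)) * B) summable_on UNIV" by (rule summable_on_cmult_left)
qed (auto simp: norm_mult intro!: mult_left_mono assms)

text \<open>Bootstrapping: the decay of \<open>1 / mu\<close> first turns square summable into
  summable, then each use of the equation gains one order. It stops at 2 because \<open>lam\<close>
  is assumed only in \<open>wiener 1\<close>.\<close>

lemma eigen_sequence_regular:
  assumes c: "sqsum c" and eq: "\<And>j. of_real (mu T j) * c j = of_real \<sigma> * (\<Sum>\<^sub>\<infinity>k. lhat (j - k) * c k)"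
  shows "wsum 2 c"
    and "\<And>\<theta>. fser (\<lambda>k. of_real (mu T k) * c k) \<theta> = of_real (\<sigma> * lam \<theta>) * fser c \<theta>"
proof -
  define a where "a k = norm (lhat k)" for k
  define K where "K = (2 / cT T)\<^sup>2"
  have a: "a summable_on UNIV" "\<And>k. a k \<ge> 0" using lhat_abs by (simp_all add: a_def[abs_def])
  define B where "B = sqrt (sqn c)"
  have cB: "norm (c k) \<le> B" for k
  proof -
    have "(norm (c k))\<^sup>2 \<le> sqn c"
      unfolding sqn_def using c finite_sum_le_infsum[of "\<lambda>k. (norm (c k))\<^sup>2" UNIV "{k}"] by (simp add: sqsum_def)
    then show ?thesis unfolding B_def by (rule real_le_rsqrt)
  qed
  have cs: "(\<lambda>k. (norm (c k))\<^sup>2) summable_on UNIV" using c by (simp add: sqsum_def)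
  have bij: "bij (\<lambda>k. j - k :: int)" for j by (rule bij_betwI[where g = "\<lambda>k. j - k"]) auto
  have as: "(\<lambda>k. a (j - k)) summable_on UNIV" for j
    using summable_on_reindex_bij_betw[OF bij, of a j] a by simp
  have asum: "(\<Sum>\<^sub>\<infinity>k. a (j - k)) = lhat_norm" for j
    using infsum_reindex_bij_betw[OF bij, of a j] by (simp add: lhat_norm_def a_def[abs_def])
  have cv: "(\<lambda>k. a (j - k) * (norm (c k))\<^sup>2) summable_on UNIV"
      "(\<lambda>j. \<Sum>\<^sub>\<infinity>k. a (j - k) * (norm (c k))\<^sup>2) summable_on UNIV" for j
    using conv_summable(2,3)[OF cs a(1) _ a(2)] by (simp_all add: mult.commute)
  have "asum c"
  proof (rule summable_on_comparison_test)
    define D where "D j = norm (c j) * (if j = 0 then 1 else 0) + (\<bar>\<sigma>\<bar> / 2) * (K * lhat_norm * ew j + (\<Sum>\<^sub>\<infinity>k. a (j - k) * (norm (c k))\<^sup>2))" for j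
    have "(\<lambda>j. norm (c j) * (if j = 0 then 1 else 0)) summable_on UNIV"
      by (rule finite_nonzero_values_imp_summable_on, rule finite_subset[of _ "{0}"]) auto
    then show "D summable_on UNIV"
      unfolding D_def[abs_def] by (intro summable_on_add summable_on_cmult_right ew_summable cv)
    fix j
    show "norm (c j) \<le> D j"
    proof (cases "j = 0")
      case True
      then show ?thesis
        unfolding D_def using lhat_norm_nonneg a
        by (auto simp: K_def intro!: mult_nonneg_nonneg add_nonneg_nonneg infsum_nonneg)
    next
      case False
      have m: "mu T j > 0" by (rule mu_pos[OF T False])
      have "mu T j * norm (c j) = norm (of_real (mu T j) * c j)" using m by (simp add: norm_mult)
      also have "\<dots> = \<bar>\<sigma>\<bar> * norm (\<Sum>\<^sub>\<infinity>k. lhat (j - k) * c k)" unfolding eq by (simp add: norm_mult)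
      finally have "norm (c j) = \<bar>\<sigma>\<bar> * ((1 / mu T j) * norm (\<Sum>\<^sub>\<infinity>k. lhat (j - k) * c k))"
        using m by (simp add: field_simps)
      also have "(1 / mu T j) * norm (\<Sum>\<^sub>\<infinity>k. lhat (j - k) * c k) = norm (\<Sum>\<^sub>\<infinity>k. of_real (1 / mu T j) * (lhat (j - k) * c k))"
        using m by (subst infsum_cmult_right') (simp add: norm_mult norm_divide)
      also have "\<dots> \<le> (\<Sum>\<^sub>\<infinity>k. a (j - k) * (K / 2 * ew j) + 1 / 2 * (a (j - k) * (norm (c k))\<^sup>2))"
      proof (rule norm_infsum_le[OF has_sum_infsum has_sum_infsum])
        show "(\<lambda>k. of_real (1 / mu T j) * (lhat (j - k) * c k)) summable_on UNIV"
          by (intro summable_on_cmult_right conv_lhat_summable[OF cB])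
        show "(\<lambda>k. a (j - k) * (K / 2 * ew j) + 1 / 2 * (a (j - k) * (norm (c k))\<^sup>2)) summable_on UNIV"
          by (intro summable_on_add summable_on_cmult_right summable_on_cmult_left as cv)
        fix k
        define x where "x = 1 / mu T j"
        define y where "y = norm (c k)"
        have x: "x > 0" "x\<^sup>2 \<le> K * ew j" using inv_mu_bound(2)[OF T False] m by (auto simp: x_def K_def)
        \<comment> \<open>AM-GM splits \<open>norm (c k) / mu T j\<close> into a weight summable in
          \<open>j\<close> and the square of \<open>norm (c k)\<close>, so only square summability
          of \<open>c\<close> is used.\<close>
        have "0 \<le> (x - y)\<^sup>2" by simp
        then have "x * y \<le> K / 2 * ew j + 1 / 2 * y\<^sup>2"
          using x by (simp add: power2_diff)
        then have "a (j - k) * (x * y) \<le> a (j - k) * (K / 2 * ew j + 1 / 2 * y\<^sup>2)"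
          by (rule mult_left_mono) (rule a)
        then show "norm (of_real (1 / mu T j) * (lhat (j - k) * c k)) \<le> a (j - k) * (K / 2 * ew j) + 1 / 2 * (a (j - k) * (norm (c k))\<^sup>2)"
          using m by (simp add: norm_mult norm_divide a_def x_def y_def algebra_simps)
      qed
      also have "\<dots> = (\<Sum>\<^sub>\<infinity>k. a (j - k)) * (K / 2 * ew j) + 1 / 2 * (\<Sum>\<^sub>\<infinity>k. a (j - k) * (norm (c k))\<^sup>2)"
        by (simp only: infsum_add[OF summable_on_cmult_left[OF as] summable_on_cmult_right[OF cv(1)]]
            infsum_cmult_left' infsum_cmult_right')
      finally have "norm (c j) \<le> \<bar>\<sigma>\<bar> * (lhat_norm * (K / 2 * ew j) + 1 / 2 * (\<Sum>\<^sub>\<infinity>k. a (j - k) * (norm (c k))\<^sup>2))"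
        unfolding asum by (simp add: mult_left_mono)
      also have "\<dots> = D j" using False by (simp add: D_def algebra_simps)
      finally show ?thesis .
    qed
  qed auto
  then have w0: "wsum 0 c" by (simp add: wsum_def)
  have coeff: "of_real \<sigma> * fc (\<lambda>x. cr lam x * fser c x) j = of_real (mu T j) * c j" for j
  proof -
    have "fc (\<lambda>x. fser c x * cr lam x) j = (\<Sum>\<^sub>\<infinity>k. c k * lhat (j - k))"
      using fc_fser_mult[OF wsum_abs[OF w0] wiener_cper[OF lam], of j] by (simp add: infsumI)
    then show ?thesis unfolding eq by (simp add: mult.commute)
  qed
  have step: "wsum (Suc s) c" if "wsum s c" "s \<le> 1" for s
  proof -
    have "wiener s (\<lambda>x. of_real \<sigma> * (cr lam x * fser c x))"
      by (intro wiener_cmult wiener_mult wiener_mono[OF lam] wiener_fser that)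
    then have "wsum s (\<lambda>k. of_real (mu T k) * c k)"
      unfolding wiener_def by (simp add: fc_cmult[abs_def] coeff cong: wsum_def)
         (simp add: wsum_def fc_cmult coeff)
    then show ?thesis by (rule wsum_of_mu[OF T])
  qed
  show w2: "wsum 2 c" using step[OF step[OF w0]] by (simp add: numeral_2_eq_2)
  have w: "asum (\<lambda>k. of_real (mu T k) * c k)" using wsum_abs[OF wsum_mu[OF T, of 1 c]] w2 by (simp add: numeral_2_eq_2)
  have "fser (\<lambda>k. of_real (mu T k) * c k) = (\<lambda>\<theta>. of_real \<sigma> * (cr lam \<theta> * fser c \<theta>))"
  proof (rule fc_unique)
    show "cper (\<lambda>\<theta>. of_real \<sigma> * (cr lam \<theta> * fser c \<theta>))"
      by (intro cper_mult cper_const cper_fser wsum_abs[OF w0] wiener_cper[OF lam])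
  qed (simp_all add: cper_fser w fc_fser fc_cmult coeff)
  then show "fser (\<lambda>k. of_real (mu T k) * c k) \<theta> = of_real (\<sigma> * lam \<theta>) * fser c \<theta>" for \<theta>
    by (simp add: mult.assoc)
qed

text \<open>If the inequality failed, the form of \<open>Nt\<close> would exceed the squared norm at
  some \<open>z\<close>, so \<open>Nt\<close> would have an eigenvalue \<open>\<nu> > 1\<close>;
  undoing the symmetrization gives a regular solution with
  \<open>\<sigma> = 1 / \<nu> < 1\<close>.\<close>

theorem spectral_gap:
  assumes no: "\<And>\<sigma> c. 0 < \<sigma> \<Longrightarrow> \<sigma> < 1 \<Longrightarrow> wsum 2 c \<Longrightarrow> \<exists>k. c k \<noteq> 0 \<Longrightarrow>
      (\<And>\<theta>. fser (\<lambda>k. of_real (mu T k) * c k) \<theta> = of_real (\<sigma> * lam \<theta>) * fser c \<theta>) \<Longrightarrow> False"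
    and g: "wiener 1 (cr g)" and mean: "integral {0..2 * pi} (\<lambda>x. lam x * g x) = 0"
  shows "integral {0..2 * pi} (\<lambda>x. lam x * (g x)\<^sup>2) \<le> Re (integral {0..2 * pi} (\<lambda>x. Lam T (cr g) x * cr g x))"
proof (rule ccontr)
  assume neg: "\<not> ?thesis"
  define gh where "gh = fc (cr g)"
  define lg where "lg = fc (\<lambda>x. cr lam x * cr g x)"
  have gc: "cper (cr g)" "asum gh" unfolding gh_def using g by (auto intro: wiener_cper wiener_abs)
  have lgc: "cper (\<lambda>x. cr lam x * cr g x)" by (intro cper_mult gc wiener_cper[OF lam])
  define G where "G = (\<Sum>\<^sub>\<infinity>k. norm (gh k))"
  have gG: "norm (gh k) \<le> G" for k
    using finite_sum_le_infsum[OF gc(2), of "{k}"] by (simp add: G_def)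
  have lg: "lg j = (\<Sum>\<^sub>\<infinity>k. lhat (j - k) * gh k)" for j
    using fc_mult_has_sum[OF gc(1) gc(2)[unfolded gh_def] wiener_cper[OF lam], of j]
    by (simp add: infsumI lg_def gh_def mult.commute)
  have lg0: "lg 0 = 0"
  proof -
    have "integral {0..2 * pi} (\<lambda>x. complex_of_real (lam x * g x)) = 0"
      using integral_cr[OF cper_mult[OF lam_cper cper_Re[OF gc(1)]]] mean by simp
    then show ?thesis by (simp add: lg_def fc_0)
  qed
  have G0: "0 \<le> G" by (rule order_trans[OF norm_ge_zero gG])
  \<comment> \<open>With the square root of the multiplier, \<open>sqn z\<close> is the energy of
    \<open>g\<close> and \<open>hform Nt z z\<close> its mass weighted by \<open>lam\<close>, both
    divided by \<open>2 * pi\<close>.\<close>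
  define z where "z k = of_real (sqrt (mu T k)) * gh k" for k
  have zn: "(norm (z k))\<^sup>2 = mu T k * (norm (gh k))\<^sup>2" for k
    using mu_nonneg[OF T, of k] by (simp add: z_def norm_mult power_mult_distrib)
  have z: "sqsum z"
    unfolding sqsum_def
  proof (rule summable_on_comparison_test)
    show "(\<lambda>k. G / cT T * (wt 1 k * norm (gh k))) summable_on UNIV"
      using g by (intro summable_on_cmult_right) (simp add: wiener_def wsum_def gh_def)
    fix k
    have "mu T k * (norm (gh k) * norm (gh k)) \<le> (wt 1 k / cT T) * (G * norm (gh k))"
    proof (intro mult_mono mult_nonneg_nonneg gG)
      show "mu T k \<le> wt 1 k / cT T"
        using mu_upper[OF T, of k] cT_pos[OF T] by (simp add: wt_def field_simps)
    qed (use cT_pos[OF T] G0 in auto)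
    then show "(norm (z k))\<^sup>2 \<le> G / cT T * (wt 1 k * norm (gh k))"
      unfolding zn by (simp add: power2_eq_square mult_ac)
  qed auto
  have "((\<lambda>k. fc (Lam T (cr g)) k * gh (- k)) has_sum
      (integral {0..2 * pi} (\<lambda>x. Lam T (cr g) x * cr g x) / of_real (2 * pi))) UNIV"
    unfolding gh_def using wiener_Lam[OF T, of 0 "cr g"] g gc by (intro integral_mult_has_sum) auto
  moreover have "fc (Lam T (cr g)) k * gh (- k) = of_real ((norm (z k))\<^sup>2)" for k
  proof -
    have "fc (Lam T (cr g)) k * gh (- k) = of_real (mu T k) * (gh k * cnj (gh k))"
      using fc_Lam[OF T, of 0 "cr g" k] g fc_cr_minus[of g k] by (simp add: gh_def)
    then show ?thesis unfolding zn complex_norm_square[symmetric] by simp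
  qed
  ultimately have "((\<lambda>k. complex_of_real ((norm (z k))\<^sup>2)) has_sum
      (integral {0..2 * pi} (\<lambda>x. Lam T (cr g) x * cr g x) / of_real (2 * pi))) UNIV"
    by (simp only:)
  from has_sum_Re[OF this] have sz: "sqn z = Re (integral {0..2 * pi} (\<lambda>x. Lam T (cr g) x * cr g x)) / (2 * pi)"
    by (simp add: sqn_def infsumI del: of_real_power)
  have "hform Nt z z = of_real (integral {0..2 * pi} (\<lambda>x. lam x * (g x)\<^sup>2) / (2 * pi))"
  proof -
    have "hform Nt z z = (\<Sum>\<^sub>\<infinity>j. \<Sum>\<^sub>\<infinity>k. cnj (z j) * Nt j k * z k)"
      using infsum_Sigma_banach[of "\<lambda>(j, k). cnj (z j) * Nt j k * z k" UNIV "\<lambda>_. UNIV"] hform_summable[OF Nt_hs z z]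
      by (simp add: hform_def)
    also have "\<dots> = (\<Sum>\<^sub>\<infinity>j. lg j * gh (- j))"
    proof (rule infsum_cong)
      fix j
      show "(\<Sum>\<^sub>\<infinity>k. cnj (z j) * Nt j k * z k) = lg j * gh (- j)"
      proof (cases "j = 0")
        case True
        then show ?thesis by (simp add: Nt_def lg0)
      next
        case False
        have bij: "bij (\<lambda>k. j - k :: int)" for j by (rule bij_betwI[where g = "\<lambda>k. j - k"]) auto
        define h where "h k = gh k * (if k = 0 then 0 else 1)" for k
        have hG: "norm (h k) \<le> G" for k
          using gG[of k] G0 by (simp add: h_def)
        have t: "cnj (z j) * Nt j k * z k = cnj (gh j) * (lhat (j - k) * h k - lhat j / lhat 0 * (lhat (0 - k) * h k))" for k
        proof (cases "k = 0")
          case True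
          then show ?thesis by (simp add: Nt_def h_def)
        next
          case k: False
          have "sqrt (mu T j) \<noteq> 0" "sqrt (mu T k) \<noteq> 0"
            using mu_pos[OF T k] mu_pos[OF T False] by auto
          then show ?thesis using k False by (simp add: Nt_def h_def z_def Mt_def field_simps)
        qed
        \<comment> \<open>\<open>h\<close> is \<open>gh\<close> without its constant mode. Because
          \<open>lg 0 = 0\<close>, the correction in \<open>Mt\<close> restores exactly the missing
          term \<open>lhat j * gh 0\<close>.\<close>
        have hs: "(\<Sum>\<^sub>\<infinity>k. lhat (i - k) * h k) = lg i - lhat i * gh 0" for i
        proof -
          have "lg i = (\<Sum>\<^sub>\<infinity>k. lhat (i - k) * h k + (if k = 0 then lhat i * gh 0 else 0))"
            unfolding lg by (intro infsum_cong) (simp add: h_def)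
          also have "\<dots> = (\<Sum>\<^sub>\<infinity>k. lhat (i - k) * h k) + (\<Sum>\<^sub>\<infinity>k::int. (if k = 0 then lhat i * gh 0 else 0))"
            by (rule infsum_add[OF conv_lhat_summable[OF hG]], rule finite_nonzero_values_imp_summable_on,
                rule finite_subset[of _ "{0}"]) auto
          also have "(\<Sum>\<^sub>\<infinity>k::int. (if k = 0 then lhat i * gh 0 else 0)) = (\<Sum>\<^sub>\<infinity>k\<in>{0::int}. (if k = 0 then lhat i * gh 0 else 0))"
            by (rule infsum_cong_neutral) auto
          finally show ?thesis by simp
        qed
        have "(\<Sum>\<^sub>\<infinity>k. cnj (z j) * Nt j k * z k)
            = cnj (gh j) * ((\<Sum>\<^sub>\<infinity>k. lhat (j - k) * h k) - lhat j / lhat 0 * (\<Sum>\<^sub>\<infinity>k. lhat (0 - k) * h k))"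
          unfolding t infsum_cmult_right'
          by (subst infsum_diff_complex) (auto intro!: summable_on_cmult_right conv_lhat_summable[OF hG] simp only: infsum_cmult_right')
        also have "\<dots> = cnj (gh j) * lg j"
          unfolding hs lg0 using lhat_0 by simp
        finally show ?thesis using fc_cr_minus[of g j] by (simp add: gh_def mult.commute)
      qed
    qed
    also have "\<dots> = integral {0..2 * pi} (\<lambda>x. cr lam x * cr g x * cr g x) / of_real (2 * pi)"
      unfolding lg_def gh_def
      by (rule infsumI, rule integral_mult_has_sum[of 1]) (intro wiener_mult lam g gc)+
    also have "integral {0..2 * pi} (\<lambda>x. cr lam x * cr g x * cr g x) = of_real (integral {0..2 * pi} (\<lambda>x. lam x * (g x)\<^sup>2))"
      using integral_cr[OF cper_mult[OF lam_cper cper_mult[OF cper_Re[OF gc(1)] cper_Re[OF gc(1)]]]]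
      by (simp add: power2_eq_square mult.assoc)
    finally show ?thesis by simp
  qed
  then have "sqn z < Re (hform Nt z z)"
    using neg sz by (simp add: divide_strict_right_mono)
  from hilbert_schmidt_eigenvector[OF Nt_hs Nt_herm z this]
  obtain \<nu> y where nu: "\<nu> > 1" and y: "sqsum y" "\<exists>j. y j \<noteq> 0"
    and eig: "\<And>j. (\<Sum>\<^sub>\<infinity>k. Nt j k * y k) = of_real \<nu> * y j" by metis
  have y0: "y 0 = 0" using eig[of 0] nu by (simp add: Nt_def)
  define d where "d k = (if k = 0 then 0 else y k / of_real (sqrt (mu T k)))" for k
  have dn: "(norm (d k))\<^sup>2 \<le> 2 / cT T * (norm (y k))\<^sup>2" for k
  proof (cases "k = 0")
    case False
    have "(norm (d k))\<^sup>2 = 1 / mu T k * (norm (y k))\<^sup>2"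
      using False mu_nonneg[OF T, of k] by (simp add: d_def norm_divide power_divide)
    also have "\<dots> \<le> 2 / cT T * (norm (y k))\<^sup>2"
      by (rule mult_right_mono[OF inv_mu_bound(1)[OF T False]]) auto
    finally show ?thesis .
  qed (use cT_pos[OF T] in \<open>auto simp: d_def\<close>)
  have ds: "sqsum d"
    unfolding sqsum_def
    by (rule summable_on_comparison_test[OF summable_on_cmult_right[OF y(1)[unfolded sqsum_def]] dn]) auto
  \<comment> \<open>The constant mode is recovered from the equation for \<open>j = 0\<close>: as
    \<open>mu\<close> vanishes there, the weighted mean of the solution must be zero.\<close>
  define c0 where "c0 = - (\<Sum>\<^sub>\<infinity>k. lhat (0 - k) * d k) / lhat 0"
  define c where "c k = d k + (if k = 0 then c0 else 0)" for k
  have cs: "sqsum c" unfolding c_def by (intro sqsum_add ds sqsum_single)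
  have dB: "norm (d k) \<le> sqrt (sqn d)" for k
  proof -
    have "(norm (d k))\<^sup>2 \<le> sqn d"
      unfolding sqn_def using ds finite_sum_le_infsum[of "\<lambda>k. (norm (d k))\<^sup>2" UNIV "{k}"] by (simp add: sqsum_def)
    then show ?thesis by (rule real_le_rsqrt)
  qed
  have lc: "(\<Sum>\<^sub>\<infinity>k. lhat (j - k) * c k) = (\<Sum>\<^sub>\<infinity>k. lhat (j - k) * d k) + lhat j * c0" for j
  proof -
    have "(\<Sum>\<^sub>\<infinity>k. lhat (j - k) * c k) = (\<Sum>\<^sub>\<infinity>k. lhat (j - k) * d k + (if k = 0 then lhat j * c0 else 0))"
      by (intro infsum_cong) (auto simp: c_def algebra_simps)
    also have "\<dots> = (\<Sum>\<^sub>\<infinity>k. lhat (j - k) * d k) + (\<Sum>\<^sub>\<infinity>k::int. (if k = 0 then lhat j * c0 else 0))"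
      by (rule infsum_add[OF conv_lhat_summable[OF dB]], rule finite_nonzero_values_imp_summable_on,
          rule finite_subset[of _ "{0}"]) auto
    also have "(\<Sum>\<^sub>\<infinity>k::int. (if k = 0 then lhat j * c0 else 0)) = (\<Sum>\<^sub>\<infinity>k\<in>{0::int}. (if k = 0 then lhat j * c0 else 0))"
      by (rule infsum_cong_neutral) auto
    finally show ?thesis by simp
  qed
  have ceq: "of_real (mu T j) * c j = of_real (1 / \<nu>) * (\<Sum>\<^sub>\<infinity>k. lhat (j - k) * c k)" for j
  proof (cases "j = 0")
    case True
    then show ?thesis using lhat_0 unfolding lc by (simp add: c0_def)
  next
    case False
    have sj: "sqrt (mu T j) \<noteq> 0" using mu_pos[OF T False] by simp
    have t: "Nt j k * y k = 1 / of_real (sqrt (mu T j)) * (lhat (j - k) * d k - lhat j / lhat 0 * (lhat (0 - k) * d k))" for k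
    proof (cases "k = 0")
      case k: False
      have "sqrt (mu T k) \<noteq> 0" using mu_pos[OF T k] by auto
      then show ?thesis using k False sj by (simp add: Nt_def d_def Mt_def field_simps)
    qed (simp add: Nt_def d_def)
    have "of_real \<nu> * y j = 1 / of_real (sqrt (mu T j)) * ((\<Sum>\<^sub>\<infinity>k. lhat (j - k) * d k) - lhat j / lhat 0 * (\<Sum>\<^sub>\<infinity>k. lhat (0 - k) * d k))"
      unfolding eig[symmetric] t infsum_cmult_right'
      by (subst infsum_diff_complex) (auto intro!: summable_on_cmult_right conv_lhat_summable[OF dB] simp only: infsum_cmult_right')
    also have "(\<Sum>\<^sub>\<infinity>k. lhat (j - k) * d k) - lhat j / lhat 0 * (\<Sum>\<^sub>\<infinity>k. lhat (0 - k) * d k) = (\<Sum>\<^sub>\<infinity>k. lhat (j - k) * c k)"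
      unfolding lc c0_def using lhat_0 by simp
    finally have *: "of_real \<nu> * (of_real (sqrt (mu T j)) * y j) = (\<Sum>\<^sub>\<infinity>k. lhat (j - k) * c k)"
      using sj by (simp add: field_simps)
    have "of_real (mu T j) = (of_real (sqrt (mu T j)) * of_real (sqrt (mu T j)) :: complex)"
      using mu_nonneg[OF T, of j] by (simp add: of_real_mult[symmetric] del: of_real_mult)
    then have "of_real (mu T j) * c j = of_real (sqrt (mu T j)) * y j"
      using False sj by (simp add: c_def d_def)
    then show ?thesis unfolding *[symmetric] using nu by simp
  qed
  have cnz: "\<exists>k. c k \<noteq> 0"
  proof -
    obtain j where j: "y j \<noteq> 0" using y(2) by blast
    then have "j \<noteq> 0" using y0 by auto
    then show ?thesis using j mu_pos[OF T, of j] by (intro exI[of _ j]) (auto simp: c_def d_def)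
  qed
  show False
    by (rule no[of "1 / \<nu>" c]) (use nu cnz eigen_sequence_regular[OF cs ceq] in auto)
qed

end

section \<open>Boundary regularity\<close>

lemma summable_on_finite_sum:
  fixes X :: "'i \<Rightarrow> 'k \<Rightarrow> real"
  assumes "finite I" "\<And>i. i \<in> I \<Longrightarrow> X i summable_on A"
  shows "(\<lambda>m. \<Sum>i\<in>I. X i m) summable_on A"
  using assms by (induction I rule: finite_induct) (auto intro: summable_on_add)

text \<open>For \<open>m \<le> 0\<close> and \<open>k \<ge> 0\<close> one has
  \<open>|m| \<le> |m - k|\<close>, so the weight can be put entirely on \<open>f\<close>; only the
  negative modes of \<open>g\<close> must carry weight themselves. On the nonpositive side the
  product is thus as regular as \<open>f\<close>, although \<open>g\<close> need not be.\<close>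

lemma commutator_bound:
  assumes f: "wiener s f" and g: "cper g" "asum (fc g)"
    and neg: "(\<lambda>k. (if k < 0 then wt s k else 1) * norm (fc g k)) summable_on UNIV"
  obtains X where "X summable_on UNIV" "\<And>m. X m \<ge> (0::real)"
    "\<And>m. m \<le> 0 \<Longrightarrow> wt s m * norm (fc (\<lambda>x. f x * g x) m) \<le> X m"
proof -
  define a where "a k = (if k < 0 then wt s k else 1) * norm (fc g k)" for k
  define b where "b k = wt s k * norm (fc f k)" for k
  have ab: "a summable_on UNIV" "b summable_on UNIV" "\<And>k. a k \<ge> 0" "\<And>k. b k \<ge> 0"
    using neg f by (auto simp: a_def[abs_def] b_def[abs_def] wiener_def wsum_def)
  define X where "X m = (\<Sum>\<^sub>\<infinity>k. a k * b (m - k))" for m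
  show ?thesis
  proof (rule that[of X])
    show "X summable_on UNIV" unfolding X_def[abs_def] by (rule conv_summable(3)[OF ab])
    show "X m \<ge> 0" for m unfolding X_def using ab by (intro infsum_nonneg) auto
    fix m :: int assume m: "m \<le> 0"
    have "((\<lambda>k. of_real (wt s m) * (fc g k * fc f (m - k))) has_sum
        of_real (wt s m) * fc (\<lambda>x. g x * f x) m) UNIV"
      by (intro has_sum_cmult_right fc_mult_has_sum wiener_cper[OF f] g)
    then have "norm (of_real (wt s m) * fc (\<lambda>x. g x * f x) m) \<le> X m"
      unfolding X_def
    proof (rule norm_infsum_le[OF _ has_sum_infsum[OF conv_summable(2)[OF ab]]])
      fix k
      have "wt s m \<le> (if k < 0 then wt s k else 1) * wt s (m - k)"
      proof (cases "k < 0")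
        case True
        then show ?thesis using wt_submult[of s k "m - k"] by simp
      next
        case False
        then show ?thesis using wt_mono_arg[of m "m - k" s] m by simp
      qed
      then have "wt s m * norm (fc g k * fc f (m - k)) \<le> (if k < 0 then wt s k else 1) * wt s (m - k) * norm (fc g k * fc f (m - k))"
        by (intro mult_right_mono) auto
      also have "\<dots> = a k * b (m - k)" by (simp add: a_def b_def norm_mult)
      finally show "norm (of_real (wt s m) * (fc g k * fc f (m - k))) \<le> a k * b (m - k)"
        by (simp add: norm_mult)
    qed
    then show "wt s m * norm (fc (\<lambda>x. f x * g x) m) \<le> X m" by (simp add: norm_mult mult.commute)
  qed
qed

text \<open>Coefficients of a real function at \<open>m\<close> and \<open>- m\<close> are
  conjugate, so decay on one side is decay on both.\<close>

lemma wiener_real_from_neg: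
  assumes f: "cper f" and X: "X summable_on UNIV" "\<And>m. X m \<ge> 0"
    and le: "\<And>m. m \<le> 0 \<Longrightarrow> wt s m * norm (fc (cr f) m) \<le> X m"
  shows "wiener s (cr f)"
proof -
  have "wsum s (fc (cr f))"
    unfolding wsum_def
  proof (rule summable_on_comparison_test)
    have "bij (uminus :: int \<Rightarrow> int)" by (rule bij_uminus)
    from summable_on_reindex_bij_betw[OF this, of X] X
    show "(\<lambda>m. X m + X (- m)) summable_on UNIV" by (intro summable_on_add) auto
    show "wt s m * norm (fc (cr f) m) \<le> X m + X (- m)" for m
    proof (cases "m \<le> 0")
      case True
      then show ?thesis using le[of m] X(2)[of "- m"] by simp
    next
      case False
      have "norm (fc (cr f) (- m)) = norm (fc (cr f) m)" by (simp add: fc_cr_minus)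
      then show ?thesis using False le[of "- m"] X(2)[of m] by simp
    qed
  qed auto
  then show ?thesis using f by (simp add: wiener_def cper_of_real)
qed

definition rd :: "(real \<Rightarrow> real) \<Rightarrow> real \<Rightarrow> real" where
  "rd g x = Re (fd (cr g) x)"

lemma rd_deriv:
  assumes "wiener (Suc s) (cr g)"
  shows "(g has_real_derivative rd g x) (at x)" "fd (cr g) = cr (rd g)" "wiener s (cr (rd g))"
proof -
  have "((\<lambda>x. Re (cr g x)) has_vector_derivative Re (fd (cr g) x)) (at x)" for x
    by (rule bounded_linear.has_vector_derivative[OF bounded_linear_Re fd_has_vector_derivative[OF assms]])
  then show 1: "(g has_real_derivative rd g x) (at x)" for x
    by (simp add: rd_def has_real_derivative_iff_has_vector_derivative)
  show 2: "fd (cr g) = cr (rd g)"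
    by (rule fd_eqI[OF assms has_vector_derivative_of_real[OF 1]])
  show "wiener s (cr (rd g))" using wiener_fd[OF assms] 2 by simp
qed

lemma cper_of_cr: "cper (cr f) \<Longrightarrow> cper f"
  using cper_Re[of "cr f"] by simp

text \<open>\<open>C2_strip\<close> contains no symmetry of second derivatives. The two sides are
  compared by Fourier coefficients in the angle, each being \<open>\<i> * k\<close> times the
  coefficient of \<open>dt T f\<close>.\<close>

lemma mixed_partials:
  fixes f :: "real \<times> real \<Rightarrow> real"
  assumes T: "T > 0" and sym: "mobius_sym T f" and h: "harmonic_strip T f" and t: "t \<in> {-T..T}"
  shows "dth (dt T f) (t, \<theta>) = dt T (dth f) (t, \<theta>)"
proof -
  have C: "C1_strip T f" "C1_strip T (dt T f)" "C1_strip T (dth f)"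
    using h by (auto simp: harmonic_strip_def C2_strip_def)
  have per: "dth f (t, \<theta> + 2 * pi) = dth f (t, \<theta>)" "dt T f (t, \<theta> + 2 * pi) = dt T f (t, \<theta>)"
    if "t \<in> {-T..T}" for t \<theta>
    using dth_sym(2)[OF sym C(1) that] dt_sym(2)[OF T sym C(1) that] by auto
  have per2: "dth (dt T f) (t, \<theta> + 2 * pi) = dth (dt T f) (t, \<theta>)" "dt T (dth f) (t, \<theta> + 2 * pi) = dt T (dth f) (t, \<theta>)" for \<theta>
  proof -
    show "dth (dt T f) (t, \<theta> + 2 * pi) = dth (dt T f) (t, \<theta>)"
    proof (rule dth_eqI[symmetric])
      have "((\<lambda>\<phi>. \<phi> + 2 * pi) has_vector_derivative 1) (at \<theta>)"
        by (auto intro!: derivative_eq_intros)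
      from vector_diff_chain_at[OF this C1_dth[OF C(2) t, of "\<theta> + 2 * pi"]]
      show "((\<lambda>\<phi>. dt T f (t, \<phi>)) has_vector_derivative dth (dt T f) (t, \<theta> + 2 * pi)) (at \<theta>)"
        by (simp add: o_def per[OF t])
    qed
    have "((\<lambda>s. dth f (s, \<theta> + 2 * pi)) has_vector_derivative dt T (dth f) (t, \<theta>)) (at t within {-T..T})"
      by (rule has_vector_derivative_transform[OF t _ C1_dt[OF C(3) t]]) (rule per(1))
    from dt_eqI[OF T t this] show "dt T (dth f) (t, \<theta> + 2 * pi) = dt T (dth f) (t, \<theta>)" .
  qed
  have cp: "cper (\<lambda>\<theta>. complex_of_real (dth (dt T f) (t, \<theta>)))" "cper (\<lambda>\<theta>. complex_of_real (dt T (dth f) (t, \<theta>)))"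
    using C t by (intro cper_slice[of T] per2; simp add: C1_strip_def)+
  have cp2: "cper (\<lambda>\<theta>. complex_of_real (f (t, \<theta>)))" "cper (\<lambda>\<theta>. complex_of_real (dt T f (t, \<theta>)))" "cper (\<lambda>\<theta>. complex_of_real (dth f (t, \<theta>)))"
    if "t \<in> {-T..T}" for t
    using C that by (intro cper_slice[of T] per mobius_shift(2)[OF sym]; simp add: C1_strip_def)+
  have "fc (\<lambda>\<theta>. of_real (dth (dt T f) (t, \<theta>))) k = fc (\<lambda>\<theta>. of_real (dt T (dth f) (t, \<theta>))) k" for k
  proof -
    have 1: "fc (\<lambda>\<theta>. of_real (dth (dt T f) (t, \<theta>))) k = \<i> * of_int k * fc (\<lambda>\<theta>. of_real (dt T f (t, \<theta>))) k"
      by (intro fc_deriv cp cp2 t has_vector_derivative_of_real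
          C1_dth[OF C(2), folded has_real_derivative_iff_has_vector_derivative])
    have 2: "fc (\<lambda>\<theta>. of_real (dth f (s, \<theta>))) k = \<i> * of_int k * fc (\<lambda>\<theta>. of_real (f (s, \<theta>))) k" if "s \<in> {-T..T}" for s
      by (intro fc_deriv cp2 that has_vector_derivative_of_real
          C1_dth[OF C(1), folded has_real_derivative_iff_has_vector_derivative])
    have "((\<lambda>s. \<i> * of_int k * fc (\<lambda>\<theta>. of_real (f (s, \<theta>))) k) has_vector_derivative
        \<i> * of_int k * fc (\<lambda>\<theta>. of_real (dt T f (t, \<theta>))) k) (at t within {-T..T})"
      by (intro has_vector_derivative_mult_right fc_slice_deriv C t)
    then have 3: "((\<lambda>s. fc (\<lambda>\<theta>. of_real (dth f (s, \<theta>))) k) has_vector_derivative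
        \<i> * of_int k * fc (\<lambda>\<theta>. of_real (dt T f (t, \<theta>))) k) (at t within {-T..T})"
      by (rule has_vector_derivative_transform[OF t, rotated]) (rule 2)
    have "\<i> * of_int k * fc (\<lambda>\<theta>. of_real (dt T f (t, \<theta>))) k = fc (\<lambda>\<theta>. of_real (dt T (dth f) (t, \<theta>))) k"
      using vector_derivative_unique_within_closed_interval[of "-T" T t, OF _ _ 3[folded box_real] fc_slice_deriv[OF C(3) t, of k, folded box_real]]
        T t by simp
    then show ?thesis using 1 by simp
  qed
  from fc_unique[OF cp this] show ?thesis
    by (metis of_real_eq_iff)
qed

lemma periodic_integral_deriv_zero:
  fixes f :: "real \<Rightarrow> real"
  assumes "\<And>x. (f has_real_derivative f' x) (at x)" "f (2 * pi) = f 0"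
  shows "(f' has_integral 0) {0..2 * pi}"
proof -
  have "(f' has_integral (f (2 * pi) - f 0)) {0..2 * pi}"
    by (rule fundamental_theorem_of_calculus)
       (auto intro: has_vector_derivative_at_within assms(1)[unfolded has_real_derivative_iff_has_vector_derivative])
  then show ?thesis using assms(2) by simp
qed

lemma cper_slice_real:
  fixes f :: "real \<times> real \<Rightarrow> real"
  assumes "continuous_on (strip T) f" "t \<in> {-T..T}" "\<And>\<theta>. f (t, \<theta> + 2 * pi) = f (t, \<theta>)"
  shows "cper (\<lambda>\<theta>. f (t, \<theta>))"
  using assms by (intro cperI continuous_strip_slice) auto

text \<open>Differentiate under the integral, replace the second \<open>t\<close> derivative by
  minus the second angular one, and integrate by parts over the circle without boundary terms. The
  oddness in the second claim comes from the sign of \<open>dt\<close> under the involution.\<close>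

lemma green_strip:
  fixes f :: "real \<times> real \<Rightarrow> real"
  assumes T: "T > 0" and sym: "mobius_sym T f" and h: "harmonic_strip T f" and t: "t \<in> {-T..T}"
  shows "((\<lambda>t. integral {0..2 * pi} (\<lambda>\<theta>. f (t, \<theta>) * dt T f (t, \<theta>))) has_vector_derivative
      integral {0..2 * pi} (\<lambda>\<theta>. (dt T f (t, \<theta>))\<^sup>2 + (dth f (t, \<theta>))\<^sup>2)) (at t within {-T..T})"
    and "integral {0..2 * pi} (\<lambda>\<theta>. f (- t, \<theta>) * dt T f (- t, \<theta>)) = - integral {0..2 * pi} (\<lambda>\<theta>. f (t, \<theta>) * dt T f (t, \<theta>))"
    and "cper (\<lambda>\<theta>. (dt T f (t, \<theta>))\<^sup>2 + (dth f (t, \<theta>))\<^sup>2)"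
proof -
  have C: "C1_strip T f" "C1_strip T (dt T f)" "C1_strip T (dth f)"
    using h by (auto simp: harmonic_strip_def C2_strip_def)
  then have cont: "continuous_on (strip T) f" "continuous_on (strip T) (dt T f)" "continuous_on (strip T) (dth f)"
      "continuous_on (strip T) (dt T (dt T f))" "continuous_on (strip T) (dth (dth f))"
    by (auto simp: C1_strip_def)
  have cp: "cper (\<lambda>\<theta>. f (t, \<theta>))" "cper (\<lambda>\<theta>. dt T f (t, \<theta>))" "cper (\<lambda>\<theta>. dth f (t, \<theta>))"
    by (intro cper_slice_real[OF _ t] cont mobius_shift(2)[OF sym t] dt_sym(2)[OF T sym C(1) t] dth_sym(2)[OF sym C(1) t])+
  show cpD: "cper (\<lambda>\<theta>. (dt T f (t, \<theta>))\<^sup>2 + (dth f (t, \<theta>))\<^sup>2)"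
    unfolding power2_eq_square by (intro cper_add cper_mult cp)
  show "integral {0..2 * pi} (\<lambda>\<theta>. f (- t, \<theta>) * dt T f (- t, \<theta>)) = - integral {0..2 * pi} (\<lambda>\<theta>. f (t, \<theta>) * dt T f (t, \<theta>))"
  proof -
    have cF: "cper (\<lambda>\<theta>. f (t, \<theta>) * dt T f (t, \<theta>))" by (intro cper_mult cp)
    have cF': "cper (\<lambda>\<theta>. f (t, \<theta> + pi) * dt T f (t, \<theta> + pi))"
    proof (rule cperI)
      show "continuous_on UNIV (\<lambda>\<theta>. f (t, \<theta> + pi) * dt T f (t, \<theta> + pi))"
        by (rule continuous_on_compose2[OF cper_cont[OF cF, of UNIV]]) (auto intro: continuous_intros)
      show "f (t, x + 2 * pi + pi) * dt T f (t, x + 2 * pi + pi) = f (t, x + pi) * dt T f (t, x + pi)" for x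
        using cper_shift[OF cF, of "x + pi"] by (simp add: algebra_simps)
    qed
    have "complex_of_real (integral {0..2 * pi} (\<lambda>\<theta>. f (t, \<theta> + pi) * dt T f (t, \<theta> + pi)))
        = of_real (integral {0..2 * pi} (\<lambda>\<theta>. f (t, \<theta>) * dt T f (t, \<theta>)))"
      using integral_shift_pi[OF cper_of_real[OF cF]] integral_cr[OF cF] integral_cr[OF cF'] by simp
    then have "integral {0..2 * pi} (\<lambda>\<theta>. f (t, \<theta> + pi) * dt T f (t, \<theta> + pi))
        = integral {0..2 * pi} (\<lambda>\<theta>. f (t, \<theta>) * dt T f (t, \<theta>))"
      by (simp only: of_real_eq_iff)
    then show ?thesis
      by (simp add: mobius_shift(1)[OF sym t] dt_sym(1)[OF T sym C(1) t])
  qed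
  have lap: "dt T (dt T f) (t, \<theta>) = - dth (dth f) (t, \<theta>)" for \<theta>
    using h t unfolding harmonic_strip_def by (auto simp: add_eq_0_iff2 dest!: bspec[of _ _ "(t, \<theta>)"])
  have "((\<lambda>t. integral (cbox 0 (2 * pi)) (\<lambda>\<theta>. f (t, \<theta>) * dt T f (t, \<theta>))) has_vector_derivative
      integral (cbox 0 (2 * pi)) (\<lambda>\<theta>. f (t, \<theta>) * dt T (dt T f) (t, \<theta>) + dt T f (t, \<theta>) * dt T f (t, \<theta>))) (at t within {-T..T})"
  proof (rule leibniz_rule_vector_derivative[where fx = "\<lambda>t \<theta>. f (t, \<theta>) * dt T (dt T f) (t, \<theta>) + dt T f (t, \<theta>) * dt T f (t, \<theta>)"])
    show "((\<lambda>t. f (t, \<theta>) * dt T f (t, \<theta>)) has_vector_derivative f (t, \<theta>) * dt T (dt T f) (t, \<theta>) + dt T f (t, \<theta>) * dt T f (t, \<theta>))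
        (at t within {-T..T})" if "t \<in> {-T..T}" for t \<theta>
      by (rule has_vector_derivative_mult[OF C1_dt[OF C(1) that] C1_dt[OF C(2) that]])
    show "(\<lambda>\<theta>. f (t, \<theta>) * dt T f (t, \<theta>)) integrable_on cbox 0 (2 * pi)" if "t \<in> {-T..T}" for t
      by (rule integrable_continuous)
         (intro continuous_intros continuous_on_subset[OF continuous_strip_slice[OF _ that]] cont; simp)
    have "continuous_on ({-T..T} \<times> cbox 0 (2 * pi)) (\<lambda>p. f p * dt T (dt T f) p + dt T f p * dt T f p)"
      by (intro continuous_intros continuous_on_subset[OF cont(1)] continuous_on_subset[OF cont(2)]
          continuous_on_subset[OF cont(4)]) (auto simp: strip_def)
    then show "continuous_on ({-T..T} \<times> cbox 0 (2 * pi)) (\<lambda>(t, \<theta>). f (t, \<theta>) * dt T (dt T f) (t, \<theta>) + dt T f (t, \<theta>) * dt T f (t, \<theta>))"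
      by (simp add: case_prod_unfold)
  qed (use t in auto)
  moreover have "integral {0..2 * pi} (\<lambda>\<theta>. f (t, \<theta>) * dt T (dt T f) (t, \<theta>) + dt T f (t, \<theta>) * dt T f (t, \<theta>))
      = integral {0..2 * pi} (\<lambda>\<theta>. (dt T f (t, \<theta>))\<^sup>2 + (dth f (t, \<theta>))\<^sup>2)"
  proof -
    have "((\<lambda>\<theta>. f (t, \<theta>) * dth (dth f) (t, \<theta>) + dth f (t, \<theta>) * dth f (t, \<theta>)) has_integral 0) {0..2 * pi}"
    proof (rule periodic_integral_deriv_zero)
      show "((\<lambda>\<theta>. f (t, \<theta>) * dth f (t, \<theta>)) has_real_derivative
          f (t, \<theta>) * dth (dth f) (t, \<theta>) + dth f (t, \<theta>) * dth f (t, \<theta>)) (at \<theta>)" for \<theta>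
        unfolding has_real_derivative_iff_has_vector_derivative
        by (rule has_vector_derivative_mult[OF C1_dth[OF C(1) t] C1_dth[OF C(3) t]])
      show "f (t, 2 * pi) * dth f (t, 2 * pi) = f (t, 0) * dth f (t, 0)"
        using cper_shift[OF cper_mult[OF cp(1) cp(3)], of 0] by simp
    qed
    from has_integral_diff[OF integrable_integral[OF cper_integrable[OF cpD]] this]
    show ?thesis by (intro integral_unique) (simp add: lap power2_eq_square algebra_simps)
  qed
  ultimately show "((\<lambda>t. integral {0..2 * pi} (\<lambda>\<theta>. f (t, \<theta>) * dt T f (t, \<theta>))) has_vector_derivative
      integral {0..2 * pi} (\<lambda>\<theta>. (dt T f (t, \<theta>))\<^sup>2 + (dth f (t, \<theta>))\<^sup>2)) (at t within {-T..T})"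
    by simp
qed

section \<open>Boundary data of a free boundary band and their regularity\<close>

locale fb_mobius =
  fixes u :: "real \<times> real \<Rightarrow> real ^ 'n" and T :: real
  assumes fb: "fb_minimal_mobius T u"
begin

lemma T: "T > 0" and sym: "mobius_sym T u" and harm: "harmonic_strip T u"
  and imm: "p \<in> strip T \<Longrightarrow> dt T u p \<noteq> 0"
  and conf: "p \<in> strip T \<Longrightarrow> norm (dt T u p) = norm (dth u p)" "p \<in> strip T \<Longrightarrow> inner (dt T u p) (dth u p) = 0"
  and bdry: "norm (u (T, \<theta>)) = 1" "dt T u (T, \<theta>) = norm (dt T u (T, \<theta>)) *\<^sub>R u (T, \<theta>)"
  using fb unfolding fb_minimal_mobius_def by auto

lemma TT: "T \<in> {-T..T}"
  using T by auto

lemma C: "C1_strip T u" "C1_strip T (dt T u)" "C1_strip T (dth u)"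
  using harm by (auto simp: harmonic_strip_def C2_strip_def)

lemma blin: "bounded_linear (\<lambda>v :: real ^ 'n. v $ i)" "bounded_linear (\<lambda>v :: real ^ 'n. inner w v)"
  by (rule bounded_linear_vec_nth) (rule bounded_linear_inner_right)

lemma u_comp: "harmonic_strip T (\<lambda>p. u p $ i)" "mobius_sym T (\<lambda>p. u p $ i)" "C1_strip T (\<lambda>p. u p $ i)"
    "p \<in> strip T \<Longrightarrow> dt T (\<lambda>p. u p $ i) p = dt T u p $ i" "p \<in> strip T \<Longrightarrow> dth (\<lambda>p. u p $ i) p = dth u p $ i"
  using harmonic_strip_linear[OF T blin(1) harm] mobius_sym_comp[OF sym, of "\<lambda>v. v $ i"] C1_strip_linear[OF T blin(1) C(1)]
  by auto

lemma u_inner: "harmonic_strip T (\<lambda>p. inner w (u p))" "mobius_sym T (\<lambda>p. inner w (u p))" "C1_strip T (\<lambda>p. inner w (u p))"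
    "p \<in> strip T \<Longrightarrow> dt T (\<lambda>p. inner w (u p)) p = inner w (dt T u p)" "p \<in> strip T \<Longrightarrow> dth (\<lambda>p. inner w (u p)) p = inner w (dth u p)"
  using harmonic_strip_linear[OF T blin(2) harm] mobius_sym_comp[OF sym, of "\<lambda>v. inner w v"] C1_strip_linear[OF T blin(2) C(1)]
  by auto

definition h :: "'n \<Rightarrow> real \<Rightarrow> real" where
  "h i \<theta> = u (T, \<theta>) $ i"

definition lam :: "real \<Rightarrow> real" where
  "lam \<theta> = norm (dt T u (T, \<theta>))"

lemma lam_pos: "lam \<theta> > 0"
  using imm[of "(T, \<theta>)"] TT by (simp add: lam_def)

lemma dt_u_T: "dt T u (T, \<theta>) $ i = lam \<theta> * h i \<theta>"
  using arg_cong[OF bdry(2)[of \<theta>], of "\<lambda>v. v $ i"] by (simp add: lam_def h_def)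

lemma sum_h_sq: "(\<Sum>i\<in>UNIV. (h i \<theta>)\<^sup>2) = 1"
proof -
  have "inner (u (T, \<theta>)) (u (T, \<theta>)) = 1" using bdry(1)[of \<theta>] by (simp add: dot_square_norm)
  then show ?thesis by (simp add: inner_vec_def h_def power2_eq_square)
qed

lemma h_cper: "cper (h i)"
  unfolding h_def[abs_def] using cper_slice_real[OF _ TT, of "\<lambda>p. u p $ i"] u_comp(2,3)[of i] mobius_shift(2)[OF u_comp(2) TT]
  by (simp add: C1_strip_def)

lemma lam_h_cper: "cper (\<lambda>\<theta>. lam \<theta> * h i \<theta>)"
proof -
  have "cper (\<lambda>\<theta>. dt T (\<lambda>p. u p $ i) (T, \<theta>))"
    using cper_slice_real[OF _ TT, of "dt T (\<lambda>p. u p $ i)"] u_comp(3)[of i] dt_sym(2)[OF T u_comp(2,3) TT] by (simp add: C1_strip_def)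
  moreover have "dt T (\<lambda>p. u p $ i) (T, \<theta>) = lam \<theta> * h i \<theta>" for \<theta>
    using u_comp(4)[of "(T, \<theta>)" i] TT dt_u_T by simp
  ultimately show ?thesis by simp
qed

lemma lam_cper: "cper lam"
proof -
  have "lam \<theta> = (\<Sum>i\<in>UNIV. h i \<theta> * (lam \<theta> * h i \<theta>))" for \<theta>
    using sum_h_sq[of \<theta>] by (simp add: power2_eq_square sum_distrib_left[symmetric] mult.left_commute)
  then have "lam = (\<lambda>\<theta>. \<Sum>i\<in>UNIV. h i \<theta> * (lam \<theta> * h i \<theta>))" by auto
  moreover have "cper (\<lambda>\<theta>. \<Sum>i\<in>UNIV. h i \<theta> * (lam \<theta> * h i \<theta>))"
    by (intro cper_sum cper_mult[OF h_cper lam_h_cper])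
  ultimately show ?thesis by simp
qed

text \<open>This is the free boundary condition: each coordinate is a Steklov eigenfunction with
  eigenvalue 1 for the density \<open>lam\<close>.\<close>

lemma fc_lam_h: "fc (cr (\<lambda>\<theta>. lam \<theta> * h i \<theta>)) k = of_real (mu T k) * fc (cr (h i)) k"
proof -
  have "dt T (\<lambda>p. u p $ i) (T, \<theta>) = lam \<theta> * h i \<theta>" for \<theta>
    using u_comp(4)[of "(T, \<theta>)" i] TT dt_u_T by simp
  then show ?thesis
    using harmonic_dtn[OF T u_comp(2,1), of i k] by (simp add: h_def)
qed

definition h1 :: "'n \<Rightarrow> real \<Rightarrow> real" where
  "h1 i \<theta> = dth u (T, \<theta>) $ i"

lemma wiener_1_h: "wiener 1 (cr (h i))" and h_deriv: "(h i has_real_derivative h1 i \<theta>) (at \<theta>)"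
  and h1_cper: "cper (h1 i)"
proof -
  have CC: "C1_strip T (\<lambda>p. dth u p $ i)" "\<And>p. p \<in> strip T \<Longrightarrow> dth (\<lambda>p. dth u p $ i) p = dth (dth u) p $ i"
    using C1_strip_linear[OF T blin(1) C(3)] by auto
  have d1: "((\<lambda>\<theta>. u (T, \<theta>) $ i) has_vector_derivative dth u (T, \<theta>) $ i) (at \<theta>)" for \<theta>
    by (rule bounded_linear.has_vector_derivative[OF blin(1) C1_dth[OF C(1) TT]])
  have d2: "((\<lambda>\<theta>. dth u (T, \<theta>) $ i) has_vector_derivative dth (dth u) (T, \<theta>) $ i) (at \<theta>)" for \<theta>
    by (rule bounded_linear.has_vector_derivative[OF blin(1) C1_dth[OF C(3) TT]])
  show hd: "(h i has_real_derivative h1 i \<theta>) (at \<theta>)" for \<theta>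
    using d1 by (simp add: h_def[abs_def] h1_def has_real_derivative_iff_has_vector_derivative)
  have p1: "dth u (T, \<theta> + 2 * pi) = dth u (T, \<theta>)" for \<theta> by (rule dth_sym(2)[OF sym C(1) TT])
  show c1: "cper (h1 i)"
    unfolding h1_def[abs_def] using cper_slice_real[OF _ TT, of "\<lambda>p. dth u p $ i"] CC(1) p1 by (simp add: C1_strip_def)
  have p2: "dth (dth u) (T, \<theta> + 2 * pi) $ i = dth (dth u) (T, \<theta>) $ i" for \<theta>
  proof -
    have "((\<lambda>\<phi>. \<phi> + 2 * pi) has_vector_derivative 1) (at \<theta>)"
      by (auto intro!: derivative_eq_intros)
    from vector_diff_chain_at[OF this d2[of "\<theta> + 2 * pi"]]
    have "((\<lambda>\<phi>. dth u (T, \<phi>) $ i) has_vector_derivative dth (dth u) (T, \<theta> + 2 * pi) $ i) (at \<theta>)"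
      by (simp add: o_def p1)
    from vector_derivative_unique_at[OF this d2] show ?thesis .
  qed
  have "continuous_on (strip T) (\<lambda>p. dth (dth u) p $ i)"
    using C(3) by (auto simp: C1_strip_def intro!: continuous_intros)
  then have c2: "cper (\<lambda>\<theta>. dth (dth u) (T, \<theta>) $ i)"
    using cper_slice_real[OF _ TT, of "\<lambda>p. dth (dth u) p $ i"] p2 by simp
  show "wiener 1 (cr (h i))"
  proof (rule wiener_1_C2)
    show "cper (cr (h i))" "cper (cr (h1 i))" "cper (cr (\<lambda>\<theta>. dth (dth u) (T, \<theta>) $ i))"
      by (intro cper_of_real h_cper c1 c2)+
    show "(cr (h i) has_vector_derivative cr (h1 i) x) (at x)" for x
      by (intro has_vector_derivative_of_real hd)
    show "(cr (h1 i) has_vector_derivative cr (\<lambda>\<theta>. dth (dth u) (T, \<theta>) $ i) x) (at x)" for x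
      using d2 by (intro has_vector_derivative_of_real) (simp add: h1_def[abs_def] has_real_derivative_iff_has_vector_derivative)
  qed
qed

lemma sum_h_h1: "(\<Sum>i\<in>UNIV. h i \<theta> * h1 i \<theta>) = 0"
proof -
  have "((\<lambda>\<theta>. \<Sum>i\<in>UNIV. (h i \<theta>)\<^sup>2) has_real_derivative (\<Sum>i\<in>UNIV. 2 * (h i \<theta> * h1 i \<theta>))) (at \<theta>)"
    by (auto intro!: derivative_eq_intros h_deriv sum.cong)
  moreover have "((\<lambda>\<theta>. \<Sum>i\<in>UNIV. (h i \<theta>)\<^sup>2) has_real_derivative 0) (at \<theta>)"
    unfolding sum_h_sq by simp
  ultimately have "(\<Sum>i\<in>UNIV. 2 * (h i \<theta> * h1 i \<theta>)) = 0" by (rule DERIV_unique)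
  then show ?thesis by (simp add: sum_distrib_left[symmetric])
qed

text \<open>\<open>phi\<close> is the boundary value of the holomorphic field \<open>u\<^sub>t - i u\<^sub>\<theta>\<close>, so its negative
  Fourier coefficients decay fast. Since \<open>lam = h \<bullet> phi\<close> is real, it therefore inherits the full
  regularity of \<open>h\<close>, although \<open>phi\<close> is one derivative worse.\<close>

definition phi :: "'n \<Rightarrow> real \<Rightarrow> complex" where
  "phi i \<theta> = of_real (lam \<theta> * h i \<theta>) - \<i> * of_real (h1 i \<theta>)"

lemma phi_cper: "cper (phi i)"
  unfolding phi_def[abs_def] by (intro cper_diff cper_mult[OF cper_const] cper_of_real lam_h_cper h1_cper)

lemma fc_phi: "fc (phi i) k = (of_real (mu T k + of_int k)) * fc (cr (h i)) k"
proof -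
  have "fc (cr (h1 i)) k = \<i> * of_int k * fc (cr (h i)) k"
    by (intro fc_deriv cper_of_real h_cper h1_cper has_vector_derivative_of_real h_deriv)
  then show ?thesis
    unfolding phi_def[abs_def]
    by (subst fc_diff) (auto intro!: cper_mult[OF cper_const] cper_of_real lam_h_cper h1_cper
        simp: fc_cmult fc_lam_h algebra_simps simp del: of_real_mult)
qed

lemma sum_h_phi: "(\<Sum>i\<in>UNIV. cr (h i) \<theta> * phi i \<theta>) = of_real (lam \<theta>)"
proof -
  have "(\<Sum>i\<in>UNIV. cr (h i) \<theta> * phi i \<theta>)
      = of_real (lam \<theta> * (\<Sum>i\<in>UNIV. (h i \<theta>)\<^sup>2)) - \<i> * of_real (\<Sum>i\<in>UNIV. h i \<theta> * h1 i \<theta>)"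
    unfolding phi_def of_real_mult of_real_sum sum_distrib_left sum_subtractf[symmetric]
    by (intro sum.cong refl) (simp add: algebra_simps power2_eq_square)
  then show ?thesis by (simp add: sum_h_sq sum_h_h1)
qed

lemma lam_regular:
  assumes s: "s \<ge> 1" and hw: "\<And>i. wiener s (cr (h i))"
  shows "wiener s (cr lam)"
proof -
  have h1w: "\<And>i. wsum 1 (fc (cr (h i)))" using wiener_1_h by (simp add: wiener_def)
  obtain C where Cb: "\<And>k. k < 0 \<Longrightarrow> wt s k * \<bar>mu T k + of_int k\<bar> \<le> C"
    using mu_decay[OF T, of s] by blast
  have "\<exists>X. X summable_on UNIV \<and> (\<forall>m. X m \<ge> (0::real)) \<and>
      (\<forall>m\<le>0. wt s m * norm (fc (\<lambda>x. cr (h i) x * phi i x) m) \<le> X m)" for i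
  proof -
    define D where "D = 1 / cT T + 1"
    have D: "D \<ge> 0" using cT_pos[OF T] by (simp add: D_def)
    have phi_le: "norm (fc (phi i) k) \<le> D * (wt 1 k * norm (fc (cr (h i)) k))" for k
    proof -
      have "\<bar>mu T k + of_int k\<bar> \<le> mu T k + \<bar>of_int k\<bar>" using mu_nonneg[OF T, of k] by linarith
      also have "\<dots> \<le> \<bar>of_int k\<bar> / cT T + \<bar>of_int k\<bar>" using mu_upper[OF T, of k] by simp
      also have "\<dots> = D * \<bar>of_int k\<bar>" by (simp add: D_def algebra_simps)
      also have "\<dots> \<le> D * wt 1 k" using D by (intro mult_left_mono) (auto simp: wt_def)
      finally show ?thesis
        unfolding fc_phi norm_mult norm_of_real by (simp add: mult.assoc[symmetric] mult_right_mono)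
    qed
    have ws: "(\<lambda>k. wt 1 k * norm (fc (cr (h i)) k)) summable_on UNIV" using h1w by (simp add: wsum_def)
    have as: "asum (fc (phi i))"
      by (rule summable_on_comparison_test[OF summable_on_cmult_right[OF ws] phi_le]) auto
    have hs: "asum (fc (cr (h i)))" using wsum_abs[OF h1w] .
    \<comment> \<open>For \<open>k < 0\<close> the decay of \<open>mu T k + k\<close> pays for the
      weight; for \<open>k \<ge> 0\<close> no weight is asked, so the regularity known at the start
      is enough.\<close>
    have neg: "(\<lambda>k. (if k < 0 then wt s k else 1) * norm (fc (phi i) k)) summable_on UNIV"
    proof (rule summable_on_comparison_test)
      show "(\<lambda>k. \<bar>C\<bar> * norm (fc (cr (h i)) k) * (if k < 0 then 1 else 0) + norm (fc (phi i) k)) summable_on UNIV"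
      proof (intro summable_on_add as)
        show "(\<lambda>k. \<bar>C\<bar> * norm (fc (cr (h i)) k) * (if k < 0 then 1 else 0)) summable_on UNIV"
          by (rule summable_on_comparison_test[OF summable_on_cmult_right[OF hs, of "\<bar>C\<bar>"]]) auto
      qed
      show "(if k < 0 then wt s k else 1) * norm (fc (phi i) k)
          \<le> \<bar>C\<bar> * norm (fc (cr (h i)) k) * (if k < 0 then 1 else 0) + norm (fc (phi i) k)" for k
      proof (cases "k < 0")
        case True
        have "wt s k * norm (fc (phi i) k) = (wt s k * \<bar>mu T k + of_int k\<bar>) * norm (fc (cr (h i)) k)"
          unfolding fc_phi norm_mult norm_of_real by simp
        also have "\<dots> \<le> \<bar>C\<bar> * norm (fc (cr (h i)) k)"
          using Cb[OF True] by (intro mult_right_mono) auto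
        finally show ?thesis using True by (simp add: add_increasing2)
      qed simp
    qed auto
    from commutator_bound[OF hw phi_cper as neg] show ?thesis by metis
  qed
  then obtain X where X: "\<And>i. X i summable_on UNIV" "\<And>i m. X i m \<ge> (0::real)"
      "\<And>i m. m \<le> 0 \<Longrightarrow> wt s m * norm (fc (\<lambda>x. cr (h i) x * phi i x) m) \<le> X i m" by metis
  show ?thesis
  proof (rule wiener_real_from_neg[OF lam_cper])
    show "(\<lambda>m. \<Sum>i\<in>UNIV. X i m) summable_on UNIV" by (rule summable_on_finite_sum) (auto intro: X)
    show "(\<Sum>i\<in>UNIV. X i m) \<ge> 0" for m by (intro sum_nonneg X)
    fix m :: int assume m: "m \<le> 0"
    have "fc (cr lam) m = (\<Sum>i\<in>UNIV. fc (\<lambda>x. cr (h i) x * phi i x) m)"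
      unfolding sum_h_phi[symmetric]
      by (rule fc_sum) (auto intro!: cper_mult cper_of_real h_cper phi_cper)
    then have "wt s m * norm (fc (cr lam) m) \<le> wt s m * (\<Sum>i\<in>UNIV. norm (fc (\<lambda>x. cr (h i) x * phi i x) m))"
      by (intro mult_left_mono) (auto intro: norm_sum)
    also have "\<dots> \<le> (\<Sum>i\<in>UNIV. X i m)"
      unfolding sum_distrib_left by (intro sum_mono X(3) m)
    finally show "wt s m * norm (fc (cr lam) m) \<le> (\<Sum>i\<in>UNIV. X i m)" .
  qed
qed

text \<open>\<open>lam\<close> inherits the regularity of \<open>h\<close>, so the product
  \<open>lam h\<close> has it too; inverting the multiplier in \<open>Lam h = lam h\<close> gains
  one order.\<close>

lemma h_regular_step:
  assumes "s \<ge> 1" "\<And>i. wiener s (cr (h i))"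
  shows "wiener (Suc s) (cr (h i))"
proof -
  have "wiener s (\<lambda>x. cr lam x * cr (h i) x)" by (intro wiener_mult lam_regular assms)
  then have "wsum s (fc (cr (\<lambda>\<theta>. lam \<theta> * h i \<theta>)))" by (simp add: wiener_def)
  then have "wsum s (\<lambda>k. of_real (mu T k) * fc (cr (h i)) k)"
    by (simp add: wsum_def fc_lam_h del: of_real_mult)
  then show ?thesis using wsum_of_mu[OF T] by (simp add: wiener_def cper_of_real h_cper)
qed

text \<open>Two rounds give what the test fields use: \<open>1 / lam\<close> of class C2, and
  \<open>h1\<close> and \<open>lam\<close> differentiable within the scale.\<close>

lemma h_wiener: "wiener 3 (cr (h i))" and lam_wiener: "wiener 2 (cr lam)"
proof -
  have 2: "wiener 2 (cr (h i))" for i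
    using h_regular_step[of 1 i] wiener_1_h by (simp add: numeral_2_eq_2)
  show "wiener 3 (cr (h i))"
    using h_regular_step[of 2 i] 2 by (simp add: numeral_3_eq_3 numeral_2_eq_2)
  show "wiener 2 (cr lam)" using lam_regular[of 2] 2 by simp
qed

end

section \<open>A strict area inequality\<close>

context fb_mobius
begin

lemma mixed_u:
  assumes p: "p \<in> strip T"
  shows "dth (dt T u) p = dt T (dth u) p"
proof -
  have "dth (dt T u) p $ i = dt T (dth u) p $ i" for i
  proof -
    note L = C1_strip_linear[OF T blin(1)[of i] C(2)] C1_strip_linear[OF T blin(1)[of i] C(3)]
    have "dth (dt T (\<lambda>p. u p $ i)) p = dth (dt T u) p $ i"
      using C1_strip_cong(3)[OF T _ L(1), of "dt T (\<lambda>p. u p $ i)" p] L(3)[OF p] u_comp(4) p by simp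
    moreover have "dt T (dth (\<lambda>p. u p $ i)) p = dt T (dth u) p $ i"
      using C1_strip_cong(2)[OF T _ L(4), of "dth (\<lambda>p. u p $ i)" p] L(5)[OF p] u_comp(5) p by simp
    moreover have "dth (dt T (\<lambda>p. u p $ i)) p = dt T (dth (\<lambda>p. u p $ i)) p"
      using mixed_partials[OF T u_comp(2,1), of "fst p" i "snd p"] p by (cases p) simp
    ultimately show ?thesis by simp
  qed
  then show ?thesis by (simp add: vec_eq_iff)
qed

text \<open>The vector on the left is the square of \<open>norm a\<close> times the component of
  \<open>w\<close> normal to the conformal frame, so for a nonzero frame the right side is
  nonnegative and vanishes exactly when \<open>w\<close> is tangent.\<close>

lemma frame_projection:
  fixes a b w :: "'a::real_inner"
  assumes "inner a b = 0" "norm a = norm b"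
  shows "(norm ((norm a)\<^sup>2 *\<^sub>R w - inner w a *\<^sub>R a - inner w b *\<^sub>R b))\<^sup>2
      = (norm a)\<^sup>2 * ((norm w)\<^sup>2 * (norm a)\<^sup>2 - ((inner w a)\<^sup>2 + (inner w b)\<^sup>2))"
proof -
  define m where "m = (norm a)\<^sup>2"
  have aa: "inner a a = m" "inner b b = m" "inner b a = 0" "inner a w = inner w a" "inner b w = inner w b"
    using assms by (simp_all add: m_def power2_norm_eq_inner inner_commute norm_eq)
  show ?thesis
    unfolding m_def[symmetric] power2_norm_eq_inner
    by (simp add: inner_diff_left inner_diff_right aa assms(1) algebra_simps power2_eq_square)
qed

text \<open>If \<open>w\<close> were tangent to the surface everywhere, so would be its rotation by a right angle
  within the tangent planes; this rotation is a constant vector, yet it changes sign under the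
  orientation reversing involution.\<close>

lemma no_tangent_vector:
  assumes w: "w \<noteq> 0"
    and tan: "\<And>p. p \<in> strip T \<Longrightarrow> (norm w)\<^sup>2 * (norm (dt T u p))\<^sup>2 = (inner w (dt T u p))\<^sup>2 + (inner w (dth u p))\<^sup>2"
  shows False
proof -
  define x where "x p = inner w (dt T u p)" for p
  define y where "y p = inner w (dth u p)" for p
  define m where "m p = inner (dt T u p) (dt T u p)" for p
  have m: "m p = (norm (dt T u p))\<^sup>2" "m p > 0" if "p \<in> strip T" for p
    using imm[OF that] by (auto simp: m_def power2_norm_eq_inner)
  have xy: "(x p)\<^sup>2 + (y p)\<^sup>2 = (norm w)\<^sup>2 * m p" if "p \<in> strip T" for p
    using tan[OF that] m[OF that] by (simp add: x_def y_def)
  have dec: "m p *\<^sub>R w = x p *\<^sub>R dt T u p + y p *\<^sub>R dth u p" if "p \<in> strip T" for p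
    using frame_projection[OF conf(2)[OF that] conf(1)[OF that], of w] tan[OF that] m(1)[OF that]
    by (simp add: x_def y_def algebra_simps)
  have ab: "inner (dt T u p) (dth u p) = 0" "inner (dth u p) (dt T u p) = 0" "inner (dth u p) (dth u p) = m p" if "p \<in> strip T" for p
    using conf[OF that] by (auto simp: inner_commute m_def norm_eq)
  \<comment> \<open>\<open>v\<close> is \<open>w\<close> turned by a right angle in the tangent
    plane. It is followed only along the core circle \<open>t = 0\<close>, which the involution maps
    to itself.\<close>
  define v where "v \<theta> = (1 / m (0, \<theta>)) *\<^sub>R (- y (0, \<theta>) *\<^sub>R dt T u (0, \<theta>) + x (0, \<theta>) *\<^sub>R dth u (0, \<theta>))" for \<theta>
  have z: "(0, \<theta>) \<in> strip T" for \<theta> using T by simp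
  have zT: "0 \<in> {-T..T}" using T by simp
  have mv: "m (0, \<theta>) *\<^sub>R v \<theta> = - y (0, \<theta>) *\<^sub>R dt T u (0, \<theta>) + x (0, \<theta>) *\<^sub>R dth u (0, \<theta>)" for \<theta>
    using m(2)[OF z, of \<theta>] by (simp add: v_def)
  have vw: "inner w (v \<theta>) = 0" for \<theta>
    by (simp add: v_def inner_diff_right x_def y_def)
  have vv: "inner (v \<theta>) (v \<theta>) = (norm w)\<^sup>2" for \<theta>
  proof -
    have "inner (m (0, \<theta>) *\<^sub>R v \<theta>) (m (0, \<theta>) *\<^sub>R v \<theta>) = m (0, \<theta>) * ((x (0, \<theta>))\<^sup>2 + (y (0, \<theta>))\<^sup>2)"
      unfolding mv by (simp add: inner_add_left inner_add_right inner_diff_left inner_diff_right ab[OF z] m_def[symmetric] algebra_simps power2_eq_square)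
    then show ?thesis unfolding xy[OF z] using m(2)[OF z, of \<theta>] by simp
  qed
  have d\<theta>: "((\<lambda>\<phi>. dt T u (0, \<phi>)) has_vector_derivative dth (dt T u) (0, \<theta>)) (at \<theta>)"
      "((\<lambda>\<phi>. dth u (0, \<phi>)) has_vector_derivative dth (dth u) (0, \<theta>)) (at \<theta>)" for \<theta>
    using C1_dth[OF C(2) zT] C1_dth[OF C(3) zT] by auto
  have lap: "dth (dth u) p = - dt T (dt T u) p" if "p \<in> strip T" for p
  proof -
    have "dt T (dt T u) p + dth (dth u) p = 0" using harm that by (simp add: harmonic_strip_def)
    then show ?thesis by (simp only: add_eq_0_iff)
  qed
  have ip: "((\<lambda>\<phi>. inner e (f \<phi>)) has_real_derivative inner e f') (at \<theta> within S)"
    if "(f has_vector_derivative f') (at \<theta> within S)" for e :: "real ^ 'n" and f f' \<theta> S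
    using bounded_linear.has_vector_derivative[OF blin(2) that] by (simp add: has_real_derivative_iff_has_vector_derivative)
  have "(v has_vector_derivative 0) (at \<theta>)" for \<theta>
  proof -
    define A where "A = dt T (dt T u) (0, \<theta>)"
    define B where "B = dth (dt T u) (0, \<theta>)"
    note dx = ip[OF d\<theta>(1), of w \<theta>, folded x_def] and dy = ip[OF d\<theta>(2), of w \<theta>, folded y_def]
    have "((\<lambda>\<phi>. inner (dt T u (0, \<phi>)) (dt T u (0, \<phi>))) has_vector_derivative
        inner (dt T u (0, \<theta>)) (dth (dt T u) (0, \<theta>)) + inner (dth (dt T u) (0, \<theta>)) (dt T u (0, \<theta>))) (at \<theta>)"
      by (rule bounded_bilinear.has_vector_derivative[OF bounded_bilinear_inner d\<theta>(1) d\<theta>(1)])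
    then obtain m' where dm: "((\<lambda>\<phi>. m (0, \<phi>)) has_real_derivative m') (at \<theta>)"
      by (auto simp: m_def[symmetric] has_real_derivative_iff_has_vector_derivative)
    have m0: "m (0, \<theta>) \<noteq> 0" using m(2)[OF z, of \<theta>] by simp
    have "\<exists>D. (v has_vector_derivative D) (at \<theta>)"
      unfolding v_def[abs_def]
      by (rule exI, rule has_vector_derivative_scaleR[OF DERIV_divide[OF DERIV_const dm m0]
          has_vector_derivative_add[OF has_vector_derivative_scaleR[OF DERIV_minus[OF dy] d\<theta>(1)]
            has_vector_derivative_scaleR[OF dx d\<theta>(2)]]])
    then obtain D where D: "(v has_vector_derivative D) (at \<theta>)" by blast
    have Dw: "inner w D = 0"
      using DERIV_unique[OF ip[OF D, of w]] vw by simp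
    have "((\<lambda>\<phi>. inner (v \<phi>) (v \<phi>)) has_vector_derivative inner (v \<theta>) D + inner D (v \<theta>)) (at \<theta>)"
      by (rule bounded_bilinear.has_vector_derivative[OF bounded_bilinear_inner D D])
    then have "((\<lambda>\<phi>. (norm w)\<^sup>2) has_real_derivative 2 * inner (v \<theta>) D) (at \<theta>)"
      by (simp add: vv has_real_derivative_iff_has_vector_derivative[symmetric] inner_commute)
    from DERIV_unique[OF this DERIV_const] have Dv: "inner (v \<theta>) D = 0" by simp
    \<comment> \<open>\<open>D\<close> is orthogonal to \<open>w\<close> and to
      \<open>v \<theta>\<close>, which span the tangent plane, so \<open>D\<close> is normal to the
      surface and \<open>a = b = 0\<close>.\<close>
    have W: "inner D (m (0, \<theta>) *\<^sub>R w) = 0" "inner D (m (0, \<theta>) *\<^sub>R v \<theta>) = 0"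
      using Dw Dv by (simp_all add: inner_commute)
    define a where "a = inner D (dt T u (0, \<theta>))"
    define b where "b = inner D (dth u (0, \<theta>))"
    have 1: "x (0, \<theta>) * a + y (0, \<theta>) * b = 0"
      using W(1) unfolding dec[OF z] by (simp add: a_def b_def inner_add_right)
    have 2: "- y (0, \<theta>) * a + x (0, \<theta>) * b = 0"
      using W(2) unfolding mv by (simp add: a_def b_def inner_add_right inner_diff_right)
    have pos: "(x (0, \<theta>))\<^sup>2 + (y (0, \<theta>))\<^sup>2 > 0"
      unfolding xy[OF z] using w m(2)[OF z, of \<theta>] by simp
    have "((x (0, \<theta>))\<^sup>2 + (y (0, \<theta>))\<^sup>2) * a = x (0, \<theta>) * (x (0, \<theta>) * a + y (0, \<theta>) * b) - y (0, \<theta>) * (- y (0, \<theta>) * a + x (0, \<theta>) * b)"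
      by (simp add: algebra_simps power2_eq_square)
    then have a0: "a = 0" using pos unfolding 1 2 by auto
    have "((x (0, \<theta>))\<^sup>2 + (y (0, \<theta>))\<^sup>2) * b = y (0, \<theta>) * (x (0, \<theta>) * a + y (0, \<theta>) * b) + x (0, \<theta>) * (- y (0, \<theta>) * a + x (0, \<theta>) * b)"
      by (simp add: algebra_simps power2_eq_square)
    then have b0: "b = 0" using pos unfolding 1 2 by auto
    have const0: "x p * inner D (dt T u p) + y p * inner D (dth u p) = 0" if "p \<in> strip T" for p
      using arg_cong[OF dec[OF that], of "inner D"] Dw by (simp add: inner_add_right inner_commute)
    have 3: "x (0, \<theta>) * inner D B - y (0, \<theta>) * inner D A = 0"
    proof -
      have "((\<lambda>\<phi>. x (0, \<phi>) * inner D (dt T u (0, \<phi>)) + y (0, \<phi>) * inner D (dth u (0, \<phi>))) has_real_derivative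
          (inner w B * a + inner D B * x (0, \<theta>)) + (inner w (dth (dth u) (0, \<theta>)) * b + inner D (dth (dth u) (0, \<theta>)) * y (0, \<theta>))) (at \<theta>)"
        unfolding B_def a_def b_def by (intro DERIV_add DERIV_mult dx dy ip d\<theta>)
      moreover have "((\<lambda>\<phi>. x (0, \<phi>) * inner D (dt T u (0, \<phi>)) + y (0, \<phi>) * inner D (dth u (0, \<phi>))) has_real_derivative 0) (at \<theta>)"
        using const0[OF z] by simp
      ultimately show ?thesis
        using DERIV_unique a0 b0 by (fastforce simp: lap[OF z] A_def[symmetric] mult.commute)
    qed
    \<comment> \<open>This differentiates \<open>const0\<close> in \<open>t\<close>, across the core
      circle; here tangency is needed off the circle and not only along it.\<close>
    have 4: "x (0, \<theta>) * inner D A + y (0, \<theta>) * inner D B = 0"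
    proof -
      note dA = C1_dt[OF C(2) zT, of \<theta>] and dB = C1_dt[OF C(3) zT, of \<theta>]
      have dB': "dt T (dth u) (0, \<theta>) = B" unfolding B_def by (rule mixed_u[OF z, symmetric])
      have "((\<lambda>t. x (t, \<theta>) * inner D (dt T u (t, \<theta>)) + y (t, \<theta>) * inner D (dth u (t, \<theta>))) has_real_derivative
          (inner w A * a + inner D A * x (0, \<theta>)) + (inner w B * b + inner D B * y (0, \<theta>))) (at 0 within {-T..T})"
        unfolding A_def a_def b_def x_def y_def dB'[symmetric] by (intro DERIV_add DERIV_mult ip dA dB)
      then have "((\<lambda>t. x (t, \<theta>) * inner D (dt T u (t, \<theta>)) + y (t, \<theta>) * inner D (dth u (t, \<theta>))) has_vector_derivative
          inner D A * x (0, \<theta>) + inner D B * y (0, \<theta>)) (at 0 within {-T..T})"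
        by (simp add: a0 b0 has_real_derivative_iff_has_vector_derivative)
      moreover have "((\<lambda>t. x (t, \<theta>) * inner D (dt T u (t, \<theta>)) + y (t, \<theta>) * inner D (dth u (t, \<theta>))) has_vector_derivative 0) (at 0 within {-T..T})"
        by (rule has_vector_derivative_transform[OF zT _ has_vector_derivative_const[of 0]]) (simp add: const0)
      ultimately have "inner D A * x (0, \<theta>) + inner D B * y (0, \<theta>) = 0"
        using vector_derivative_unique_within_closed_interval[of "-T" T 0] T by (simp add: box_real)
      then show ?thesis by (simp add: mult.commute)
    qed
    \<comment> \<open>Along the circle the derivative of \<open>m\<close> times the inner product of
      \<open>D\<close> and \<open>v\<close> is \<open>m\<close> times the squared length of
      \<open>D\<close>. Harmonicity turns its other expression into minus the quantity just shown to
      vanish.\<close>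
    have e1: "((\<lambda>\<phi>. m (0, \<phi>) * inner D (v \<phi>)) has_real_derivative m' * inner D (v \<theta>) + inner D D * m (0, \<theta>)) (at \<theta>)"
      by (intro DERIV_mult dm ip D)
    have e2: "(\<lambda>\<phi>. m (0, \<phi>) * inner D (v \<phi>)) = (\<lambda>\<phi>. x (0, \<phi>) * inner D (dth u (0, \<phi>)) - y (0, \<phi>) * inner D (dt T u (0, \<phi>)))"
    proof
      fix \<phi>
      show "m (0, \<phi>) * inner D (v \<phi>) = x (0, \<phi>) * inner D (dth u (0, \<phi>)) - y (0, \<phi>) * inner D (dt T u (0, \<phi>))"
        using arg_cong[OF mv[of \<phi>], of "inner D"] by (simp add: inner_add_right inner_diff_right)
    qed
    have e3: "((\<lambda>\<phi>. x (0, \<phi>) * inner D (dth u (0, \<phi>)) - y (0, \<phi>) * inner D (dt T u (0, \<phi>))) has_real_derivative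
        (inner w B * b + inner D (dth (dth u) (0, \<theta>)) * x (0, \<theta>)) - (inner w (dth (dth u) (0, \<theta>)) * a + inner D B * y (0, \<theta>))) (at \<theta>)"
      unfolding B_def a_def b_def by (intro DERIV_diff DERIV_mult dx dy ip d\<theta>)
    have "m' * inner D (v \<theta>) + inner D D * m (0, \<theta>)
        = (inner w B * b + inner D (dth (dth u) (0, \<theta>)) * x (0, \<theta>)) - (inner w (dth (dth u) (0, \<theta>)) * a + inner D B * y (0, \<theta>))"
      by (rule DERIV_unique[OF e1[unfolded e2] e3])
    then have "inner D D * m (0, \<theta>) = - (x (0, \<theta>) * inner D A + y (0, \<theta>) * inner D B)"
      using Dv a0 b0 by (simp add: lap[OF z] A_def[symmetric] inner_commute algebra_simps)
    then have "D = 0" using 4 m0 by simp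
    then show ?thesis using D by simp
  qed
  then obtain q where q: "\<And>\<theta>. v \<theta> = q"
    using has_vector_derivative_zero_constant[of UNIV v] by auto
  have "v pi = - v 0"
  proof -
    have "dt T u (0, pi) = - dt T u (0, 0)" "dth u (0, pi) = dth u (0, 0)"
      using dt_sym(1)[OF T sym C(1) zT, of 0] dth_sym(1)[OF sym C(1) zT, of 0] by auto
    then show ?thesis by (simp add: v_def x_def y_def m_def algebra_simps)
  qed
  then have "q = - q" using q by metis
  then have "q + q = 0" by (metis add.right_inverse)
  then have "2 *\<^sub>R q = 0" by (simp only: scaleR_2)
  then have "q = 0" by simp
  then show False using vv[of 0] q[of 0] w by simp
qed

abbreviation "II f \<equiv> integral {0..2 * pi} f"

lemma inner_u_T: "inner w (u (T, \<theta>)) = (\<Sum>i\<in>UNIV. w $ i * h i \<theta>)"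
  by (simp add: inner_vec_def h_def)

text \<open>Green's formula turns the difference of the two sides into the integral over the strip of
  \<open>\<bar>w\<bar>\<^sup>2 \<bar>\<nabla>u\<bar>\<^sup>2 - 2 \<bar>\<nabla>(w \<bullet> u)\<bar>\<^sup>2\<close>, which vanishes only where \<open>w\<close> is tangent.\<close>

theorem strict_area:
  assumes w: "w \<noteq> (0 :: real ^ 'n)"
  shows "2 * II (\<lambda>\<theta>. lam \<theta> * (\<Sum>i\<in>UNIV. w $ i * h i \<theta>)\<^sup>2) < (norm w)\<^sup>2 * II lam"
proof (rule ccontr)
  assume neg: "\<not> ?thesis"
  define om where "om p = inner w (u p)" for p
  define G where "G f t = II (\<lambda>\<theta>. f (t, \<theta>) * dt T f (t, \<theta>))" for f :: "real \<times> real \<Rightarrow> real" and t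
  define D where "D f t \<theta> = (dt T f (t, \<theta>))\<^sup>2 + (dth f (t, \<theta>))\<^sup>2" for f :: "real \<times> real \<Rightarrow> real" and t \<theta>
  define \<Phi> where "\<Phi> t = (norm w)\<^sup>2 * (\<Sum>i\<in>UNIV. G (\<lambda>p. u p $ i) t) - 2 * G om t" for t
  define E where "E t \<theta> = (norm w)\<^sup>2 * (\<Sum>i\<in>UNIV. D (\<lambda>p. u p $ i) t \<theta>) - 2 * D om t \<theta>" for t \<theta>
  note om = u_inner[where w = w, folded om_def]
  note gc = green_strip[OF T u_comp(2,1), folded D_def G_def]
  note go = green_strip[OF T om(2,1), folded D_def G_def]
  have Ecp: "cper (E t)" if "t \<in> {-T..T}" for t
    unfolding E_def[abs_def] by (intro cper_diff cper_mult[OF cper_const] cper_sum gc(3) go(3) that)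
  have Edec: "E t \<theta> = 2 * ((norm w)\<^sup>2 * (norm (dt T u (t, \<theta>)))\<^sup>2 - ((inner w (dt T u (t, \<theta>)))\<^sup>2 + (inner w (dth u (t, \<theta>)))\<^sup>2))"
    if t: "t \<in> {-T..T}" for t \<theta>
  proof -
    have p: "(t, \<theta>) \<in> strip T" using t by simp
    have "(\<Sum>i\<in>UNIV. D (\<lambda>p. u p $ i) t \<theta>) = inner (dt T u (t, \<theta>)) (dt T u (t, \<theta>)) + inner (dth u (t, \<theta>)) (dth u (t, \<theta>))"
      by (simp add: D_def u_comp(4,5)[OF p] inner_vec_def sum.distrib power2_eq_square)
    also have "\<dots> = 2 * (norm (dt T u (t, \<theta>)))\<^sup>2"
      using conf(1)[OF p] by (simp add: power2_norm_eq_inner[symmetric])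
    finally show ?thesis
      by (simp add: E_def) (simp add: D_def om(4,5)[OF p])
  qed
  have Epos: "E t \<theta> \<ge> 0" if t: "t \<in> {-T..T}" for t \<theta>
  proof -
    have p: "(t, \<theta>) \<in> strip T" using t by simp
    have "0 \<le> (norm (dt T u (t, \<theta>)))\<^sup>2 * ((norm w)\<^sup>2 * (norm (dt T u (t, \<theta>)))\<^sup>2 - ((inner w (dt T u (t, \<theta>)))\<^sup>2 + (inner w (dth u (t, \<theta>)))\<^sup>2))"
      using frame_projection[OF conf(2)[OF p] conf(1)[OF p], of w] by (metis zero_le_power2)
    then show ?thesis
      unfolding Edec[OF t] using imm[OF p] by (simp add: zero_le_mult_iff)
  qed
  have d\<Phi>: "(\<Phi> has_vector_derivative II (E t)) (at t within {-T..T})" if t: "t \<in> {-T..T}" for t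
  proof -
    have "(\<Phi> has_vector_derivative (norm w)\<^sup>2 * (\<Sum>i\<in>UNIV. II (D (\<lambda>p. u p $ i) t)) - 2 * II (D om t)) (at t within {-T..T})"
      unfolding \<Phi>_def[abs_def] 
      by (intro has_vector_derivative_diff has_vector_derivative_mult_right has_vector_derivative_sum)
         (use gc(1)[OF t] go(1)[OF t] in \<open>simp_all add: G_def[abs_def] D_def[abs_def]\<close>)
    moreover have "II (E t) = (norm w)\<^sup>2 * (\<Sum>i\<in>UNIV. II (D (\<lambda>p. u p $ i) t)) - 2 * II (D om t)"
    proof -
      have cD: "cper (D (\<lambda>p. u p $ i) t)" for i
        using green_strip(3)[OF T u_comp(2,1) t, of i] by (simp add: D_def[abs_def])
      have cDo: "cper (D om t)"
        using green_strip(3)[OF T om(2,1) t] by (simp add: D_def[abs_def])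
      have "II (E t) = II (\<lambda>\<theta>. (norm w)\<^sup>2 * (\<Sum>i\<in>UNIV. D (\<lambda>p. u p $ i) t \<theta>)) - II (\<lambda>\<theta>. 2 * D om t \<theta>)"
        unfolding E_def[abs_def]
        by (rule integral_diff) (intro cper_integrable cper_mult[OF cper_const] cper_sum cD cDo)+
      also have "\<dots> = (norm w)\<^sup>2 * II (\<lambda>\<theta>. \<Sum>i\<in>UNIV. D (\<lambda>p. u p $ i) t \<theta>) - 2 * II (D om t)"
        by (simp only: integral_mult_right)
      also have "II (\<lambda>\<theta>. \<Sum>i\<in>UNIV. D (\<lambda>p. u p $ i) t \<theta>) = (\<Sum>i\<in>UNIV. II (D (\<lambda>p. u p $ i) t))"
        by (rule integral_sum) (auto intro: cper_integrable cD)
      finally show ?thesis .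
    qed
    ultimately show ?thesis by simp
  qed
  have cont: "continuous_on {-T..T} \<Phi>"
    using d\<Phi> by (intro continuous_on_vector_derivative) blast
  have mono: "\<Phi> a \<le> \<Phi> b" if "- T \<le> a" "a \<le> b" "b \<le> T" for a b
  proof (rule DERIV_nonneg_imp_increasing_open[OF that(2)])
    fix x assume x: "a < x" "x < b"
    then have xT: "x \<in> {-T..T}" using that by auto
    have "(\<Phi> has_real_derivative II (E x)) (at x)"
      using d\<Phi>[OF xT] x that at_within_Icc_at[of "-T" x T] by (simp add: has_real_derivative_iff_has_vector_derivative)
    moreover have "II (E x) \<ge> 0" by (intro integral_nonneg cper_integrable Ecp xT) (rule Epos[OF xT])
    ultimately show "\<exists>y. (\<Phi> has_real_derivative y) (at x) \<and> 0 \<le> y" by blast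
  qed (use that in \<open>auto intro: continuous_on_subset[OF cont]\<close>)
  have odd: "\<Phi> (- T) = - \<Phi> T"
  proof -
    have Gneg: "G f (- T) = - G f T" if "mobius_sym T f" "harmonic_strip T f" for f
      using green_strip(2)[OF T that TT] by (simp add: G_def)
    show ?thesis
      unfolding \<Phi>_def Gneg[OF u_comp(2,1)] Gneg[OF om(2,1)] by (simp add: sum_negf)
  qed
  have \<Phi>T: "\<Phi> T = (norm w)\<^sup>2 * II lam - 2 * II (\<lambda>\<theta>. lam \<theta> * (\<Sum>i\<in>UNIV. w $ i * h i \<theta>)\<^sup>2)"
  proof -
    have pT: "(T, \<theta>) \<in> strip T" for \<theta> using TT by simp
    have "G (\<lambda>p. u p $ i) T = II (\<lambda>\<theta>. h i \<theta> * (lam \<theta> * h i \<theta>))" for i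
      by (simp add: G_def u_comp(4)[OF pT] dt_u_T h_def)
    then have "(\<Sum>i\<in>UNIV. G (\<lambda>p. u p $ i) T) = II (\<lambda>\<theta>. \<Sum>i\<in>UNIV. h i \<theta> * (lam \<theta> * h i \<theta>))"
      by (simp add: integral_sum cper_integrable cper_mult h_cper lam_cper)
    also have "(\<lambda>\<theta>. \<Sum>i\<in>UNIV. h i \<theta> * (lam \<theta> * h i \<theta>)) = lam"
    proof
      fix \<theta>
      have "(\<Sum>i\<in>UNIV. h i \<theta> * (lam \<theta> * h i \<theta>)) = lam \<theta> * (\<Sum>i\<in>UNIV. (h i \<theta>)\<^sup>2)"
        by (simp add: sum_distrib_left power2_eq_square mult_ac)
      then show "(\<Sum>i\<in>UNIV. h i \<theta> * (lam \<theta> * h i \<theta>)) = lam \<theta>" by (simp add: sum_h_sq)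
    qed
    finally have 1: "(\<Sum>i\<in>UNIV. G (\<lambda>p. u p $ i) T) = II lam" .
    have "inner w (dt T u (T, \<theta>)) = lam \<theta> * inner w (u (T, \<theta>))" for \<theta>
      by (simp add: inner_vec_def dt_u_T h_def[symmetric] sum_distrib_left mult_ac)
    then have "G om T = II (\<lambda>\<theta>. lam \<theta> * (\<Sum>i\<in>UNIV. w $ i * h i \<theta>)\<^sup>2)"
      by (simp add: G_def om(4)[OF pT]) (simp add: om_def inner_u_T power2_eq_square mult_ac)
    with 1 show ?thesis by (simp add: \<Phi>_def)
  qed
  \<comment> \<open>Monotonicity and \<open>\<Phi> (- T) = - \<Phi> T\<close> give
    \<open>\<Phi> T \<ge> 0\<close>, the negated claim gives the opposite inequality; a monotone
    \<open>\<Phi>\<close> with equal end values is constant.\<close>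
  have "\<Phi> T = 0"
    using neg mono[of "-T" T] odd T \<Phi>T by simp
  then have \<Phi>0: "\<Phi> t = 0" if "t \<in> {-T..T}" for t
    using mono[of "-T" t] mono[of t T] odd that by auto
  have "E t \<theta> = 0" if t: "t \<in> {-T..T}" for t \<theta>
  proof -
    have "(\<Phi> has_vector_derivative 0) (at t within {-T..T})"
      by (rule has_vector_derivative_transform[OF t _ has_vector_derivative_const[of 0]]) (simp add: \<Phi>0)
    then have "II (E t) = 0"
      using vector_derivative_unique_within_closed_interval[of "-T" T t \<Phi>] d\<Phi>[OF t] T t by (simp add: box_real)
    then show ?thesis by (intro integral_pos_zero[OF Ecp[OF t]] Epos[OF t])
  qed
  then have "(norm w)\<^sup>2 * (norm (dt T u p))\<^sup>2 = (inner w (dt T u p))\<^sup>2 + (inner w (dth u p))\<^sup>2" if "p \<in> strip T" for p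
    using Edec[of "fst p" "snd p"] that by (cases p) simp
  then show False by (rule no_tangent_vector[OF w])
qed

end

section \<open>Test fields\<close>

lemma wiener_Lam1: "T > 0 \<Longrightarrow> wiener 1 f \<Longrightarrow> wiener 0 (Lam T f)"
  unfolding One_nat_def by (rule wiener_Lam)

lemma fc_Lam1: "T > 0 \<Longrightarrow> wiener 1 f \<Longrightarrow> fc (Lam T f) k = of_real (mu T k) * fc f k"
  unfolding One_nat_def by (rule fc_Lam)

lemma rd_deriv1: "wiener 1 (cr g) \<Longrightarrow> (g has_real_derivative rd g x) (at x)"
  unfolding One_nat_def by (rule rd_deriv(1))

lemma fc_fd1: "wiener 1 f \<Longrightarrow> fc (fd f) k = \<i> * of_int k * fc f k"
  unfolding One_nat_def by (rule fc_fd)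

lemma Lam_add:
  assumes "T > 0" "wiener 1 f" "wiener 1 g"
  shows "Lam T (\<lambda>x. f x + g x) = (\<lambda>x. Lam T f x + Lam T g x)"
proof (rule fc_unique)
  have fg: "wiener 1 (\<lambda>x. f x + g x)" by (intro wiener_add assms)
  note L = wiener_Lam1[OF assms(1)] and F = fc_Lam1[OF assms(1)]
  show "cper (Lam T (\<lambda>x. f x + g x))" "cper (\<lambda>x. Lam T f x + Lam T g x)"
    using L[OF fg] L[OF assms(2)] L[OF assms(3)] by (auto intro!: cper_add dest: wiener_cper)
  show "fc (Lam T (\<lambda>x. f x + g x)) k = fc (\<lambda>x. Lam T f x + Lam T g x) k" for k
    using L[OF assms(2)] L[OF assms(3)] assms
    by (simp add: F[OF fg] F[OF assms(2)] F[OF assms(3)] fc_add wiener_cper algebra_simps)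
qed

lemma Lam_cmult: "Lam T (\<lambda>x. a * f x) = (\<lambda>x. a * Lam T f x)"
  by (simp add: Lam_def fser_def[abs_def] fc_cmult infsum_cmult_right'[symmetric] mult_ac)

lemma Lam_const [simp]: "Lam T (\<lambda>x. a) = (\<lambda>x. 0)"
  by (simp add: Lam_def fser_def[abs_def] fc_const if_distrib[of "\<lambda>z. _ * z"] cong: if_cong)

lemma Lam_sym:
  assumes T: "T > 0" and f: "wiener 1 f" and g: "wiener 1 g"
  shows "integral {0..2 * pi} (\<lambda>x. Lam T f x * g x) = integral {0..2 * pi} (\<lambda>x. Lam T g x * f x)"
proof -
  note L = wiener_Lam1[OF T] and F = fc_Lam1[OF T]
  have 2: "((\<lambda>k. fc g k * fc (Lam T f) (- k)) has_sum (integral {0..2 * pi} (\<lambda>x. g x * Lam T f x) / of_real (2 * pi))) UNIV"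
    by (rule integral_mult_has_sum[OF g wiener_cper[OF L[OF f]]])
  have 3: "((\<lambda>k. fc (Lam T g) k * fc f (- k)) has_sum (integral {0..2 * pi} (\<lambda>x. Lam T g x * f x) / of_real (2 * pi))) UNIV"
    by (rule integral_mult_has_sum[OF L[OF g] wiener_cper[OF f]])
  have "fc g k * fc (Lam T f) (- k) = fc (Lam T g) k * fc f (- k)" for k
    by (simp add: F[OF f] F[OF g])
  then have "integral {0..2 * pi} (\<lambda>x. g x * Lam T f x) / complex_of_real (2 * pi)
      = integral {0..2 * pi} (\<lambda>x. Lam T g x * f x) / of_real (2 * pi)"
    by (intro has_sum_unique[OF _ 3]) (use 2 in simp)
  then show ?thesis by (simp add: mult.commute)
qed

text \<open>The Fourier form of: \<open>F\<close> is the boundary value at \<open>t = T\<close> of a holomorphic function \<open>G\<close> of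
  \<open>t + i \<theta>\<close> on the strip such that the conjugate of \<open>G(-t, \<theta> + \<pi>)\<close> is \<open>\<epsilon> G(t, \<theta>)\<close>.\<close>

definition trace_type :: "real \<Rightarrow> real \<Rightarrow> (real \<Rightarrow> complex) \<Rightarrow> bool" where
  "trace_type T \<epsilon> F \<longleftrightarrow> (\<forall>k. cnj (fc F k) = of_real (\<epsilon> * sg k * exp (2 * of_int k * T)) * fc F (- k))"

lemma sg_mult: "sg (j + k) = sg j * sg k"
  by (simp add: sg_def)

text \<open>The factor \<open>sg k * exp (2 * k * T)\<close> is multiplicative in \<open>k\<close>,
  hence compatible with convolution of coefficients.\<close>

lemma trace_type_mult:
  assumes F: "trace_type T \<epsilon>1 F" "wiener s F" and G: "trace_type T \<epsilon>2 G" "wiener s G"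
  shows "trace_type T (\<epsilon>1 * \<epsilon>2) (\<lambda>x. F x * G x)"
  unfolding trace_type_def
proof
  fix m
  have H: "((\<lambda>k. fc F k * fc G (j - k)) has_sum fc (\<lambda>x. F x * G x) j) UNIV" for j
    by (intro fc_mult_has_sum wiener_cper[OF F(2)] wiener_abs[OF F(2)] wiener_cper[OF G(2)])
  from H[of m] have 1: "((\<lambda>k. cnj (fc F k * fc G (m - k))) has_sum cnj (fc (\<lambda>x. F x * G x) m)) UNIV"
    by (subst has_sum_cnj_iff)
  define C where "C = complex_of_real (\<epsilon>1 * \<epsilon>2 * sg m * exp (2 * of_int m * T))"
  have "((\<lambda>k. fc F (- k) * fc G (- m - - k)) has_sum fc (\<lambda>x. F x * G x) (- m)) UNIV"
    using has_sum_reindex_bij_betw[OF bij_uminus, of "\<lambda>k. fc F k * fc G (- m - k)"] H[of "- m"] by simp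
  then have 2: "((\<lambda>k. C * (fc F (- k) * fc G (- m - - k))) has_sum C * fc (\<lambda>x. F x * G x) (- m)) UNIV"
    by (rule has_sum_cmult_right)
  have "cnj (fc F k * fc G (m - k)) = C * (fc F (- k) * fc G (- m - - k))" for k
  proof -
    have "sg m = sg k * sg (m - k)" using sg_mult[of k "m - k"] by simp
    moreover have "exp (2 * of_int m * T) = exp (2 * of_int k * T) * exp (2 * of_int (m - k) * T)"
      by (simp add: exp_add[symmetric] algebra_simps)
    ultimately have "C = of_real (\<epsilon>1 * sg k * exp (2 * of_int k * T)) * of_real (\<epsilon>2 * sg (m - k) * exp (2 * of_int (m - k) * T))"
      by (simp add: C_def)
    then show ?thesis
      using F(1) G(1) unfolding trace_type_def complex_cnj_mult by simp
  qed
  with 1 2 show "cnj (fc (\<lambda>x. F x * G x) m) = of_real (\<epsilon>1 * \<epsilon>2 * sg m * exp (2 * of_int m * T)) * fc (\<lambda>x. F x * G x) (- m)"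
    unfolding C_def[symmetric] by (simp add: has_sum_unique)
qed

lemma trace_type_add: "cper F \<Longrightarrow> cper G \<Longrightarrow> trace_type T \<epsilon> F \<Longrightarrow> trace_type T \<epsilon> G \<Longrightarrow> trace_type T \<epsilon> (\<lambda>x. F x + G x)"
  by (simp add: trace_type_def fc_add algebra_simps)

lemma trace_type_rmult: "trace_type T \<epsilon> F \<Longrightarrow> trace_type T \<epsilon> (\<lambda>x. of_real r * F x)"
  by (simp add: trace_type_def fc_cmult)

lemma trace_type_sum:
  assumes "finite I" "\<And>i. i \<in> I \<Longrightarrow> cper (F i)" "\<And>i. i \<in> I \<Longrightarrow> trace_type T \<epsilon> (F i)"
  shows "trace_type T \<epsilon> (\<lambda>x. \<Sum>i\<in>I. F i x)"
  using assms
proof (induction I rule: finite_induct)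
  case empty
  then show ?case by (simp add: trace_type_def fc_const)
next
  case (insert i I)
  then show ?case by (simp add: trace_type_add cper_sum)
qed

lemma trace_type_const: "trace_type T (- 1) (\<lambda>x. \<i> * of_real c)"
  by (simp add: trace_type_def fc_const sg_def)

text \<open>The quotient defining \<open>mu\<close> with \<open>exp (k T)\<close> cancelled: the
  form in which it meets the reflection factor of \<open>trace_type\<close>.\<close>

lemma mu_exp:
  assumes T: "T > 0"
  shows "mu T k * (1 + sg k * exp (- 2 * of_int k * T)) = of_int k * (1 - sg k * exp (- 2 * of_int k * T))"
proof -
  define E where "E = exp (of_int k * T)"
  have e: "exp (- of_int k * T) = E * exp (- 2 * of_int k * T)"
    by (simp add: E_def exp_add[symmetric])
  have "mu T k * XC k T = of_int k * XS k T"
    using XC_nz[OF T, of k] by (simp add: mu_def)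
  then have "E * (mu T k * (1 + sg k * exp (- 2 * of_int k * T))) = E * (of_int k * (1 - sg k * exp (- 2 * of_int k * T)))"
    unfolding XC_def XS_def e E_def[symmetric] by (simp add: algebra_simps)
  then show ?thesis by (simp add: E_def)
qed

lemma mu_exp':
  assumes T: "T > 0"
  shows "mu T k + of_int k = - sg k * exp (2 * of_int k * T) * (mu T k - of_int k)"
proof -
  have "exp (2 * of_int k * T) * exp (- 2 * of_int k * T) = 1" by (simp add: exp_add[symmetric])
  then have "- sg k * exp (2 * of_int k * T) * (- sg k * exp (- 2 * of_int k * T) * (mu T k + of_int k)) = mu T k + of_int k"
    by (simp add: mult_ac sg_def)
  moreover have "mu T k - of_int k = - sg k * exp (- 2 * of_int k * T) * (mu T k + of_int k)"
    using mu_exp[OF T, of k] by (simp add: algebra_simps)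
  ultimately show ?thesis by simp
qed

text \<open>With sign 1 the real part of the holomorphic extension is invariant under the
  involution, so it is the harmonic extension of \<open>Re F\<close>; by Cauchy-Riemann its
  \<open>t\<close> derivative is the angular derivative of the imaginary part. In coefficients this
  is \<open>mu_exp\<close>.\<close>

lemma Lam_Re:
  assumes T: "T > 0" and F: "trace_type T 1 F" "wiener 1 F"
  shows "Lam T (cr (\<lambda>x. Re (F x))) = cr (\<lambda>x. Im (fd F x))"
proof (rule fc_unique)
  have ReF: "cr (\<lambda>x. Re (F x)) = (\<lambda>x. (1 / 2) * (F x + cnj (F x)))"
    by (auto simp: complex_eq_iff)
  have wR: "wiener 1 (cr (\<lambda>x. Re (F x)))"
    unfolding ReF by (intro wiener_cmult wiener_add wiener_cnj F)
  show "cper (Lam T (cr (\<lambda>x. Re (F x))))"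
    by (rule wiener_cper[OF wiener_Lam1[OF T wR]])
  have fdF: "wiener 0 (fd F)" using wiener_fd[of 0 F] F by simp
  have ImF: "cr (\<lambda>x. Im (fd F x)) = (\<lambda>x. (- \<i> / 2) * (fd F x - cnj (fd F x)))"
    by (auto simp: complex_eq_iff)
  show "cper (cr (\<lambda>x. Im (fd F x)))"
    unfolding ImF by (intro cper_mult[OF cper_const] cper_diff cper_cnj wiener_cper[OF fdF])
  fix k
  define q where "q = complex_of_real (sg k * exp (- 2 * of_int k * T))"
  have neg: "cnj (fc F (- k)) = q * fc F k"
    using F(1) unfolding trace_type_def q_def by (metis (no_types, lifting) minus_minus mult_1 mult_minus_left mult_minus_right of_int_minus sg_minus)
  have "fc (Lam T (cr (\<lambda>x. Re (F x)))) k = of_real (mu T k) * fc (\<lambda>x. (1 / 2) * (F x + cnj (F x))) k"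
    using fc_Lam1[OF T wR, of k] ReF by simp
  also have "fc (\<lambda>x. (1 / 2) * (F x + cnj (F x))) k = (1 / 2) * (fc F k + q * fc F k)"
    using F(2) by (simp add: fc_cmult fc_add fc_cnj neg cper_cnj wiener_cper del: times_divide_eq_left)
  also have "of_real (mu T k) * ((1 / 2) * (fc F k + q * fc F k)) = (1 / 2) * (of_real (mu T k) * (1 + q)) * fc F k"
    by (simp add: algebra_simps)
  also have "of_real (mu T k) * (1 + q) = of_int k * (1 - q)"
    using arg_cong[OF mu_exp[OF T, of k], of complex_of_real] by (simp add: q_def)
  also have "(1 / 2) * (of_int k * (1 - q)) * fc F k = (- \<i> / 2) * (\<i> * of_int k * fc F k - \<i> * of_int k * (q * fc F k))"
    by (simp add: algebra_simps)
  also have "\<dots> = fc (\<lambda>x. (- \<i> / 2) * (fd F x - cnj (fd F x))) k"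
  proof -
    have "fc (\<lambda>x. (- \<i> / 2) * (fd F x - cnj (fd F x))) k = (- \<i> / 2) * (fc (fd F) k - cnj (fc (fd F) (- k)))"
      by (subst fc_cmult, subst fc_diff) (auto simp: fc_cnj intro!: cper_cnj wiener_cper[OF fdF])
    then show ?thesis unfolding fc_fd1[OF F(2)] by (simp add: neg)
  qed
  finally show "fc (Lam T (cr (\<lambda>x. Re (F x)))) k = fc (cr (\<lambda>x. Im (fd F x))) k"
    unfolding ImF .
qed

text \<open>Mean zero allows solving \<open>Lam v = a\<close>. Then \<open>Lam v - i v'\<close> has
  real part \<open>a\<close> and, like \<open>phi\<close>, the sign -1; the sequence
  \<open>\<beta>\<close> holds the coefficients of \<open>- v'\<close>.\<close>

lemma conjugate_exists:
  assumes T: "T > 0" and a: "wiener 1 (cr a)" "integral {0..2 * pi} a = 0"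
  shows "\<exists>b. wiener 1 (cr b) \<and> trace_type T (- 1) (\<lambda>x. cr a x + \<i> * cr b x)"
proof -
  define \<beta> where "\<beta> k = - \<i> * of_int k * fc (cr a) k / of_real (mu T k)" for k
  have ac: "cper a" by (rule cper_of_cr[OF wiener_cper[OF a(1)]])
  have a0: "fc (cr a) 0 = 0" using integral_cr[OF ac] a(2) by (simp add: fc_0)
  have wb: "wsum 1 \<beta>"
  proof (rule wsum_bound[where C = "1 / cT T"])
    show "wsum 1 (fc (cr a))" using a by (simp add: wiener_def)
    fix k
    have "\<bar>real_of_int k\<bar> / mu T k \<le> 1 / cT T"
      using mu_lower[OF T, of k] mu_pos[OF T, of k] cT_pos[OF T]
      by (cases "k = 0") (auto simp: field_simps)
    then have "norm (\<beta> k) \<le> 1 / cT T * norm (fc (cr a) k)"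
      using mult_right_mono[of "\<bar>real_of_int k\<bar> / mu T k" "1 / cT T" "norm (fc (cr a) k)"] mu_nonneg[OF T, of k]
      by (simp add: \<beta>_def norm_mult norm_divide)
    then show "wt 1 k * norm (\<beta> k) \<le> 1 / cT T * (wt 1 k * norm (fc (cr a) k))"
      using mult_left_mono[of "norm (\<beta> k)" "1 / cT T * norm (fc (cr a) k)" "wt 1 k"] by (simp add: mult_ac)
  qed
  define b where "b x = Re (fser \<beta> x)" for x
  have wf: "wiener 1 (fser \<beta>)" by (rule wiener_fser[OF wb])
  have fb: "fc (fser \<beta>) k = \<beta> k" for k by (rule fc_fser[OF wsum_abs[OF wb]])
  have "(\<lambda>x. cnj (fser \<beta> x)) = fser \<beta>"
  proof (rule fc_unique)
    show "cper (\<lambda>x. cnj (fser \<beta> x))" "cper (fser \<beta>)" by (intro cper_cnj wiener_cper[OF wf])+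
    show "fc (\<lambda>x. cnj (fser \<beta> x)) k = fc (fser \<beta>) k" for k
      unfolding fc_cnj fb by (simp add: \<beta>_def fc_cr_minus)
  qed
  then have cb: "cr b = fser \<beta>"
    by (auto simp: b_def complex_eq_iff fun_eq_iff)
  have cbx: "complex_of_real (b x) = fser \<beta> x" for x by (rule fun_cong[OF cb])
  have "trace_type T (- 1) (\<lambda>x. cr a x + \<i> * cr b x)"
    unfolding trace_type_def
  proof
    fix k
    have f: "fc (\<lambda>x. cr a x + \<i> * fser \<beta> x) j = fc (cr a) j + \<i> * \<beta> j" for j
      using ac by (subst fc_add) (auto simp: fc_cmult fb intro!: cper_mult[OF cper_const] cper_of_real wiener_cper[OF wf])
    show "cnj (fc (\<lambda>x. cr a x + \<i> * cr b x) k) = of_real (- 1 * sg k * exp (2 * of_int k * T)) * fc (\<lambda>x. cr a x + \<i> * cr b x) (- k)"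
    proof (cases "k = 0")
      case True
      then show ?thesis unfolding cbx f by (simp add: a0 \<beta>_def)
    next
      case False
      have m: "of_real (mu T k) \<noteq> (0 :: complex)" using mu_pos[OF T False] by simp
      have g: "fc (cr a) j + \<i> * \<beta> j = of_real ((mu T j + of_int j) / mu T j) * fc (cr a) j" if "mu T j \<noteq> 0" for j
        using that by (simp add: \<beta>_def field_simps)
      have "cnj (fc (cr a) k + \<i> * \<beta> k) = of_real ((mu T k + of_int k) / mu T k) * fc (cr a) (- k)"
        using m by (subst g) (auto simp: fc_cr_minus)
      also have "mu T k + of_int k = - sg k * exp (2 * of_int k * T) * (mu T k - of_int k)"
        by (rule mu_exp'[OF T])
      also have "complex_of_real (- sg k * exp (2 * of_int k * T) * (mu T k - of_int k) / mu T k) * fc (cr a) (- k)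
          = of_real (- 1 * sg k * exp (2 * of_int k * T)) * (of_real ((mu T (- k) + of_int (- k)) / mu T (- k)) * fc (cr a) (- k))"
        by simp
      also have "of_real ((mu T (- k) + of_int (- k)) / mu T (- k)) * fc (cr a) (- k) = fc (cr a) (- k) + \<i> * \<beta> (- k)"
        using m by (subst g) auto
      finally show ?thesis unfolding cbx f .
    qed
  qed
  moreover have "wiener 1 (cr b)" unfolding cb by (rule wf)
  ultimately show ?thesis by blast
qed

section \<open>Frame identities on the boundary curve and the family of test fields\<close>

context fb_mobius
begin

lemma Lam_h: "Lam T (cr (h i)) = cr (\<lambda>\<theta>. lam \<theta> * h i \<theta>)"
proof (rule fc_unique)
  have w: "wiener 1 (cr (h i))" by (rule wiener_1_h)
  show "cper (Lam T (cr (h i)))" by (rule wiener_cper[OF wiener_Lam1[OF T w]])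
  show "cper (cr (\<lambda>\<theta>. lam \<theta> * h i \<theta>))" by (rule cper_of_real[OF lam_h_cper])
  show "fc (Lam T (cr (h i))) k = fc (cr (\<lambda>\<theta>. lam \<theta> * h i \<theta>)) k" for k
    unfolding fc_lam_h using fc_Lam1[OF T w, of k] by simp
qed

definition l1 :: "real \<Rightarrow> real" where "l1 = rd lam"

definition h2 :: "'n \<Rightarrow> real \<Rightarrow> real" where "h2 i = rd (h1 i)"

lemma rd_h: "rd (h i) = h1 i"
  using DERIV_unique[OF rd_deriv(1) h_deriv, of 0 i] wiener_1_h by auto

lemma h1_wiener: "wiener 2 (cr (h1 i))"
  using rd_deriv(3)[of 2 "h i"] h_wiener by (simp add: rd_h numeral_3_eq_3 numeral_2_eq_2)

lemma lam_deriv: "(lam has_real_derivative l1 x) (at x)" and l1_wiener: "wiener 1 (cr l1)"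
  using rd_deriv(1,3)[of 1 lam] lam_wiener by (simp_all add: l1_def numeral_2_eq_2)

lemma h1_deriv: "(h1 i has_real_derivative h2 i x) (at x)"
  using rd_deriv(1)[of 1 "h1 i"] h1_wiener by (simp add: h2_def numeral_2_eq_2)

lemma sum_h1_sq: "(\<Sum>i\<in>UNIV. (h1 i \<theta>)\<^sup>2) = (lam \<theta>)\<^sup>2"
proof -
  have "(T, \<theta>) \<in> strip T" using TT by simp
  then have "inner (dth u (T, \<theta>)) (dth u (T, \<theta>)) = (lam \<theta>)\<^sup>2"
    using conf(1) by (simp add: lam_def power2_norm_eq_inner[symmetric])
  then show ?thesis by (simp add: inner_vec_def h1_def power2_eq_square)
qed

lemma sum_h_h2: "(\<Sum>i\<in>UNIV. h i \<theta> * h2 i \<theta>) = - (lam \<theta>)\<^sup>2"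
proof -
  have "((\<lambda>\<theta>. \<Sum>i\<in>UNIV. h i \<theta> * h1 i \<theta>) has_real_derivative (\<Sum>i\<in>UNIV. h1 i \<theta> * h1 i \<theta> + h2 i \<theta> * h i \<theta>)) (at \<theta>)"
    by (intro DERIV_sum DERIV_mult h_deriv h1_deriv)
  moreover have "((\<lambda>\<theta>. \<Sum>i\<in>UNIV. h i \<theta> * h1 i \<theta>) has_real_derivative 0) (at \<theta>)"
    unfolding sum_h_h1 by simp
  ultimately have "(\<Sum>i\<in>UNIV. h1 i \<theta> * h1 i \<theta> + h2 i \<theta> * h i \<theta>) = 0" by (rule DERIV_unique)
  then show ?thesis
    using sum_h1_sq[of \<theta>] by (simp add: sum.distrib power2_eq_square mult.commute)
qed

lemma sum_h1_h2: "(\<Sum>i\<in>UNIV. h1 i \<theta> * h2 i \<theta>) = lam \<theta> * l1 \<theta>"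
proof -
  have 1: "((\<lambda>\<theta>. \<Sum>i\<in>UNIV. h1 i \<theta> * h1 i \<theta>) has_real_derivative (\<Sum>i\<in>UNIV. h2 i \<theta> * h1 i \<theta> + h2 i \<theta> * h1 i \<theta>)) (at \<theta>)"
    by (intro DERIV_sum DERIV_mult h1_deriv)
  have 2: "(\<lambda>\<theta>. \<Sum>i\<in>UNIV. h1 i \<theta> * h1 i \<theta>) = (\<lambda>\<theta>. lam \<theta> * lam \<theta>)"
    using sum_h1_sq by (auto simp: power2_eq_square)
  have 3: "((\<lambda>\<theta>. lam \<theta> * lam \<theta>) has_real_derivative l1 \<theta> * lam \<theta> + l1 \<theta> * lam \<theta>) (at \<theta>)"
    by (intro DERIV_mult lam_deriv)
  have "(\<Sum>i\<in>UNIV. h2 i \<theta> * h1 i \<theta> + h2 i \<theta> * h1 i \<theta>) = l1 \<theta> * lam \<theta> + l1 \<theta> * lam \<theta>"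
    by (rule DERIV_unique[OF 1[unfolded 2] 3])
  then show ?thesis by (simp add: mult.commute[of "h2 _ _"] sum_distrib_left[symmetric])
qed

text \<open>Wiener's inversion theorem is avoided: \<open>lam\<close> is positive with two
  continuous derivatives, so \<open>1 / lam\<close> is C2.\<close>

lemma inv_lam_wiener: "wiener 1 (cr (\<lambda>x. 1 / lam x))"
proof (rule wiener_1_C2)
  define l2 where "l2 = rd l1"
  have l2: "(l1 has_real_derivative l2 x) (at x)" "wiener 0 (cr l2)" for x
    using rd_deriv(1,3)[of 0 l1] l1_wiener by (simp_all add: l2_def)
  have nz: "lam x \<noteq> 0" for x using lam_pos[of x] by simp
  have c: "cper lam" "cper l1" "cper l2"
    using lam_wiener l1_wiener l2(2) by (auto intro: cper_of_cr wiener_cper)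
  define d1 where "d1 x = - (l1 x / (lam x)\<^sup>2)" for x
  define d2 where "d2 x = - ((l2 x * (lam x)\<^sup>2 - l1 x * (2 * lam x * l1 x)) / ((lam x)\<^sup>2)\<^sup>2)" for x
  have D1: "((\<lambda>x. 1 / lam x) has_real_derivative d1 x) (at x)" for x
    unfolding d1_def by (auto intro!: derivative_eq_intros lam_deriv simp: nz power2_eq_square field_simps)
  have D2: "(d1 has_real_derivative d2 x) (at x)" for x
    unfolding d1_def[abs_def] d2_def
    by (auto intro!: derivative_eq_intros lam_deriv l2 simp: nz)
  have ci: "cper (\<lambda>x. 1 / lam x)" "cper d1" "cper d2"
    unfolding d1_def[abs_def] d2_def[abs_def]
    using c nz by (auto simp: cper_def intro!: continuous_intros)
  show "cper (cr (\<lambda>x. 1 / lam x))" "cper (cr d1)" "cper (cr d2)" by (intro cper_of_real ci)+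
  show "(cr (\<lambda>x. 1 / lam x) has_vector_derivative cr d1 x) (at x)" for x
    by (rule has_vector_derivative_of_real[OF D1])
  show "(cr d1 has_vector_derivative cr d2 x) (at x)" for x
    by (rule has_vector_derivative_of_real[OF D2])
qed

text \<open>The mean is the coefficient at 0 of \<open>Lam h\<close>, where the multiplier
  vanishes.\<close>

lemma II_lam_h: "II (\<lambda>x. lam x * h i x) = 0"
proof -
  have "fc (cr (\<lambda>\<theta>. lam \<theta> * h i \<theta>)) 0 = 0" unfolding fc_lam_h by simp
  then have "complex_of_real (II (\<lambda>x. lam x * h i x)) = 0"
    unfolding fc_0 integral_cr[OF lam_h_cper] by simp
  then show ?thesis by simp
qed

lemma II_lam_pos: "II lam > 0"
proof -
  have "II lam \<ge> 0" by (intro integral_nonneg cper_integrable lam_cper) (auto intro: less_imp_le lam_pos)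
  moreover have "II lam \<noteq> 0"
    using integral_pos_zero[OF lam_cper, of 0] lam_pos[of 0] less_imp_le[OF lam_pos] by force
  ultimately show ?thesis by simp
qed

definition il :: "real" where "il = II (\<lambda>x. 1 / lam x)"
definition kap :: "'n \<Rightarrow> real" where "kap j = - II (\<lambda>x. h j x * (1 / lam x)) / il"
definition af :: "'n \<Rightarrow> real \<Rightarrow> real" where "af j x = - (h j x + kap j) * (1 / lam x)"

lemma il_cper: "cper (\<lambda>x. 1 / lam x)"
  by (rule cper_of_cr[OF wiener_cper[OF inv_lam_wiener]])

lemma il_pos: "il > 0"
proof -
  have "il \<ge> 0" unfolding il_def by (intro integral_nonneg cper_integrable il_cper) (auto intro: less_imp_le lam_pos)
  moreover have "il \<noteq> 0"
    using integral_pos_zero[OF il_cper, of 0] lam_pos[of 0] less_imp_le[OF lam_pos] unfolding il_def by force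
  ultimately show ?thesis by simp
qed

lemma af_wiener: "wiener 1 (cr (af j))"
proof -
  have "wiener 1 (\<lambda>x. (- 1) * ((cr (h j) x + of_real (kap j)) * cr (\<lambda>x. 1 / lam x) x))"
    by (intro wiener_cmult wiener_mult wiener_add wiener_1_h wiener_const inv_lam_wiener)
  then show ?thesis by (simp add: af_def[abs_def])
qed

lemma II_af: "II (af j) = 0"
proof -
  have "af j = (\<lambda>x. - (h j x * (1 / lam x)) - kap j * (1 / lam x))"
    by (auto simp: af_def algebra_simps)
  then have "II (af j) = II (\<lambda>x. - (h j x * (1 / lam x))) - II (\<lambda>x. kap j * (1 / lam x))"
    by (simp only:) (rule integral_diff, (intro integrable_neg cper_integrable cper_mult[OF cper_const] cper_mult[OF h_cper] il_cper)+)
  also have "\<dots> = - II (\<lambda>x. h j x * (1 / lam x)) - kap j * il"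
    by (simp only: integral_neg integral_mult_right il_def)
  finally show ?thesis using il_pos by (simp add: kap_def)
qed

text \<open>One conjugate is fixed per coordinate, so that \<open>bw\<close> depends linearly on
  \<open>w\<close> and \<open>c\<close>; the dimension count needs a linear family.\<close>

definition bf :: "'n \<Rightarrow> real \<Rightarrow> real" where
  "bf j = (SOME b. wiener 1 (cr b) \<and> trace_type T (- 1) (\<lambda>x. cr (af j) x + \<i> * cr b x))"

lemma bf: "wiener 1 (cr (bf j))" "trace_type T (- 1) (\<lambda>x. cr (af j) x + \<i> * cr (bf j) x)"
  using someI_ex[OF conjugate_exists[OF T af_wiener II_af, of j]] unfolding bf_def by auto

lemma phi_wiener: "wiener 1 (phi i)"
proof -
  have "wiener 1 (\<lambda>x. cr lam x * cr (h i) x - \<i> * cr (h1 i) x)"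
    by (intro wiener_diff wiener_mult wiener_cmult wiener_1_h wiener_mono[OF lam_wiener] wiener_mono[OF h1_wiener]) auto
  then show ?thesis by (simp add: phi_def[abs_def])
qed

text \<open>Under the involution \<open>u_t\<close> changes sign and \<open>u_theta\<close> does
  not, so after conjugation \<open>u_t - i u_theta\<close> becomes its negative.\<close>

lemma phi_trace_type: "trace_type T (- 1) (phi i)"
  unfolding trace_type_def fc_phi
proof
  fix k
  have e: "complex_of_real (mu T k + of_int k)
      = of_real (- 1 * sg k * exp (2 * of_int k * T)) * of_real (mu T (- k) + of_int (- k))"
    using arg_cong[OF mu_exp'[OF T, of k], of complex_of_real] by simp
  have "cnj (of_real (mu T k + of_int k) * fc (cr (h i)) k) = of_real (mu T k + of_int k) * fc (cr (h i)) (- k)"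
    by (simp only: complex_cnj_mult complex_cnj_complex_of_real fc_cr_minus)
  then show "cnj (of_real (mu T k + of_int k) * fc (cr (h i)) k)
      = of_real (- 1 * sg k * exp (2 * of_int k * T)) * (of_real (mu T (- k) + of_int (- k)) * fc (cr (h i)) (- k))"
    by (simp only: e mult.assoc)
qed

lemma phi_deriv: "(phi i has_vector_derivative of_real (l1 x * h i x + lam x * h1 i x) - \<i> * of_real (h2 i x)) (at x)"
proof -
  have "((\<lambda>x. lam x * h i x) has_real_derivative l1 x * h i x + h1 i x * lam x) (at x)"
    by (rule DERIV_mult[OF lam_deriv h_deriv])
  then show ?thesis
    unfolding phi_def[abs_def]
    by (intro has_vector_derivative_diff has_vector_derivative_mult_right has_vector_derivative_of_real h1_deriv)
       (simp add: mult.commute)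
qed

text \<open>\<open>Uf w c = w + kw w h + Re ((aw w + i bw w c) phi)\<close>, on which the Dirichlet-to-Neumann
  operator is explicit because the product is again a holomorphic boundary value. The choice of
  \<open>aw\<close> cancels \<open>kw w h\<close> and leaves the projection of \<open>w\<close> orthogonal to \<open>h\<close>; the constants \<open>kap\<close>
  give \<open>aw\<close> mean zero, without which it would have no conjugate \<open>bw\<close>.\<close>

definition sw :: "real ^ 'n \<Rightarrow> real \<Rightarrow> real" where "sw w x = (\<Sum>j\<in>UNIV. w $ j * h j x)"
definition aw :: "real ^ 'n \<Rightarrow> real \<Rightarrow> real" where "aw w x = (\<Sum>j\<in>UNIV. w $ j * af j x)"
definition bw :: "real ^ 'n \<Rightarrow> real \<Rightarrow> real \<Rightarrow> real" where "bw w c x = (\<Sum>j\<in>UNIV. w $ j * bf j x) + c"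
definition kw :: "real ^ 'n \<Rightarrow> real" where "kw w = (\<Sum>j\<in>UNIV. w $ j * kap j)"
definition Uf :: "real ^ 'n \<Rightarrow> real \<Rightarrow> 'n \<Rightarrow> real \<Rightarrow> real" where
  "Uf w c i x = w $ i - sw w x * h i x + bw w c x * h1 i x"
definition Vf :: "real ^ 'n \<Rightarrow> real \<Rightarrow> 'n \<Rightarrow> real \<Rightarrow> real" where
  "Vf w c i x = kw w * (lam x * h i x) + (rd (bw w c) x * (lam x * h i x) + bw w c x * (l1 x * h i x + lam x * h1 i x)
      - rd (aw w) x * h1 i x - aw w x * h2 i x)"

lemma aw_lam: "aw w x * lam x = - (sw w x + kw w)"
proof -
  have "w $ j * af j x * lam x = - (w $ j * h j x + w $ j * kap j)" for j
    using lam_pos[of x] by (simp add: af_def algebra_simps)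
  then show ?thesis
    by (simp add: aw_def sw_def kw_def sum_distrib_right sum_subtractf sum_negf)
qed

lemma aw_wiener: "wiener 1 (cr (aw w))" and bw_wiener: "wiener 1 (cr (bw w c))" and sw_wiener: "wiener 1 (cr (sw w))"
proof -
  have "wiener 1 (\<lambda>x. \<Sum>j\<in>UNIV. of_real (w $ j) * cr (af j) x)"
    by (intro wiener_sum wiener_cmult af_wiener)
  then show "wiener 1 (cr (aw w))" by (simp add: aw_def[abs_def])
  have "wiener 1 (\<lambda>x. (\<Sum>j\<in>UNIV. of_real (w $ j) * cr (bf j) x) + of_real c)"
    by (intro wiener_add wiener_sum wiener_cmult bf wiener_const)
  then show "wiener 1 (cr (bw w c))" by (simp add: bw_def[abs_def])
  have "wiener 1 (\<lambda>x. \<Sum>j\<in>UNIV. of_real (w $ j) * cr (h j) x)"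
    by (intro wiener_sum wiener_cmult wiener_1_h)
  then show "wiener 1 (cr (sw w))" by (simp add: sw_def[abs_def])
qed

definition ff :: "real ^ 'n \<Rightarrow> real \<Rightarrow> real \<Rightarrow> complex" where
  "ff w c x = cr (aw w) x + \<i> * cr (bw w c) x"

lemma ff_trace_type: "trace_type T (- 1) (ff w c)"
proof -
  have cp: "cper (\<lambda>x. cr (af j) x + \<i> * cr (bf j) x)" for j
    by (intro cper_add cper_mult[OF cper_const] wiener_cper[OF af_wiener] wiener_cper[OF bf(1)])
  have "trace_type T (- 1) (\<lambda>x. (\<Sum>j\<in>UNIV. of_real (w $ j) * (cr (af j) x + \<i> * cr (bf j) x)) + \<i> * of_real c)"
    by (intro trace_type_add trace_type_sum trace_type_rmult bf trace_type_const cper_sum cper_mult[OF cper_const] cp cper_const) auto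
  moreover have "(\<Sum>j\<in>UNIV. of_real (w $ j) * (cr (af j) x + \<i> * cr (bf j) x)) + \<i> * of_real c = ff w c x" for x
    by (simp add: ff_def aw_def bw_def algebra_simps sum.distrib sum_distrib_left)
  ultimately show ?thesis by simp
qed

lemma ff_wiener: "wiener 1 (ff w c)"
  unfolding ff_def[abs_def] by (intro wiener_add wiener_cmult aw_wiener bw_wiener)

lemma Uf_wiener: "wiener 1 (cr (Uf w c i))" and Uf_Lam: "Lam T (cr (Uf w c i)) = cr (Vf w c i)"
proof -
  \<comment> \<open>Both factors have sign -1, so \<open>F\<close> has sign 1 and
    \<open>Lam_Re\<close> applies. \<open>Vf\<close> is then \<open>kw w\<close> times
    \<open>lam h\<close> plus the imaginary part of the derivative of \<open>F\<close>.\<close>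
  define F where "F x = ff w c x * phi i x" for x
  have F: "wiener 1 F" "trace_type T 1 F"
    unfolding F_def[abs_def]
    by (intro wiener_mult ff_wiener phi_wiener)
       (use trace_type_mult[OF ff_trace_type ff_wiener phi_trace_type phi_wiener, of w c i] in simp)
  have rdA: "(aw w has_real_derivative rd (aw w) x) (at x)" for x by (rule rd_deriv1[OF aw_wiener])
  have rdB: "(bw w c has_real_derivative rd (bw w c) x) (at x)" for x by (rule rd_deriv1[OF bw_wiener])
  have fdF: "fd F = (\<lambda>x. ff w c x * (of_real (l1 x * h i x + lam x * h1 i x) - \<i> * of_real (h2 i x))
      + (of_real (rd (aw w) x) + \<i> * of_real (rd (bw w c) x)) * phi i x)"
  proof (rule fd_eqI[of 0])
    show "wiener (Suc 0) F" using F(1) unfolding One_nat_def .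
    show "(F has_vector_derivative ff w c x * (of_real (l1 x * h i x + lam x * h1 i x) - \<i> * of_real (h2 i x))
      + (of_real (rd (aw w) x) + \<i> * of_real (rd (bw w c) x)) * phi i x) (at x)" for x
      unfolding F_def[abs_def]
      by (rule has_vector_derivative_mult[OF _ phi_deriv], unfold ff_def[abs_def],
          intro has_vector_derivative_add has_vector_derivative_mult_right has_vector_derivative_of_real rdA rdB)
  qed
  have ReF: "Re (F x) = aw w x * (lam x * h i x) + bw w c x * h1 i x" for x
    by (simp add: F_def ff_def phi_def)
  have U: "cr (Uf w c i) = (\<lambda>x. (of_real (w $ i) + of_real (kw w) * cr (h i) x) + cr (\<lambda>x. Re (F x)) x)"
  proof
    fix x
    have "aw w x * (lam x * h i x) = - (sw w x + kw w) * h i x" using aw_lam[of w x] by (simp add: mult.assoc[symmetric])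
    then have "Uf w c i x = w $ i + kw w * h i x + Re (F x)"
      unfolding ReF Uf_def by (simp add: algebra_simps)
    then show "cr (Uf w c i) x = of_real (w $ i) + of_real (kw w) * cr (h i) x + cr (\<lambda>x. Re (F x)) x"
      by simp
  qed
  have wR: "wiener 1 (cr (\<lambda>x. Re (F x)))"
  proof -
    have "cr (\<lambda>x. Re (F x)) = (\<lambda>x. (1 / 2) * (F x + cnj (F x)))" by (auto simp: complex_eq_iff)
    then show ?thesis by (simp only:) (intro wiener_cmult wiener_add wiener_cnj F)
  qed
  show "wiener 1 (cr (Uf w c i))"
    unfolding U by (intro wiener_add wiener_const wiener_cmult wiener_1_h wR)
  have "Lam T (cr (Uf w c i)) = (\<lambda>x. (0 + of_real (kw w) * cr (\<lambda>x. lam x * h i x) x) + cr (\<lambda>x. Im (fd F x)) x)"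
    unfolding U
    by (subst Lam_add[OF T], intro wiener_add wiener_const wiener_cmult wiener_1_h, rule wR,
        subst Lam_add[OF T], rule wiener_const, intro wiener_cmult wiener_1_h)
       (simp add: Lam_cmult Lam_h Lam_Re[OF T F(2,1)])
  also have "\<dots> = cr (Vf w c i)"
    by (rule ext) (simp add: Vf_def fdF ff_def phi_def algebra_simps)
  finally show "Lam T (cr (Uf w c i)) = cr (Vf w c i)" .
qed

lemma sw_has_deriv: "(sw w has_real_derivative (\<Sum>j\<in>UNIV. w $ j * h1 j x)) (at x)"
  unfolding sw_def[abs_def] by (intro DERIV_sum DERIV_cmult h_deriv)

text \<open>The coefficient of \<open>bw\<close> is, up to sign, \<open>lam\<close> times the
  derivative of \<open>aw * lam + sw\<close>, which is the constant \<open>- kw w\<close>; so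
  neither \<open>c\<close> nor the unknown conjugates survive. The last bracket is the derivative of
  a periodic function.\<close>

lemma Q_integrand:
  "(\<Sum>i\<in>UNIV. Uf w c i x * (Vf w c i x - lam x * Uf w c i x))
    = - lam x * (norm w)\<^sup>2 + 2 * (lam x * (sw w x)\<^sup>2) + kw w * (lam x * sw w x)
      - (rd (aw w) x * (\<Sum>j\<in>UNIV. w $ j * h1 j x) + (\<Sum>j\<in>UNIV. w $ j * h2 j x) * aw w x)"
proof -
  define H where "H = (\<chi> i. h i x)"
  define H1 where "H1 = (\<chi> i. h1 i x)"
  define H2 where "H2 = (\<chi> i. h2 i x)"
  define L where "L = lam x"
  define s where "s = sw w x"
  define s1 where "s1 = (\<Sum>j\<in>UNIV. w $ j * h1 j x)"
  define s2 where "s2 = (\<Sum>j\<in>UNIV. w $ j * h2 j x)"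
  define a where "a = aw w x"
  define a' where "a' = rd (aw w) x"
  define b where "b = bw w c x"
  define b' where "b' = rd (bw w c) x"
  define m where "m = l1 x"
  \<comment> \<open>The coefficient of the vector \<open>H\<close> in
    \<open>Vf - lam Uf\<close>.\<close>
  define p where "p = kw w * L + b' * L + b * m + L * s"
  have ip: "inner H H = 1" "inner H H1 = 0" "inner H1 H = 0" "inner H1 H1 = L\<^sup>2" "inner H H2 = - L\<^sup>2" "inner H1 H2 = L * m"
      "inner w H = s" "inner H w = s" "inner w H1 = s1" "inner H1 w = s1" "inner w H2 = s2"
    using sum_h_sq[of x] sum_h_h1[of x] sum_h1_sq[of x] sum_h_h2[of x] sum_h1_h2[of x]
    by (simp_all add: inner_vec_def H_def H1_def H2_def L_def m_def s_def s1_def s2_def sw_def power2_eq_square mult.commute)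
  have ww: "inner w w = (norm w)\<^sup>2" by (simp add: power2_norm_eq_inner)
  have der: "a' * L + a * m = - s1"
  proof -
    have 1: "((\<lambda>x. aw w x * lam x) has_real_derivative a' * L + m * a) (at x)"
      unfolding a'_def L_def m_def a_def
      by (rule DERIV_mult[OF rd_deriv1[OF aw_wiener] lam_deriv])
    have 2: "((\<lambda>x. aw w x * lam x) has_real_derivative - s1) (at x)"
    proof -
      have "((\<lambda>x. - (sw w x + kw w)) has_real_derivative - (s1 + 0)) (at x)"
        unfolding s1_def by (intro DERIV_minus DERIV_add sw_has_deriv DERIV_const)
      then show ?thesis unfolding aw_lam by simp
    qed
    show ?thesis using DERIV_unique[OF 1 2] by (simp add: mult.commute)
  qed
  have aL: "a * L = - (s + kw w)" using aw_lam[of w x] by (simp add: a_def L_def s_def)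
  have "(\<Sum>i\<in>UNIV. Uf w c i x * (Vf w c i x - lam x * Uf w c i x))
      = inner (w - s *\<^sub>R H + b *\<^sub>R H1) (p *\<^sub>R H - a' *\<^sub>R H1 - a *\<^sub>R H2 - L *\<^sub>R w)"
    unfolding inner_vec_def
    by (intro sum.cong refl) (simp add: Uf_def Vf_def H_def H1_def H2_def L_def s_def a_def a'_def b_def b'_def m_def p_def algebra_simps)
  also have "\<dots> = (p * s - a' * s1 - a * s2 - L * (norm w)\<^sup>2) - s * (p + a * L\<^sup>2 - L * s)
      + b * (- a' * L\<^sup>2 - a * (L * m) - L * s1)"
    by (simp add: inner_add_left inner_add_right inner_diff_left inner_diff_right ip ww algebra_simps del: inner_same_Basis)
  also have "b * (- a' * L\<^sup>2 - a * (L * m) - L * s1) = - b * L * (a' * L + a * m + s1)"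
    by (simp add: algebra_simps power2_eq_square)
  also have "\<dots> = 0" using der by simp
  also have "s * (p + a * L\<^sup>2 - L * s) = s * p + s * (a * L) * L - L * s * s"
    by (simp add: algebra_simps power2_eq_square)
  finally show ?thesis
    unfolding aL by (simp add: L_def[symmetric] s_def[symmetric] s1_def[symmetric] s2_def[symmetric]
        a_def[symmetric] a'_def[symmetric] algebra_simps power2_eq_square)
qed

lemma Vf_cper: "cper (Vf w c i)" and Uf_cper: "cper (Uf w c i)"
proof -
  show "cper (Uf w c i)" by (rule cper_of_cr[OF wiener_cper[OF Uf_wiener]])
  have "cper (Lam T (cr (Uf w c i)))"
    by (rule wiener_cper[OF wiener_Lam1[OF T Uf_wiener]])
  then show "cper (Vf w c i)" unfolding Uf_Lam by (rule cper_of_cr)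
qed

lemma Q_total:
  "(\<Sum>i\<in>UNIV. II (\<lambda>x. Uf w c i x * (Vf w c i x - lam x * Uf w c i x)))
    = 2 * II (\<lambda>x. lam x * (sw w x)\<^sup>2) - (norm w)\<^sup>2 * II lam"
proof -
  define d where "d x = rd (aw w) x * (\<Sum>j\<in>UNIV. w $ j * h1 j x) + (\<Sum>j\<in>UNIV. w $ j * h2 j x) * aw w x" for x
  have swc: "cper (sw w)" by (rule cper_of_cr[OF wiener_cper[OF sw_wiener]])
  have d: "(d has_integral 0) {0..2 * pi}"
  proof (rule periodic_integral_deriv_zero)
    have "((\<lambda>x. \<Sum>j\<in>UNIV. w $ j * h1 j x) has_real_derivative (\<Sum>j\<in>UNIV. w $ j * h2 j x)) (at x)" for x
      by (intro DERIV_sum DERIV_cmult h1_deriv)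
    then show "((\<lambda>x. aw w x * (\<Sum>j\<in>UNIV. w $ j * h1 j x)) has_real_derivative d x) (at x)" for x
      unfolding d_def by (intro DERIV_mult rd_deriv1 aw_wiener)
    have "cper (\<lambda>x. aw w x * (\<Sum>j\<in>UNIV. w $ j * h1 j x))"
      by (intro cper_mult cper_sum cper_mult[OF cper_const] h1_cper cper_of_cr[OF wiener_cper[OF aw_wiener]])
    from cper_shift[OF this, of 0]
    show "aw w (2 * pi) * (\<Sum>j\<in>UNIV. w $ j * h1 j (2 * pi)) = aw w 0 * (\<Sum>j\<in>UNIV. w $ j * h1 j 0)" by simp
  qed
  have lsw: "II (\<lambda>x. lam x * sw w x) = 0"
  proof -
    have "II (\<lambda>x. lam x * sw w x) = II (\<lambda>x. \<Sum>j\<in>UNIV. w $ j * (lam x * h j x))"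
      by (simp add: sw_def sum_distrib_left mult_ac)
    also have "\<dots> = (\<Sum>j\<in>UNIV. II (\<lambda>x. w $ j * (lam x * h j x)))"
      by (rule integral_sum) (auto intro!: cper_integrable cper_mult[OF cper_const] lam_h_cper)
    also have "\<dots> = 0" by (simp only: integral_mult_right II_lam_h mult_zero_right sum.neutral_const)
    finally show ?thesis .
  qed
  have "(\<Sum>i\<in>UNIV. II (\<lambda>x. Uf w c i x * (Vf w c i x - lam x * Uf w c i x)))
      = II (\<lambda>x. \<Sum>i\<in>UNIV. Uf w c i x * (Vf w c i x - lam x * Uf w c i x))"
    by (rule integral_sum[symmetric]) (auto intro!: cper_integrable cper_mult cper_diff Uf_cper Vf_cper lam_cper)
  also have "\<dots> = II (\<lambda>x. (- (norm w)\<^sup>2 * lam x + 2 * (lam x * (sw w x)\<^sup>2)) + kw w * (lam x * sw w x) - d x)"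
    unfolding Q_integrand d_def by (simp add: mult.commute)
  also have "\<dots> = (- (norm w)\<^sup>2 * II lam + 2 * II (\<lambda>x. lam x * (sw w x)\<^sup>2)) + kw w * II (\<lambda>x. lam x * sw w x) - 0"
    by (intro integral_unique has_integral_diff has_integral_add has_integral_mult_right d integrable_integral cper_integrable
        lam_cper cper_mult lam_cper swc) (auto simp: power2_eq_square intro!: cper_mult lam_cper swc)
  finally show ?thesis using lsw by simp
qed

end

section \<open>The boundary density is constant\<close>

lemma Lam_real:
  assumes T: "T > 0" and g: "wiener 1 (cr g)"
  shows "\<exists>V. Lam T (cr g) = cr V"
proof -
  note L = wiener_cper[OF wiener_Lam1[OF T g]]
  have "(\<lambda>x. cnj (Lam T (cr g) x)) = Lam T (cr g)"
  proof (rule fc_unique)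
    show "cper (\<lambda>x. cnj (Lam T (cr g) x))" "cper (Lam T (cr g))" by (intro cper_cnj L)+
    show "fc (\<lambda>x. cnj (Lam T (cr g) x)) k = fc (Lam T (cr g)) k" for k
      by (simp add: fc_cnj fc_Lam1[OF T g] fc_cr_minus)
  qed
  then have e: "Lam T (cr g) = cr (\<lambda>x. Re (Lam T (cr g) x))"
    by (auto simp: complex_eq_iff fun_eq_iff)
  show ?thesis by (rule exI, rule e)
qed

locale fb_gap = fb_mobius u T for u :: "real \<times> real \<Rightarrow> real ^ 'n" and T +
  assumes gap: "\<And>\<sigma>. 0 < \<sigma> \<Longrightarrow> \<sigma> < 1 \<Longrightarrow> \<not> steklov_eigenvalue T u \<sigma>"
begin

text \<open>A solution forbidden in \<open>spectral_gap\<close> would extend to a Steklov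
  eigenfunction with eigenvalue below 1, contrary to \<open>gap\<close>.\<close>

lemma rayleigh:
  assumes g: "wiener 1 (cr g)" and V: "Lam T (cr g) = cr V" and mean: "II (\<lambda>x. lam x * g x) = 0"
  shows "0 \<le> II (\<lambda>x. g x * (V x - lam x * g x))"
proof -
  have l: "wiener 1 (cr lam)" by (rule wiener_mono[OF lam_wiener]) simp
  have gc: "cper g" by (rule cper_of_cr[OF wiener_cper[OF g]])
  have Vc: "cper V" using wiener_cper[OF wiener_Lam1[OF T g]] unfolding V by (rule cper_of_cr)
  have "II (\<lambda>x. lam x * (g x)\<^sup>2) \<le> Re (integral {0..2 * pi} (\<lambda>x. Lam T (cr g) x * cr g x))"
  proof (rule spectral_gap[OF T l lam_pos _ g mean])
    fix \<sigma> c
    assume s: "0 < \<sigma>" "\<sigma> < 1" and c: "wsum 2 c" "\<exists>k. c k \<noteq> 0"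
      and eq: "\<And>\<theta>. fser (\<lambda>k. of_real (mu T k) * c k) \<theta> = of_real (\<sigma> * lam \<theta>) * fser c \<theta>"
    from c(2) obtain k0 where k0: "c k0 \<noteq> 0" by blast
    have "norm (dt T u (- T, \<theta>)) = norm (dt T u (T, \<theta> + pi))" for \<theta>
      using dt_sym(1)[OF T sym C(1) TT, of "\<theta>"] by simp
    from steklov_from_series[OF T c(1) k0 eq[unfolded lam_def] this] gap[OF s]
    show False by simp
  qed
  also have "integral {0..2 * pi} (\<lambda>x. Lam T (cr g) x * cr g x) = of_real (II (\<lambda>x. V x * g x))"
    using integral_cr[OF cper_mult[OF Vc gc]] by (simp add: V)
  finally have "0 \<le> II (\<lambda>x. V x * g x) - II (\<lambda>x. lam x * (g x)\<^sup>2)" by simp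
  also have "\<dots> = II (\<lambda>x. V x * g x - lam x * (g x)\<^sup>2)"
    by (rule integral_diff[symmetric]) (auto simp: power2_eq_square intro!: cper_integrable cper_mult Vc gc lam_cper)
  also have "(\<lambda>x. V x * g x - lam x * (g x)\<^sup>2) = (\<lambda>x. g x * (V x - lam x * g x))"
    by (auto simp: power2_eq_square algebra_simps)
  finally show ?thesis .
qed

lemma linear_test_means: "linear (\<lambda>p. \<chi> i. II (\<lambda>x. lam x * Uf (fst p) (snd p) i x) :: real ^ 'n)"
proof (rule linearI)
  fix p q :: "(real ^ 'n) \<times> real" and r :: real
  have int: "(\<lambda>x. lam x * Uf w c i x) integrable_on {0..2 * pi}" for w c i
    by (intro cper_integrable cper_mult lam_cper Uf_cper)
  have "lam x * Uf (fst (p + q)) (snd (p + q)) i x = lam x * Uf (fst p) (snd p) i x + lam x * Uf (fst q) (snd q) i x" for i x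
    by (simp add: Uf_def sw_def bw_def sum.distrib algebra_simps)
  then show "(\<chi> i. II (\<lambda>x. lam x * Uf (fst (p + q)) (snd (p + q)) i x)) =
      (\<chi> i. II (\<lambda>x. lam x * Uf (fst p) (snd p) i x)) + (\<chi> i. II (\<lambda>x. lam x * Uf (fst q) (snd q) i x))"
    by (simp add: vec_eq_iff integral_add[OF int int])
  have "lam x * Uf (fst (r *\<^sub>R p)) (snd (r *\<^sub>R p)) i x = r * (lam x * Uf (fst p) (snd p) i x)" for i x
    by (simp add: Uf_def sw_def bw_def sum_distrib_left algebra_simps)
  then show "(\<chi> i. II (\<lambda>x. lam x * Uf (fst (r *\<^sub>R p)) (snd (r *\<^sub>R p)) i x)) =
      r *\<^sub>R (\<chi> i. II (\<lambda>x. lam x * Uf (fst p) (snd p) i x))"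
    by (simp only: vec_eq_iff vec_lambda_beta vector_scaleR_component integral_mult_right real_scaleR_def simp_thms)
qed

text \<open>The test fields form an \<open>n + 1\<close> dimensional family and the mean constraint has \<open>n\<close>
  components, so some nonzero field is admissible; it must have \<open>w = 0\<close>.\<close>

lemma II_lam_h1: "II (\<lambda>x. lam x * h1 i x) = 0"
proof -
  define \<Psi> where "\<Psi> = (\<lambda>p. \<chi> i. II (\<lambda>x. lam x * Uf (fst p) (snd p) i x) :: real ^ 'n)"
  have lin: "linear \<Psi>" unfolding \<Psi>_def by (rule linear_test_means)
  have "\<not> inj \<Psi>"
  proof
    assume "inj \<Psi>"
    then have "dim (range \<Psi>) = dim (UNIV :: ((real ^ 'n) \<times> real) set)"
      by (intro dim_image_eq lin) (auto simp: inj_on_def)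
    moreover have "dim (range \<Psi>) \<le> DIM(real ^ 'n)" by (rule dim_subset_UNIV)
    ultimately show False by (simp add: DIM_prod)
  qed
  then obtain p where p: "\<Psi> p = 0" "p \<noteq> 0"
    using linear_injective_0[OF lin] by blast
  obtain w c where wc: "p = (w, c)" by (cases p)
  have mean: "II (\<lambda>x. lam x * Uf w c j x) = 0" for j
    using arg_cong[OF p(1), of "\<lambda>v. v $ j"] by (simp add: \<Psi>_def wc)
  have w: "w = 0"
  proof (rule ccontr)
    assume "w \<noteq> 0"
    from strict_area[OF this] have "2 * II (\<lambda>x. lam x * (sw w x)\<^sup>2) - (norm w)\<^sup>2 * II lam < 0"
      by (simp add: sw_def[abs_def])
    moreover have "0 \<le> (\<Sum>i\<in>UNIV. II (\<lambda>x. Uf w c i x * (Vf w c i x - lam x * Uf w c i x)))"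
      by (intro sum_nonneg rayleigh Uf_wiener Uf_Lam mean)
    ultimately show False unfolding Q_total by linarith
  qed
  \<comment> \<open>The kernel vector is \<open>(0, c)\<close> and its field is \<open>c\<close>
    times \<open>h1\<close>, whose admissibility is the claim.\<close>
  then have c: "c \<noteq> 0" using p(2) wc by (auto simp: zero_prod_def)
  have "lam x * Uf w c i x = c * (lam x * h1 i x)" for x
    by (simp add: Uf_def w sw_def bw_def)
  then have "c * II (\<lambda>x. lam x * h1 i x) = 0" using mean[of i] by (simp only: integral_mult_right)
  then show ?thesis using c by simp
qed

text \<open>By \<open>Lam_h1\<close> this is the residual of \<open>h1 i\<close> in the eigenvalue
  equation, that is, \<open>Lam h' - lam h'\<close>.\<close>

definition var1 :: "'n \<Rightarrow> real \<Rightarrow> real" where "var1 i x = l1 x * h i x"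

lemma lam_h_wiener: "wiener 1 (cr (\<lambda>x. lam x * h i x))"
proof -
  have "wiener 1 (\<lambda>x. cr lam x * cr (h i) x)"
    by (intro wiener_mult wiener_1_h wiener_mono[OF lam_wiener]) simp
  then show ?thesis by simp
qed

lemma lam_h_deriv: "((\<lambda>x. lam x * h i x) has_real_derivative var1 i x + lam x * h1 i x) (at x)"
  using DERIV_mult[OF lam_deriv h_deriv[of i x]] by (simp add: var1_def mult.commute)

lemma var1_wiener: "wiener 1 (cr (var1 i))"
proof -
  have "wiener 1 (\<lambda>x. cr l1 x * cr (h i) x)"
    by (intro wiener_mult wiener_1_h l1_wiener)
  then show ?thesis by (simp add: var1_def[abs_def])
qed

lemma wiener_1_h1: "wiener 1 (cr (h1 i))"
  by (rule wiener_mono[OF h1_wiener]) simp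

text \<open>A Fourier multiplier commutes with the angular derivative, so
  \<open>Lam h' = (Lam h)' = (lam h)'\<close>.\<close>

lemma Lam_h1: "Lam T (cr (h1 i)) = cr (\<lambda>x. var1 i x + lam x * h1 i x)"
proof (rule fc_unique)
  note w = wiener_1_h1[of i]
  have 1: "fd (cr (\<lambda>x. lam x * h i x)) = cr (\<lambda>x. var1 i x + lam x * h1 i x)"
    by (rule fd_eqI[of 0], use lam_h_wiener in simp, rule has_vector_derivative_of_real[OF lam_h_deriv])
  have 2: "fd (cr (h i)) = cr (h1 i)"
    by (rule fd_eqI[of 0], use wiener_1_h in simp, rule has_vector_derivative_of_real[OF h_deriv])
  show "cper (Lam T (cr (h1 i)))" by (rule wiener_cper[OF wiener_Lam1[OF T w]])
  show "cper (cr (\<lambda>x. var1 i x + lam x * h1 i x))"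
    by (intro cper_of_real cper_add cper_mult lam_cper h1_cper cper_of_cr[OF wiener_cper[OF var1_wiener]])
  show "fc (Lam T (cr (h1 i))) k = fc (cr (\<lambda>x. var1 i x + lam x * h1 i x)) k" for k
    unfolding 1[symmetric] fc_Lam1[OF T w] fc_fd1[OF lam_h_wiener] fc_lam_h
    unfolding 2[symmetric] fc_fd1[OF wiener_1_h] by simp
qed

lemma var1_cper: "cper (var1 i)"
  by (rule cper_of_cr[OF wiener_cper[OF var1_wiener]])

text \<open>Each component is nonnegative by the Rayleigh inequality, and their sum vanishes because
  \<open>h\<close> is orthogonal to \<open>h'\<close>.\<close>

lemma II_h1_var1: "II (\<lambda>x. h1 i x * var1 i x) = 0"
proof -
  have nn: "0 \<le> II (\<lambda>x. h1 j x * var1 j x)" for j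
    using rayleigh[OF wiener_1_h1 Lam_h1 II_lam_h1, of j] by simp
  have "(\<Sum>j\<in>UNIV. II (\<lambda>x. h1 j x * var1 j x)) = II (\<lambda>x. \<Sum>j\<in>UNIV. h1 j x * var1 j x)"
    by (rule integral_sum[symmetric]) (auto intro!: cper_integrable cper_mult h1_cper var1_cper)
  also have "(\<lambda>x. \<Sum>j\<in>UNIV. h1 j x * var1 j x) = (\<lambda>x. l1 x * (\<Sum>j\<in>UNIV. h j x * h1 j x))"
    by (simp add: var1_def sum_distrib_left mult_ac)
  also have "II \<dots> = 0" by (simp add: sum_h_h1)
  finally show ?thesis using sum_nonneg_eq_0_iff[of UNIV "\<lambda>j. II (\<lambda>x. h1 j x * var1 j x)"] nn by simp
qed

lemma II_var1: "II (var1 i) = 0"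
proof -
  have "((\<lambda>x. var1 i x + lam x * h1 i x) has_integral 0) {0..2 * pi}"
    by (rule periodic_integral_deriv_zero[OF lam_h_deriv]) (use cper_shift[OF lam_h_cper, of 0 i] in simp)
  then have "II (\<lambda>x. var1 i x + lam x * h1 i x) = 0" by (rule integral_unique)
  then show ?thesis
    by (subst (asm) integral_add) (auto simp: II_lam_h1 intro!: cper_integrable cper_mult lam_cper h1_cper var1_cper)
qed

text \<open>By the Rayleigh inequality \<^term>\<open>h1 i\<close> minimizes a nonnegative quadratic form with value
  \<open>0\<close>, so its first variation \<^term>\<open>var1 i\<close> is orthogonal to every admissible direction.\<close>

lemma var1_zero: "var1 i x = 0"
proof -
  \<comment> \<open>Subtracting the weighted mean makes \<open>var1 i\<close> an admissible
    direction; the constant disappears again at the end because \<open>II_var1\<close> says that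
    \<open>var1 i\<close> has mean zero.\<close>
  define m where "m = II (\<lambda>x. lam x * var1 i x) / II lam"
  define \<psi> where "\<psi> x = var1 i x + (- m)" for x
  have \<psi>w: "wiener 1 (cr \<psi>)"
  proof -
    have "wiener 1 (\<lambda>x. cr (var1 i) x + of_real (- m))" by (intro wiener_add wiener_const var1_wiener)
    then show ?thesis by (simp add: \<psi>_def[abs_def])
  qed
  obtain V where V: "Lam T (cr \<psi>) = cr V" using Lam_real[OF T \<psi>w] by blast
  have \<psi>c: "cper \<psi>" by (rule cper_of_cr[OF wiener_cper[OF \<psi>w]])
  have Vc: "cper V" using wiener_cper[OF wiener_Lam1[OF T \<psi>w]] unfolding V by (rule cper_of_cr)
  note cp = \<psi>c Vc lam_cper h1_cper var1_cper
  have m\<psi>: "II (\<lambda>x. lam x * \<psi> x) = 0"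
  proof -
    have "(\<lambda>x. lam x * \<psi> x) = (\<lambda>x. lam x * var1 i x + (- m) * lam x)" by (auto simp: \<psi>_def algebra_simps)
    then have "II (\<lambda>x. lam x * \<psi> x) = II (\<lambda>x. lam x * var1 i x) + II (\<lambda>x. (- m) * lam x)"
      by (simp only:) (intro integral_add cper_integrable cper_mult cp cper_const)
    also have "\<dots> = 0" using II_lam_pos by (simp add: m_def)
    finally show ?thesis .
  qed
  define D where "D x = V x - lam x * \<psi> x" for x
  have Dc: "cper D" unfolding D_def[abs_def] by (intro cper_diff cper_mult cp)
  \<comment> \<open>Symmetry of \<open>Lam\<close> transfers the residual operator from
    \<open>\<psi>\<close> to \<open>h1 i\<close>.\<close>
  have h1D: "II (\<lambda>x. h1 i x * D x) = II (\<lambda>x. \<psi> x * var1 i x)"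
  proof -
    have "complex_of_real (II (\<lambda>x. V x * h1 i x)) = of_real (II (\<lambda>x. (var1 i x + lam x * h1 i x) * \<psi> x))"
      using Lam_sym[OF T \<psi>w wiener_1_h1[of i]] integral_cr[OF cper_mult[OF Vc h1_cper[of i]]]
        integral_cr[OF cper_mult[OF cper_add[OF var1_cper cper_mult[OF lam_cper h1_cper]] \<psi>c], of i i]
      unfolding V Lam_h1 by simp
    then have e: "II (\<lambda>x. V x * h1 i x) = II (\<lambda>x. (var1 i x + lam x * h1 i x) * \<psi> x)" by (simp only: of_real_eq_iff)
    have "(\<lambda>x. h1 i x * D x) = (\<lambda>x. V x * h1 i x - lam x * h1 i x * \<psi> x)" by (auto simp: D_def algebra_simps)
    then have "II (\<lambda>x. h1 i x * D x) = II (\<lambda>x. V x * h1 i x) - II (\<lambda>x. lam x * h1 i x * \<psi> x)"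
      by (simp only:) (intro integral_diff cper_integrable cper_mult cp)
    also have "\<dots> = II (\<lambda>x. (var1 i x + lam x * h1 i x) * \<psi> x - lam x * h1 i x * \<psi> x)"
      unfolding e by (intro integral_diff[symmetric] cper_integrable cper_mult cper_add cp)
    also have "(\<lambda>x. (var1 i x + lam x * h1 i x) * \<psi> x - lam x * h1 i x * \<psi> x) = (\<lambda>x. \<psi> x * var1 i x)"
      by (auto simp: algebra_simps)
    finally show ?thesis .
  qed
  have "II (\<lambda>x. \<psi> x * var1 i x) = 0"
  proof (rule nonneg_quadratic_linear_coeff)
    fix e :: real
    define g where "g x = h1 i x + e * \<psi> x" for x
    have gw: "wiener 1 (\<lambda>x. cr (h1 i) x + of_real e * cr \<psi> x)"
      by (intro wiener_add wiener_cmult wiener_1_h1 \<psi>w)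
    have ge: "cr g = (\<lambda>x. cr (h1 i) x + of_real e * cr \<psi> x)" by (simp add: g_def[abs_def])
    have Lg: "Lam T (cr g) = cr (\<lambda>x. (var1 i x + lam x * h1 i x) + e * V x)"
      unfolding ge by (subst Lam_add[OF T wiener_1_h1 wiener_cmult[OF \<psi>w]]) (simp add: Lam_cmult V Lam_h1)
    have "(\<lambda>x. lam x * g x) = (\<lambda>x. lam x * h1 i x + e * (lam x * \<psi> x))" by (auto simp: g_def algebra_simps)
    then have "II (\<lambda>x. lam x * g x) = II (\<lambda>x. lam x * h1 i x) + II (\<lambda>x. e * (lam x * \<psi> x))"
      by (simp only:) (intro integral_add cper_integrable cper_mult cp cper_const)
    then have mean: "II (\<lambda>x. lam x * g x) = 0" by (simp add: II_lam_h1 m\<psi>)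
    have "0 \<le> II (\<lambda>x. g x * ((var1 i x + lam x * h1 i x) + e * V x - lam x * g x))"
      by (rule rayleigh[OF _ Lg mean]) (unfold ge, rule gw)
    also have "(\<lambda>x. g x * ((var1 i x + lam x * h1 i x) + e * V x - lam x * g x))
        = (\<lambda>x. (h1 i x * var1 i x + e * (\<psi> x * var1 i x)) + (e * (h1 i x * D x) + e\<^sup>2 * (\<psi> x * D x)))"
      by (auto simp: g_def D_def algebra_simps power2_eq_square)
    also have "II \<dots> = (II (\<lambda>x. h1 i x * var1 i x) + e * II (\<lambda>x. \<psi> x * var1 i x))
        + (e * II (\<lambda>x. h1 i x * D x) + e\<^sup>2 * II (\<lambda>x. \<psi> x * D x))"
      by (intro integral_unique has_integral_add has_integral_mult_right integrable_integral cper_integrable cper_mult cp Dc)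
    finally show "0 \<le> 2 * e * II (\<lambda>x. \<psi> x * var1 i x) + e\<^sup>2 * II (\<lambda>x. \<psi> x * D x)"
      by (simp add: II_h1_var1 h1D)
  qed
  moreover have "II (\<lambda>x. \<psi> x * var1 i x) = II (\<lambda>x. var1 i x * var1 i x) + II (\<lambda>x. (- m) * var1 i x)"
    unfolding \<psi>_def distrib_right
    by (intro integral_add cper_integrable cper_mult cp cper_const)
  ultimately have "II (\<lambda>x. var1 i x * var1 i x) = 0" by (simp add: II_var1)
  then have "var1 i x * var1 i x = 0"
    by (intro integral_pos_zero[OF cper_mult[OF var1_cper var1_cper]]) simp_all
  then show ?thesis by simp
qed

text \<open>\<open>h\<close> has length 1, so \<open>l1 h\<close> can vanish only if
  \<open>l1\<close> does.\<close>

theorem lam_const: "\<exists>l. \<forall>x. lam x = l"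
proof -
  have "l1 x = 0" for x
  proof -
    have "(\<Sum>i\<in>UNIV. (var1 i x)\<^sup>2) = (l1 x)\<^sup>2 * (\<Sum>i\<in>UNIV. (h i x)\<^sup>2)"
      by (simp add: var1_def power_mult_distrib sum_distrib_left)
    then show ?thesis by (simp add: var1_zero sum_h_sq)
  qed
  then have "lam x = lam 0" for x
    using DERIV_isconst_all[of lam x 0] lam_deriv by simp
  then show ?thesis by blast
qed

end

section \<open>Classification\<close>

lemma mu_2: "mu T 2 = 2 * tanh (2 * T)"
  by (simp add: mu_def XS_def XC_def sg_def tanh_altdef field_simps)

text \<open>For even \<open>k\<close> both factors of \<open>k tanh (k T)\<close> exceed those at 2;
  for odd \<open>k\<close> the value \<open>k coth (k T)\<close> is at least 3, while
  \<open>mu T 2 < 2\<close>.\<close>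

lemma mu_high:
  assumes T: "T > 0" and k: "k \<ge> 3"
  shows "mu T 2 < mu T k"
proof (cases "even k")
  case True
  then have k4: "4 \<le> k" using k by presburger
  have "mu T k = of_int k * tanh (of_int k * T)"
    using True by (simp add: mu_def XS_def XC_def sg_def tanh_altdef)
  moreover have "tanh (2 * T) < tanh (of_int k * T)" using k T by simp
  moreover have "0 < tanh (2 * T)" using T by simp
  ultimately have "2 * tanh (2 * T) < of_int k * tanh (of_int k * T)"
    using k by (intro mult_strict_mono) auto
  then show ?thesis by (simp add: mu_2 \<open>mu T k = _\<close>)
next
  case False
  have "exp (- (of_int k * T)) < exp (of_int k * T)" using T k by (simp add: mult_pos_pos)
  then have "1 \<le> XS k T / XC k T"
    using False by (simp add: XS_def XC_def sg_def)
  then have "of_int k * 1 \<le> of_int k * (XS k T / XC k T)"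
    using k by (intro mult_left_mono) auto
  then have "of_int k \<le> mu T k" by (simp add: mu_def)
  moreover have "mu T 2 < 2" using tanh_real_lt_1[of "2 * T"] by (simp add: mu_2)
  moreover have "3 \<le> real_of_int k" using k by simp
  ultimately show ?thesis by linarith
qed

text \<open>\<open>XC 1\<close> and \<open>XC 2\<close> are twice \<open>sinh t\<close> and
  \<open>cosh (2 * t)\<close>, and a mode absent on the boundary is absent inside because
  \<open>XC k T\<close> is nonzero.\<close>

lemma low_modes:
  fixes f :: "real \<times> real \<Rightarrow> real"
  assumes T: "T > 0" and sym: "mobius_sym T f" and harm: "harmonic_strip T f"
    and zero: "\<And>k. \<bar>k\<bar> \<noteq> 1 \<Longrightarrow> \<bar>k\<bar> \<noteq> 2 \<Longrightarrow> fc (\<lambda>\<theta>. of_real (f (T, \<theta>))) k = 0"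
  shows "\<exists>a b c d. \<forall>t\<in>{-T..T}. \<forall>\<theta>. f (t, \<theta>)
    = sinh t * (a * cos \<theta> + b * sin \<theta>) + cosh (2 * t) * (c * cos (2 * \<theta>) + d * sin (2 * \<theta>))"
proof -
  have TT: "T \<in> {-T..T}" using T by auto
  have cont: "continuous_on (strip T) f" using harm by (auto simp: harmonic_strip_def C2_strip_def C1_strip_def)
  have hc: "\<exists>\<alpha>. \<forall>t\<in>{-T..T}. fc (\<lambda>\<theta>. of_real (f (t, \<theta>))) k = \<alpha> * of_real (XC k t)" for k
    by (rule harmonic_coeffs[OF T sym harm, of k]) auto
  obtain A' where A': "\<forall>t\<in>{-T..T}. fc (\<lambda>\<theta>. of_real (f (t, \<theta>))) 1 = A' * of_real (XC 1 t)"
    using hc[of 1] by (rule exE)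
  obtain B' where B': "\<forall>t\<in>{-T..T}. fc (\<lambda>\<theta>. of_real (f (t, \<theta>))) 2 = B' * of_real (XC 2 t)"
    using hc[of 2] by (rule exE)
  have other: "fc (\<lambda>\<theta>. of_real (f (t, \<theta>))) k = 0" if k: "\<bar>k\<bar> \<noteq> 1" "\<bar>k\<bar> \<noteq> 2" and t: "t \<in> {-T..T}" for k t
  proof -
    obtain \<alpha> where \<alpha>: "\<forall>t\<in>{-T..T}. fc (\<lambda>\<theta>. of_real (f (t, \<theta>))) k = \<alpha> * of_real (XC k t)"
      using hc[of k] by (rule exE)
    have "\<alpha> = 0" using bspec[OF \<alpha> TT] zero[OF k] XC_nz[OF T, of k] by simp
    then show ?thesis using bspec[OF \<alpha> t] by simp
  qed
  define A where "A = 2 * A'"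
  define B where "B = 2 * B'"
  have "f (t, \<theta>) = sinh t * (2 * Re A * cos \<theta> + (- 2 * Im A) * sin \<theta>)
      + cosh (2 * t) * (2 * Re B * cos (2 * \<theta>) + (- 2 * Im B) * sin (2 * \<theta>))" if t: "t \<in> {-T..T}" for t \<theta>
  proof -
    define g where "g = (\<lambda>\<theta>. of_real (sinh t) * (A * mode 1 \<theta> + cnj A * mode (- 1) \<theta>)
        + of_real (cosh (2 * t)) * (B * mode 2 \<theta> + cnj B * mode (- 2) \<theta>))"
    have XC1: "XC 1 t = 2 * sinh t" and XC2: "XC 2 t = 2 * cosh (2 * t)"
      by (simp_all add: XC_def sg_def sinh_def cosh_def)
    have gc: "cper g" unfolding g_def by (intro cper_add cper_mult cper_mode cper_const)
    have fcg: "fc g k = of_real (sinh t) * (A * (if k = 1 then 1 else 0) + cnj A * (if k = - 1 then 1 else 0))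
        + of_real (cosh (2 * t)) * (B * (if k = 2 then 1 else 0) + cnj B * (if k = - 2 then 1 else 0))" for k
      unfolding g_def
      by (simp add: fc_add fc_cmult fc_mode cper_add cper_mult)
    have pos: "fc (\<lambda>\<theta>. of_real (f (t, \<theta>))) k = fc g k" if "k \<ge> 0" for k
      using bspec[OF A' t] bspec[OF B' t] other[OF _ _ t, of k] that
      unfolding fcg by (cases "k = 1"; cases "k = 2") (simp_all add: A_def B_def XC1 XC2)
    have "(\<lambda>\<theta>. complex_of_real (f (t, \<theta>))) = g"
    proof (rule fc_unique[OF _ gc])
      show "cper (\<lambda>\<theta>. complex_of_real (f (t, \<theta>)))"
        by (rule cper_slice[OF cont t mobius_shift(2)[OF sym t]])
      show "fc (\<lambda>\<theta>. of_real (f (t, \<theta>))) k = fc g k" for k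
      proof (cases "k \<ge> 0")
        case False
        have "fc g k = cnj (fc g (- k))" unfolding fcg by auto
        then show ?thesis
          using pos[of "- k"] False fc_cr_minus[of "\<lambda>\<theta>. f (t, \<theta>)" "- k"] by simp
      qed (rule pos)
    qed
    then have "f (t, \<theta>) = Re (g \<theta>)" by (metis Re_complex_of_real)
    also have "\<dots> = sinh t * (2 * Re A * cos \<theta> + (- 2 * Im A) * sin \<theta>)
      + cosh (2 * t) * (2 * Re B * cos (2 * \<theta>) + (- 2 * Im B) * sin (2 * \<theta>))"
      by (simp add: g_def mode_def algebra_simps)
    finally show ?thesis .
  qed
  then show ?thesis by blast
qed

text \<open>On the positive axis \<open>coth\<close> decreases and \<open>tanh\<close> increases
  strictly, so the equation has at most one solution; existence is supplied by the band under
  study.\<close>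

lemma T0_eqI:
  assumes T: "T > 0" and eq: "cosh T / sinh T = 2 * tanh (2 * T)"
  shows "T0 = T"
  unfolding T0_def
proof (rule the_equality)
  show "T > 0 \<and> cosh T / sinh T = 2 * tanh (2 * T)" using assms by blast
  have less: "cosh b / sinh b < cosh a / sinh a \<and> tanh (2 * a) < tanh (2 * b)" if "0 < a" "a < b" for a b :: real
  proof
    \<comment> \<open>After clearing denominators the difference of the two quotients is
      \<open>sinh (b - a)\<close>.\<close>
    have "0 < sinh (b - a)" using that by simp
    then show "cosh b / sinh b < cosh a / sinh a"
      using that by (simp add: sinh_diff divide_simps mult.commute)
    show "tanh (2 * a) < tanh (2 * b)" using that by simp
  qed
  fix t :: real assume "t > 0 \<and> cosh t / sinh t = 2 * tanh (2 * t)"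
  then show "t = T" using less[of t T] less[of T t] assms by (cases t T rule: linorder_cases) auto
qed

lemma vector_4 [simp]:
  "(vector [a, b, c, d] :: 'a::zero ^ 4) $ 1 = a"
  "(vector [a, b, c, d] :: 'a::zero ^ 4) $ 2 = b"
  "(vector [a, b, c, d] :: 'a::zero ^ 4) $ 3 = c"
  "(vector [a, b, c, d] :: 'a::zero ^ 4) $ 4 = d"
  unfolding vector_def by simp_all

section \<open>From constant density to the critical band\<close>

context fb_gap
begin

text \<open>When the density is constant, every mode \<open>k \<noteq> 0\<close> has weighted mean
  zero; the Rayleigh inequality for its cosine compares the two numbers.\<close>

lemma lam_le_mu:
  assumes k: "k \<noteq> 0" and l: "\<And>x. lam x = \<Lambda>"
  shows "\<Lambda> \<le> mu T k"
proof -
  define g where "g x = cos (of_int k * x)" for x :: real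
  have ge: "cr g = (\<lambda>x. (1 / 2) * mode k x + (1 / 2) * mode (- k) x)"
    by (auto simp: g_def mode_def complex_eq_iff)
  have Lam_mode: "Lam T (mode j) = (\<lambda>x. of_real (mu T j) * mode j x)" for j
  proof (rule fc_unique)
    show "cper (Lam T (mode j))" by (rule wiener_cper[OF wiener_Lam1[OF T wiener_mode]])
    show "cper (\<lambda>x. of_real (mu T j) * mode j x)" by (intro cper_mult cper_const cper_mode)
    show "fc (Lam T (mode j)) m = fc (\<lambda>x. of_real (mu T j) * mode j x) m" for m
      unfolding fc_Lam1[OF T wiener_mode] fc_cmult fc_mode by simp
  qed
  have wg: "wiener 1 (cr g)" unfolding ge by (intro wiener_add wiener_cmult wiener_mode)
  have gc: "cper g" by (rule cper_of_cr[OF wiener_cper[OF wg]])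
  have V: "Lam T (cr g) = cr (\<lambda>x. mu T k * g x)"
  proof -
    have "Lam T (cr g) = (\<lambda>x. of_real (mu T k) * cr g x)"
      unfolding ge Lam_add[OF T wiener_cmult[OF wiener_mode] wiener_cmult[OF wiener_mode]] Lam_cmult Lam_mode
      by (rule ext) (simp add: fun_cong[OF ge] algebra_simps)
    then show ?thesis by simp
  qed
  have "fc (cr g) 0 = 0"
    unfolding ge fc_add[OF cper_mult[OF cper_const cper_mode] cper_mult[OF cper_const cper_mode]] fc_cmult fc_mode
    using k by simp
  then have "complex_of_real (II g) = 0" using integral_cr[OF gc] by (simp add: fc_0)
  then have "II (\<lambda>x. lam x * g x) = 0" by (simp add: l)
  from rayleigh[OF wg V this] have "0 \<le> II (\<lambda>x. (mu T k - \<Lambda>) * (g x * g x))"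
    by (simp add: l algebra_simps)
  then have 1: "0 \<le> (mu T k - \<Lambda>) * II (\<lambda>x. g x * g x)" by (simp only: integral_mult_right)
  have "II (\<lambda>x. g x * g x) \<ge> 0" by (intro integral_nonneg cper_integrable cper_mult gc) auto
  moreover have "II (\<lambda>x. g x * g x) \<noteq> 0"
    using integral_pos_zero[OF cper_mult[OF gc gc], of 0] by (auto simp: g_def)
  ultimately show ?thesis using 1 by (simp add: zero_le_mult_iff)
qed

text \<open>\<open>Lam h = \<Lambda> h\<close> leaves only modes with
  \<open>mu T k = \<Lambda>\<close>. Here \<open>\<Lambda> > 0\<close> excludes mode 0, and
  \<open>\<Lambda> \<le> mu T 2\<close> excludes all \<open>|k| \<ge> 3\<close>.\<close>

lemma mode_12_form:
  assumes l: "\<And>x. lam x = \<Lambda>"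
  obtains p q r s :: "real ^ 'n" where "\<And>t \<theta>. t \<in> {-T..T} \<Longrightarrow>
    u (t, \<theta>) = sinh t *\<^sub>R (cos \<theta> *\<^sub>R p + sin \<theta> *\<^sub>R q) + cosh (2 * t) *\<^sub>R (cos (2 * \<theta>) *\<^sub>R r + sin (2 * \<theta>) *\<^sub>R s)"
proof -
  have lpos: "\<Lambda> > 0" using lam_pos[of 0] l by simp
  have ne: "mu T k \<noteq> \<Lambda>" if "\<bar>k\<bar> \<noteq> 1" "\<bar>k\<bar> \<noteq> 2" for k
  proof (cases "k = 0")
    case True
    then show ?thesis using lpos by (simp add: mu_def)
  next
    case False
    then have "3 \<le> \<bar>k\<bar>" using that by linarith
    then have "mu T 2 < mu T \<bar>k\<bar>" by (rule mu_high[OF T])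
    also have "mu T \<bar>k\<bar> = mu T k" by (simp add: abs_if)
    finally show ?thesis using lam_le_mu[OF _ l, of 2] by simp
  qed
  have "fc (cr (h i)) k = 0" if "\<bar>k\<bar> \<noteq> 1" "\<bar>k\<bar> \<noteq> 2" for i k
    using fc_lam_h[of i k] ne[OF that] by (auto simp: l fc_cmult)
  then have "\<exists>a b c d. \<forall>t\<in>{-T..T}. \<forall>\<theta>. u (t, \<theta>) $ i
    = sinh t * (a * cos \<theta> + b * sin \<theta>) + cosh (2 * t) * (c * cos (2 * \<theta>) + d * sin (2 * \<theta>))" for i
    using low_modes[OF T u_comp(2,1), of i] by (simp add: h_def)
  then obtain a b c d where "\<And>i t \<theta>. t \<in> {-T..T} \<Longrightarrow> u (t, \<theta>) $ i
    = sinh t * (a i * cos \<theta> + b i * sin \<theta>) + cosh (2 * t) * (c i * cos (2 * \<theta>) + d i * sin (2 * \<theta>))"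
    by metis
  then show ?thesis
    by (intro that[of "\<chi> i. a i" "\<chi> i. b i" "\<chi> i. c i" "\<chi> i. d i"]) (simp add: vec_eq_iff mult.commute)
qed

text \<open>\<open>p\<close>, \<open>q\<close>, \<open>r\<close>, \<open>s\<close> turn out
  orthogonal, the first two twice as long as the others, which is the factor 2 in
  \<open>crit_phi\<close>. The conormal condition then fixes \<open>T\<close>, the unit sphere the
  scale, and \<open>full\<close> the dimension.\<close>

theorem critical_of_gap:
  assumes full: "\<forall>a::real ^ 'n. a \<noteq> 0 \<longrightarrow> (\<exists>p \<in> strip T. inner a (u p) \<noteq> 0)"
  shows "CARD('n) = 4 \<and> (\<exists>L :: real ^ 4 \<Rightarrow> real ^ 'n. linear L \<and> (\<forall>x. norm (L x) = norm x) \<and>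
        L ` critical_mobius_band = u ` strip T)"
proof -
  obtain \<Lambda> where l: "\<And>x. lam x = \<Lambda>" using lam_const by blast
  obtain p q r s :: "real ^ 'n" where u: "\<And>t \<theta>. t \<in> {-T..T} \<Longrightarrow>
    u (t, \<theta>) = sinh t *\<^sub>R (cos \<theta> *\<^sub>R p + sin \<theta> *\<^sub>R q) + cosh (2 * t) *\<^sub>R (cos (2 * \<theta>) *\<^sub>R r + sin (2 * \<theta>) *\<^sub>R s)"
    using mode_12_form[OF l] by metis
  have udt: "dt T u (t, \<theta>) = cosh t *\<^sub>R (cos \<theta> *\<^sub>R p + sin \<theta> *\<^sub>R q)
      + (2 * sinh (2 * t)) *\<^sub>R (cos (2 * \<theta>) *\<^sub>R r + sin (2 * \<theta>) *\<^sub>R s)" if t: "t \<in> {-T..T}" for t \<theta>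
  proof (rule dt_eqI[OF T t], rule has_vector_derivative_transform[OF t], erule u)
    show "((\<lambda>t. sinh t *\<^sub>R (cos \<theta> *\<^sub>R p + sin \<theta> *\<^sub>R q) + cosh (2 * t) *\<^sub>R (cos (2 * \<theta>) *\<^sub>R r + sin (2 * \<theta>) *\<^sub>R s))
      has_vector_derivative cosh t *\<^sub>R (cos \<theta> *\<^sub>R p + sin \<theta> *\<^sub>R q)
      + (2 * sinh (2 * t)) *\<^sub>R (cos (2 * \<theta>) *\<^sub>R r + sin (2 * \<theta>) *\<^sub>R s)) (at t within {-T..T})"
      by (auto intro!: derivative_eq_intros)
  qed
  have udth: "dth u (0, \<theta>) = cos (2 * \<theta>) *\<^sub>R (2 *\<^sub>R s) - sin (2 * \<theta>) *\<^sub>R (2 *\<^sub>R r)" for \<theta>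
  proof (rule dth_eqI)
    have u0: "u (0, \<phi>) = cos (2 * \<phi>) *\<^sub>R r + sin (2 * \<phi>) *\<^sub>R s" for \<phi> using u[of 0] T by simp
    show "((\<lambda>\<phi>. u (0, \<phi>)) has_vector_derivative cos (2 * \<theta>) *\<^sub>R (2 *\<^sub>R s) - sin (2 * \<theta>) *\<^sub>R (2 *\<^sub>R r)) (at \<theta>)"
      unfolding u0 by (auto intro!: derivative_eq_intros)
  qed
  have z: "0 \<in> {-T..T}" "(0, \<theta>) \<in> strip T" for \<theta> using T by (auto simp: strip_def)
  have udt0: "dt T u (0, \<theta>) = cos \<theta> *\<^sub>R p + sin \<theta> *\<^sub>R q" for \<theta> using udt[OF z(1)] by simp
  define v where "v \<theta> = cos \<theta> *\<^sub>R p + sin \<theta> *\<^sub>R q" for \<theta>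
  define w where "w \<theta> = cos (2 * \<theta>) *\<^sub>R (2 *\<^sub>R s) - sin (2 * \<theta>) *\<^sub>R (2 *\<^sub>R r)" for \<theta>
  have c1: "inner (v \<theta>) (v \<theta>) = inner (w \<theta>) (w \<theta>)" and c2: "inner (v \<theta>) (w \<theta>) = 0" for \<theta>
    using conf[OF z(2)[of \<theta>]] unfolding udt0 udth v_def[symmetric] w_def[symmetric]
    by (simp_all add: dot_square_norm)
  \<comment> \<open>Angles 0 and \<open>pi / 2\<close> compare \<open>p\<close> and \<open>q\<close>
    with \<open>s\<close>; \<open>pi / 4\<close> and \<open>3 * pi / 4\<close> bring in
    \<open>r\<close> and the product of \<open>p\<close> and \<open>q\<close>; \<open>pi / 8\<close>
    settles the product of \<open>r\<close> and \<open>s\<close>.\<close>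
  have v: "v 0 = p" "v (pi / 2) = q" "v (pi / 4) = (sqrt 2 / 2) *\<^sub>R (p + q)" "v (3 * pi / 4) = (sqrt 2 / 2) *\<^sub>R (q - p)"
    and w: "w 0 = 2 *\<^sub>R s" "w (pi / 2) = - 2 *\<^sub>R s" "w (pi / 4) = - 2 *\<^sub>R r" "w (3 * pi / 4) = 2 *\<^sub>R r"
      "w (pi / 8) = sqrt 2 *\<^sub>R (s - r)"
  proof -
    have a: "3 * pi / 4 = pi / 2 + pi / 4" "2 * (3 * pi / 4) = pi + pi / 2" by simp_all
    show "v 0 = p" "v (pi / 2) = q" "v (pi / 4) = (sqrt 2 / 2) *\<^sub>R (p + q)"
      by (simp_all add: v_def cos_45 sin_45 algebra_simps)
    show "v (3 * pi / 4) = (sqrt 2 / 2) *\<^sub>R (q - p)"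
      unfolding v_def a(1) cos_add sin_add by (simp add: cos_45 sin_45 algebra_simps)
    show "w 0 = 2 *\<^sub>R s" "w (pi / 2) = - 2 *\<^sub>R s" "w (pi / 4) = - 2 *\<^sub>R r"
      by (simp_all add: w_def)
    show "w (3 * pi / 4) = 2 *\<^sub>R r" unfolding w_def a(2) cos_add sin_add by simp
    have "2 * (pi / 8) = pi / 4" by simp
    then show "w (pi / 8) = sqrt 2 *\<^sub>R (s - r)"
      unfolding w_def by (simp add: cos_45 sin_45 algebra_simps)
  qed
  have ps: "inner p s = 0" "inner p p = 4 * inner s s" using c2[of 0] c1[of 0] by (simp_all add: v w)
  have qs: "inner q s = 0" "inner q q = 4 * inner s s" using c2[of "pi / 2"] c1[of "pi / 2"] by (simp_all add: v w)
  have "inner p r + inner q r = 0" "inner q r - inner p r = 0"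
    using c2[of "pi / 4"] c2[of "3 * pi / 4"] by (simp_all add: v w inner_add_left inner_diff_left)
  then have pr: "inner p r = 0" and qr: "inner q r = 0" by simp_all
  have "inner p p + inner q q + 2 * inner p q = 8 * inner r r" "inner p p + inner q q - 2 * inner p q = 8 * inner r r"
    using c1[of "pi / 4", unfolded v w] c1[of "3 * pi / 4", unfolded v w]
    by (simp_all add: inner_add_left inner_diff_left inner_add_right inner_diff_right inner_commute algebra_simps)
  then have pq: "inner p q = 0" and rr: "inner r r = inner s s" using ps qs by simp_all
  have rs: "inner r s = 0"
  proof -
    have "inner (v (pi / 8)) (v (pi / 8)) = (cos (pi / 8))\<^sup>2 * inner p p + (sin (pi / 8))\<^sup>2 * inner p p"
      using pq trans[OF qs(2) ps(2)[symmetric]] by (simp add: v_def inner_add_left inner_add_right inner_commute algebra_simps power2_eq_square)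
    then have "inner p p = 2 * inner (s - r) (s - r)" using c1[of "pi / 8", unfolded w] by (simp add: distrib_right[symmetric] mult.assoc[symmetric])
    then show ?thesis using ps(2) rr by (simp add: inner_diff_left inner_diff_right inner_commute)
  qed
  define \<rho> where "\<rho> = norm r"
  have r2: "inner r r = \<rho>\<^sup>2" by (simp add: \<rho>_def power2_norm_eq_inner)
  note ip = ps qs pr qr pq rs rr[symmetric] r2
  have "p \<noteq> 0" using imm[OF z(2)[of 0]] udt0[of 0] by simp
  then have \<rho>: "\<rho> > 0" using ip by (auto simp: \<rho>_def)
  have TT': "(T, 0) \<in> strip T" using TT by (simp add: strip_def)
  have bd: "dt T u (T, 0) = \<Lambda> *\<^sub>R u (T, 0)" using bdry(2)[of 0] l[of 0] unfolding lam_def by simp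
  \<comment> \<open>Pairing the conormal condition with \<open>p\<close> and with \<open>r\<close>
    shows that both radial profiles have logarithmic derivative \<open>\<Lambda>\<close> at
    \<open>T\<close>, which is the equation defining \<open>T0\<close>.\<close>
  have "cosh T * inner p p = \<Lambda> * sinh T * inner p p" "2 * sinh (2 * T) * inner r r = \<Lambda> * cosh (2 * T) * inner r r"
    using arg_cong[OF bd, of "inner p"] arg_cong[OF bd, of "inner r"]
    unfolding udt[OF TT] u[OF TT] by (simp_all add: inner_add_right ip inner_commute)
  then have "cosh T / sinh T = \<Lambda>" "2 * tanh (2 * T) = \<Lambda>"
    using \<rho> T ip by (simp_all add: tanh_def field_simps)
  then have T0: "T0 = T" by (intro T0_eqI T) simp
  define D where "D = sqrt (4 * (sinh T)\<^sup>2 + (cosh (2 * T))\<^sup>2)"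
  have "inner (u (T, 0)) (u (T, 0)) = 1" using bdry(1)[of 0] by (simp add: dot_square_norm)
  then have "(4 * (sinh T)\<^sup>2 + (cosh (2 * T))\<^sup>2) * \<rho>\<^sup>2 = 1"
    unfolding u[OF TT] by (simp add: inner_add_right inner_add_left ip inner_commute power2_eq_square algebra_simps)
  then have "(D * \<rho>)\<^sup>2 = 1" by (simp add: D_def power_mult_distrib)
  moreover have "0 \<le> D * \<rho>" using \<rho> by (simp add: D_def)
  ultimately have D1: "D * \<rho> = 1" unfolding power2_eq_1_iff by linarith
  have D: "1 / D = \<rho>" by (rule inverse_unique[OF D1, unfolded inverse_eq_divide])
  define L :: "real ^ 4 \<Rightarrow> real ^ 'n" where
    "L x = (x $ 1 / (2 * \<rho>)) *\<^sub>R p + (x $ 2 / (2 * \<rho>)) *\<^sub>R q + (x $ 3 / \<rho>) *\<^sub>R r + (x $ 4 / \<rho>) *\<^sub>R s" for x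
  have lin: "linear L"
    by (rule linearI) (simp_all add: L_def algebra_simps add_divide_distrib)
  have nL: "norm (L x) = norm x" for x
  proof -
    have "inner (L x) (L x) = x $ 1 * x $ 1 + x $ 2 * x $ 2 + x $ 3 * x $ 3 + x $ 4 * x $ 4"
      using \<rho> unfolding L_def by (simp add: inner_add_right inner_add_left ip inner_commute power2_eq_square)
    also have "\<dots> = inner x x" by (simp add: inner_vec_def sum_4)
    finally have "inner (L x) (L x) = inner x x" .
    then show ?thesis by (simp add: norm_eq_sqrt_inner)
  qed
  have "L ((1 / sqrt (4 * (sinh T0)\<^sup>2 + (cosh (2 * T0))\<^sup>2)) *\<^sub>R crit_phi y) = u y" if yT: "y \<in> strip T" for y
  proof -
    obtain t \<theta> where y: "y = (t, \<theta>)" "t \<in> {-T..T}" using yT by (auto simp: strip_def)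
    show ?thesis
      unfolding y(1) u[OF y(2)] T0 D_def[symmetric] D
      using \<rho> by (simp add: L_def crit_phi_def algebra_simps)
  qed
  then have im: "L ` critical_mobius_band = u ` strip T"
    unfolding critical_mobius_band_def T0 image_image by (intro image_cong) auto
  have inj: "inj L" using nL by (intro linear_injective_0[OF lin, THEN iffD2]) (metis norm_eq_zero)
  have "dim (range L) = dim (UNIV :: (real ^ 4) set)"
    using inj by (intro dim_image_eq lin) (auto simp: inj_on_def)
  then have d4: "dim (range L) = 4" by simp
  \<comment> \<open>The surface lies in \<open>range L\<close>; a nonzero vector orthogonal to that
    subspace would contradict \<open>full\<close>.\<close>
  have "dim (range L) = DIM(real ^ 'n)"
  proof (rule ccontr)
    assume "dim (range L) \<noteq> DIM(real ^ 'n)"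
    then have "dim (range L) < DIM(real ^ 'n)" using dim_subset_UNIV[of "range L"] by simp
    from orthogonal_to_subspace_exists[OF this] obtain a where
      a: "a \<noteq> 0" "\<And>y. y \<in> span (range L) \<Longrightarrow> orthogonal a y" by blast
    obtain y where y: "y \<in> strip T" "inner a (u y) \<noteq> 0" using full a(1) by blast
    then have "u y \<in> range L" using im by blast
    then show False using a(2)[of "u y"] y(2) by (simp add: span_base orthogonal_def)
  qed
  then have "CARD('n) = 4" using d4 by simp
  then show ?thesis using lin nL im by blast
qed

end

theorem theorem7p4:
  fixes u :: "real \<times> real \<Rightarrow> real ^ 'n" and T :: real
  assumes "fb_minimal_mobius T u"
    and full: "\<forall>a::real ^ 'n. a \<noteq> 0 \<longrightarrow> (\<exists>p \<in> strip T. inner a (u p) \<noteq> 0)"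
    and "\<forall>i. first_steklov_eigenfunction T u (\<lambda>p. u p $ i)"
  shows "CARD('n) = 4 \<and>
    (\<exists>L :: real ^ 4 \<Rightarrow> real ^ 'n. linear L \<and> (\<forall>x. norm (L x) = norm x) \<and>
        L ` critical_mobius_band = u ` strip T)"
proof -
  interpret fb_mobius u T by unfold_locales (rule assms(1))
  \<comment> \<open>At a boundary point where some coordinate is nonzero, the eigenfunction
    condition and the conormal condition agree only if \<open>sigma1 T u = 1\<close>.\<close>
  obtain i where i: "h i 0 \<noteq> 0"
  proof -
    have "\<not> (\<forall>i. h i 0 = 0)"
    proof
      assume "\<forall>i. h i 0 = 0"
      then have "(\<Sum>i\<in>UNIV. (h i 0)\<^sup>2) = 0" by simp
      then show False unfolding sum_h_sq by simp
    qed
    then show thesis using that by blast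
  qed
  have "dt T (\<lambda>p. u p $ i) (T, 0) = sigma1 T u * norm (dt T u (T, 0)) * u (T, 0) $ i"
    using assms(3) unfolding first_steklov_eigenfunction_def steklov_eigenfunction_def by blast
  then have "lam 0 * h i 0 = sigma1 T u * (lam 0 * h i 0)"
    using u_comp(4)[of "(T, 0)" i] dt_u_T[of 0 i] TT by (auto simp: strip_def lam_def[symmetric] h_def[symmetric])
  then have s1: "sigma1 T u = 1" using i lam_pos[of 0] by simp
  interpret fb_gap u T
  proof unfold_locales
    fix \<sigma> :: real
    assume s: "0 < \<sigma>" "\<sigma> < 1"
    show "\<not> steklov_eigenvalue T u \<sigma>"
    proof
      assume "steklov_eigenvalue T u \<sigma>"
      \<comment> \<open>The infimum is a true lower bound because the set consists of positive
        numbers.\<close>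
      then have "Inf {\<sigma>. \<sigma> > 0 \<and> steklov_eigenvalue T u \<sigma>} \<le> \<sigma>"
        using s by (intro cInf_lower bdd_belowI[of _ 0]) auto
      then show False using s1 s by (simp add: sigma1_def)
    qed
  qed
  show ?thesis by (rule critical_of_gap[OF full])
qed

end
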